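(* Let $n\ge 1$, $\alpha\in\mathbf R$, $\beta,\gamma>0$, $1\le p,q<\infty$ and $\frac{2n}{2n-1}<m<2$. Then the following are equivalent: (i) $P_{\beta m}$ extends to a bounded operator from $L^p_{\alpha m}$ into $L^q_{\gamma m}$; (ii) either $q<q_{\max}$, or $q=q_{\max}=p$, where $q_{\max}=\frac{4\gamma}{\beta^2}\left(\beta-\frac{\alpha}{p}\right)$.
   Context: For $\alpha\in\mathbf R$, $m>0$ let $d\mu_{\alpha m}(z)=e^{-\alpha|z|^{2m}}\,dz$ on $\mathbf C^n$ ($dz$ Lebesgue measure), and $L^p_{\alpha m}=L^p(\mathbf C^n,d\mu_{\alpha m})$. For $\beta>0$, $H^2_{\beta m}$ is the closed subspace of entire functions in $L^2_{\beta m}$; its reproducing kernel is $K_{\beta m}(x,y)=\frac{m\beta^{n/m}}{\pi^n}\sum_{k=0}^\infty \frac{(\beta^{1/m}\langle x,y\rangle)^k}{k!}\frac{\Gamma(n+k)}{\Gamma(\frac{n+k}{m})}$, and $P_{\beta m}f(x)=\int f(y)K_{\beta m}(x,y)\,d\mu_{\beta m}(y)$ is the orthogonal projection of $L^2_{\beta m}$ onto $H^2_{\beta m}$. "$P_{\beta m}$ is bounded from $L^p_{\alpha m}$ into $L^q_{\gamma m}$" means that $P_{\beta m}$, defined by this integral on $L^2_{\beta m}\cap L^p_{\alpha m}$, extends by continuity to a bounded operator $L^p_{\alpha m}\to L^q_{\gamma m}$. *)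

theory Defs
  imports "HOL-Analysis.Analysis"
begin

text \<open>Points of C^n are modelled as complex ^ 'n with n = CARD('n);
  lborel on this type is Lebesgue measure on C^n = R^(2n), and norm is the Euclidean norm.\<close>

definition cinner :: "complex ^ 'n \<Rightarrow> complex ^ 'n \<Rightarrow> complex" where
  "cinner x y = (\<Sum>i\<in>UNIV. x $ i * cnj (y $ i))"

definition mu :: "real \<Rightarrow> real \<Rightarrow> (complex ^ 'n::finite) measure" where
  "mu \<alpha> m = density lborel (\<lambda>z. ennreal (exp (- \<alpha> * norm z powr (2 * m))))"

definition inLp :: "'a measure \<Rightarrow> real \<Rightarrow> ('a \<Rightarrow> complex) \<Rightarrow> bool" where
  "inLp M p f \<longleftrightarrow> f \<in> borel_measurable M \<and> (\<integral>\<^sup>+ x. ennreal (norm (f x) powr p) \<partial>M) < \<infinity>"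

definition Lpnorm :: "'a measure \<Rightarrow> real \<Rightarrow> ('a \<Rightarrow> complex) \<Rightarrow> real" where
  "Lpnorm M p f = (enn2real (\<integral>\<^sup>+ x. ennreal (norm (f x) powr p) \<partial>M)) powr (1 / p)"

definition bergK :: "real \<Rightarrow> real \<Rightarrow> complex ^ 'n::finite \<Rightarrow> complex ^ 'n \<Rightarrow> complex" where
  "bergK \<beta> m x y =
     complex_of_real (m * \<beta> powr (real CARD('n) / m) / pi ^ CARD('n)) *
     (\<Sum>k. (complex_of_real (\<beta> powr (1 / m)) * cinner x y) ^ k / of_nat (fact k) *
          complex_of_real (Gamma (real CARD('n) + real k) / Gamma ((real CARD('n) + real k) / m)))"

definition Pproj :: "real \<Rightarrow> real \<Rightarrow> (complex ^ 'n::finite \<Rightarrow> complex) \<Rightarrow> complex ^ 'n \<Rightarrow> complex" where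
  "Pproj \<beta> m f x = (\<integral> y. f y * bergK \<beta> m x y \<partial>(mu \<beta> m))"

text \<open>P_{beta m} (defined on L^2_{beta m} \<inter> L^p_{alpha m}) extends to a bounded operator
  L^p_{alpha m} \<rightarrow> L^q_{gamma m}.\<close>
definition P_bounded :: "'n::finite itself \<Rightarrow> real \<Rightarrow> real \<Rightarrow> real \<Rightarrow> real \<Rightarrow> real \<Rightarrow> real \<Rightarrow> bool" where
  "P_bounded _ \<beta> m \<alpha> p \<gamma> q \<longleftrightarrow>
     (\<exists>C. \<forall>f :: complex ^ 'n \<Rightarrow> complex.
        inLp (mu \<beta> m) 2 f \<and> inLp (mu \<alpha> m) p f \<longrightarrow>
        inLp (mu \<gamma> m) q (Pproj \<beta> m f) \<and>
        Lpnorm (mu \<gamma> m) q (Pproj \<beta> m f) \<le> C * Lpnorm (mu \<alpha> m) p f)"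

end

theory Submission
  imports Defs
begin

text \<open>Write the kernel as \<open>F(\<beta>\<^bsup>1/m\<^esup> \<langle>x, y\<rangle>)\<close> with \<open>F(z) = \<Sum> c\<^sub>k z\<^sup>k\<close>,
  \<open>c\<^sub>k = \<Gamma>(n + k) / (k! \<Gamma>((n + k) / m))\<close>; after moving the weights into the kernel the question is
  whether \<open>e\<^bsup>-a |x|\<^bsup>2m\<^esup>\<^esup> F e\<^bsup>-b |y|\<^bsup>2m\<^esup>\<^esup>\<close> with \<open>a = \<gamma> / q\<close>, \<open>b = \<beta> - \<alpha> / p\<close> maps \<open>L\<^sup>p\<close> to \<open>L\<^sup>q\<close>
  for Lebesgue measure, and \<open>q < q\<^sub>m\<^sub>a\<^sub>x\<close> means \<open>\<beta>\<^sup>2 < 4 a b\<close>.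

  In the subcritical case \<open>|F(z)| \<le> C e\<^bsup>(1 + \<epsilon>) |z|\<^sup>m\<^esup>\<close> dominates the kernel by a product of Gaussian-like
  factors. In the critical case \<open>p = q\<close> the Schur test applies. The integral of \<open>|F|\<close> against a radial
  weight only sees the means of \<open>|F|\<close> over circles. These are bounded by Cauchy--Schwarz and Bessel's
  inequality after multiplying \<open>F\<close> by \<open>1 - \<rho> \<zeta>\<close>, which replaces the coefficients by their differences;
  comparing the bound with a power series in \<open>|\<langle>x, y\<rangle>|\<^sup>2\<close>, whose terms integrate explicitly, gives a series
  comparable with \<open>e\<^bsup>a |x|\<^bsup>2m\<^esup>\<^esup>\<close>. No asymptotic expansion of \<open>F\<close> is needed.

  For necessity the test functions are \<open>y\<^sup>\<nu> e\<^bsup>-c |y|\<^bsup>2m\<^esup>\<^esup>\<close> (truncated), which \<open>P\<close> maps to multiples of \<open>y\<^sup>\<nu>\<close>.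
  Stirling's formula for the moments gives an exponential rate in \<open>|\<nu>|\<close> that forces \<open>q \<le> q\<^sub>m\<^sub>a\<^sub>x\<close>, and for
  \<open>q = q\<^sub>m\<^sub>a\<^sub>x\<close> a power of \<open>|\<nu>|\<close> with exponent \<open>(d/2 + n/m - n)(1/q - 1/p)\<close> when \<open>d\<close> of the coordinates are
  active. For \<open>d = 1\<close> the first factor is negative since \<open>m > 2n/(2n - 1)\<close>, for \<open>d = n\<close> it is positive
  since \<open>m < 2\<close>; hence \<open>p = q\<close>.\<close>

section \<open>Ratios of Gamma functions\<close>

text \<open>At the critical exponent the Schur test leaves no room even for a power of
  \<open>|x|\<close>. With \<open>s = |z|^m\<close> and \<open>h = n - n/m\<close>, \<open>F\<close>
  has size \<open>s^h e^s\<close> near the positive axis, but its circle mean has order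
  \<open>s^(h - 1/2) e^s\<close>, because it lives on an arc of width about \<open>s^(-1/2)\<close>.
  The triangle inequality does not see this arc, and plain Cauchy-Schwarz with Bessel yields
  \<open>s^(h - 1/4) e^s\<close>; either surplus power would survive the integration. The terms of
  the series form a bell of width about \<open>sqrt s\<close> around \<open>k = m s\<close>, so
  their differences are smaller by \<open>s^(-1/2)\<close>, and damping with
  \<open>1 - \<rho>\<close> of order \<open>s^(-1/2)\<close> turns this gain into the true order.
  The comparison series has at least this order, yet integrates to a pure exponential without any
  power. Constants never matter, so Gamma quotients are estimated by log-convexity alone; only
  necessity needs Stirling's formula, with a bounded error in the logarithm.\<close>

lemma ln_Gamma_convex:
  fixes u v x y z :: real
  assumes "x > 0" "y > 0" "0 \<le> u" "0 \<le> v" "u + v > 0" "(u + v) * z = u * x + v * y"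
  shows "(u + v) * ln (Gamma z) \<le> u * ln (Gamma x) + v * ln (Gamma y)"
proof -
  define t where "t = v / (u + v)"
  have t: "0 \<le> t" "t \<le> 1" "(u + v) * t = v" "(u + v) * (1 - t) = u"
    using assms by (auto simp: t_def field_simps)
  have "(u + v) * z = (u + v) * ((1 - t) * x + t * y)"
    using assms t by (simp add: distrib_left mult.assoc[symmetric])
  hence z: "z = (1 - t) * x + t * y" using assms by simp
  have "ln (Gamma z) \<le> (1 - t) * ln (Gamma x) + t * ln (Gamma y)"
    using convex_onD[OF log_convex_Gamma_real, of t x y] assms t by (simp add: z)
  hence "(u + v) * ln (Gamma z) \<le> (u + v) * ((1 - t) * ln (Gamma x) + t * ln (Gamma y))"
    using assms by (intro mult_left_mono) auto
  thus ?thesis using t by (simp add: distrib_left mult.assoc[symmetric])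
qed

lemma ln_Gamma_Suc:
  fixes x :: real
  assumes "x > 0"
  shows "ln (Gamma (x + 1)) = ln (Gamma x) + ln x"
proof -
  have "Gamma (x + 1) = x * Gamma x"
    using assms nonpos_Ints_nonpos[of x] by (intro Gamma_plus1) auto
  moreover have "Gamma x \<noteq> 0" using Gamma_real_pos[OF assms] by simp
  ultimately show ?thesis using assms by (simp add: ln_mult)
qed

lemma Gamma_powr_leI:
  fixes x y a b :: real
  assumes "x > 0" "y > 0" "b > 0" "ln (Gamma x) \<le> ln (Gamma y) + a * ln b"
  shows "Gamma x \<le> Gamma y * b powr a"
proof -
  have "ln (Gamma x) \<le> ln (Gamma y * b powr a)"
    using assms Gamma_real_pos[OF \<open>y > 0\<close>] less_imp_neq[OF Gamma_real_pos[OF \<open>y > 0\<close>]]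
    by (simp add: ln_mult)
  thus ?thesis
    using assms Gamma_real_pos[of y] Gamma_real_pos[of x] by (subst (asm) ln_le_cancel_iff) auto
qed

text \<open>Log-convexity at \<open>y + d\<close>, which divides the segment from \<open>y\<close>
  to \<open>y + d + 1\<close> with weights 1 and \<open>d\<close>; the functional equation then
  removes \<open>Gamma (y + d + 1)\<close>. There is no upper bound on \<open>d\<close>, hence the
  larger point as base of the power.\<close>

lemma Gamma_add_le:
  fixes y d :: real
  assumes "y > 0" "d \<ge> 0"
  shows "Gamma (y + d) \<le> Gamma y * (y + d) powr d"
proof -
  have "(1 + d) * ln (Gamma (y + d)) \<le> 1 * ln (Gamma y) + d * ln (Gamma (y + d + 1))"
    using assms by (intro ln_Gamma_convex) (auto simp: algebra_simps)
  hence "ln (Gamma (y + d)) \<le> ln (Gamma y) + d * ln (y + d)"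
    using assms ln_Gamma_Suc[of "y + d"] by (simp add: algebra_simps)
  thus ?thesis
    using assms by (intro Gamma_powr_leI) (auto simp: algebra_simps)
qed

text \<open>Log-convexity at \<open>y + 1\<close>, between \<open>y\<close> with weight
  \<open>d\<close> and \<open>y + 1 + d\<close> with weight 1. The quotient
  \<open>(y + d) / y\<close> is left over from the functional equation at both ends.\<close>

lemma Gamma_add_ge:
  fixes y d :: real
  assumes "y > 0" "d \<ge> 0"
  shows "Gamma y * y powr d \<le> Gamma (y + d) * ((y + d) / y)"
proof -
  have "(d + 1) * ln (Gamma (y + 1)) \<le> d * ln (Gamma y) + 1 * ln (Gamma (y + 1 + d))"
    using assms by (intro ln_Gamma_convex) (auto simp: algebra_simps)
  hence "ln (Gamma (y + 1)) + d * ln y \<le> ln (Gamma (y + d + 1))"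
    using assms ln_Gamma_Suc[of y] by (simp add: algebra_simps)
  hence "ln (Gamma y) \<le> ln (Gamma (y + d)) + 1 * (ln (y + d) - ln y - d * ln y)"
    using assms ln_Gamma_Suc[of y] ln_Gamma_Suc[of "y + d"] by (simp add: algebra_simps)
  also have "ln (y + d) - ln y - d * ln y = ln ((y + d) / y * y powr (- d))"
    using assms by (simp add: ln_mult ln_div del: powr_minus)
  finally have "Gamma y \<le> Gamma (y + d) * ((y + d) / y * y powr (- d)) powr 1"
    using assms by (intro Gamma_powr_leI) auto
  hence "Gamma y * y powr d \<le> Gamma (y + d) * ((y + d) / y * y powr (- d)) * y powr d"
    using assms by (intro mult_right_mono) auto
  also have "\<dots> = Gamma (y + d) * ((y + d) / y) * (y powr (- d) * y powr d)"
    by (simp only: mult_ac)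
  also have "y powr (- d) * y powr d = 1"
    using assms by (simp add: powr_add[symmetric])
  finally show ?thesis by simp
qed

lemma Gamma_add_ge':
  fixes y d :: real
  assumes "y \<ge> 1" "d \<ge> 0"
  shows "Gamma y * y powr d \<le> Gamma (y + d) * (1 + d)"
proof -
  have "(y + d) / y \<le> 1 + d"
    using assms mult_left_mono[of 1 y d] by (simp add: field_simps)
  hence "Gamma (y + d) * ((y + d) / y) \<le> Gamma (y + d) * (1 + d)"
    using assms Gamma_real_pos[of "y + d"] by (intro mult_left_mono) auto
  thus ?thesis using Gamma_add_ge[of y d] assms by linarith
qed

lemma Gamma_add_le':
  fixes y d :: real
  assumes "y \<ge> 1" "d \<ge> 0"
  shows "Gamma (y + d) \<le> Gamma y * y powr d * (1 + d) powr d"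
proof -
  have "(y + d) powr d \<le> (y * (1 + d)) powr d"
    using assms mult_left_mono[of 1 y d] by (intro powr_mono2) (auto simp: algebra_simps)
  also have "\<dots> = y powr d * (1 + d) powr d"
    using assms by (simp add: powr_mult)
  finally have "Gamma y * (y + d) powr d \<le> Gamma y * (y powr d * (1 + d) powr d)"
    using assms Gamma_real_pos[of y] by (intro mult_left_mono) auto
  hence "Gamma y * (y + d) powr d \<le> Gamma y * y powr d * (1 + d) powr d"
    by (simp add: mult.assoc)
  thus ?thesis using Gamma_add_le[of y d] assms by linarith
qed

text \<open>For \<open>d\<close> up to 1, plain interpolation between \<open>y\<close> and
  \<open>y + 1\<close> has constant 1. \<open>kcoeff_step\<close> depends on this: it measures the
  deviation of a Gamma quotient from a power, which any other constant factor would swamp.\<close>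

lemma Gamma_add_le_unit:
  fixes y d :: real
  assumes "y > 0" "0 \<le> d" "d \<le> 1"
  shows "Gamma (y + d) \<le> Gamma y * y powr d"
proof -
  have "((1 - d) + d) * ln (Gamma (y + d)) \<le> (1 - d) * ln (Gamma y) + d * ln (Gamma (y + 1))"
    using assms by (intro ln_Gamma_convex) (auto simp: algebra_simps)
  hence "ln (Gamma (y + d)) \<le> ln (Gamma y) + d * ln y"
    using assms ln_Gamma_Suc[of y] by (simp add: algebra_simps)
  thus ?thesis using assms by (intro Gamma_powr_leI) auto
qed

text \<open>Interpolates \<open>y\<close> between \<open>y + d - 1\<close> and \<open>y + d\<close>.
  The base \<open>y + d - 1\<close> differs from the base in \<open>Gamma_add_le_unit\<close> by at
  most 1, the accuracy that \<open>kcoeff_step\<close> needs.\<close>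

lemma Gamma_add_ge_unit:
  fixes y d :: real
  assumes "y + d > 1" "0 \<le> d" "d \<le> 1"
  shows "Gamma y * (y + d - 1) powr d \<le> Gamma (y + d)"
proof -
  have y: "y > 0" using assms by linarith
  have "((1 - d) + d) * ln (Gamma y) \<le> (1 - d) * ln (Gamma (y + d)) + d * ln (Gamma (y + d - 1))"
    using assms by (intro ln_Gamma_convex) (auto simp: algebra_simps)
  hence "ln (Gamma y) \<le> ln (Gamma (y + d)) + (- d) * ln (y + d - 1)"
    using assms ln_Gamma_Suc[of "y + d - 1"] by (simp add: algebra_simps)
  hence "Gamma y \<le> Gamma (y + d) * (y + d - 1) powr (- d)"
    using assms y by (intro Gamma_powr_leI) auto
  hence "Gamma y * (y + d - 1) powr d \<le> Gamma (y + d) * (y + d - 1) powr (- d) * (y + d - 1) powr d"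
    by (intro mult_right_mono) auto
  also have "\<dots> = Gamma (y + d) * ((y + d - 1) powr (- d) * (y + d - 1) powr d)"
    by (simp only: mult_ac)
  also have "(y + d - 1) powr (- d) * (y + d - 1) powr d = 1"
    using assms by (simp add: powr_add[symmetric])
  finally show ?thesis by simp
qed

text \<open>The general term of the exponential series, continued to real index: the kernel is a
  series in steps of \<open>1 / m\<close>, whose terms lie between those of integer index. Since
  \<open>0 powr 0 = 0\<close>, \<open>expterm 0 0\<close> vanishes, and the point
  \<open>s = 0\<close> is kept apart.\<close>

definition expterm :: "real \<Rightarrow> real \<Rightarrow> real" where
  "expterm x s = s powr x / Gamma (x + 1)"

lemma expterm_nonneg: "x \<ge> 0 \<Longrightarrow> expterm x s \<ge> 0"
  unfolding expterm_def using Gamma_real_pos[of "x + 1"] by (intro divide_nonneg_pos) auto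

lemma expterm_nat: "s > 0 \<Longrightarrow> expterm (real j) s = s ^ j / fact j"
  unfolding expterm_def by (simp add: powr_realpow Gamma_fact add.commute)

text \<open>Up to a constant depending on the window length \<open>D\<close>, the terms fall with
  the index beyond \<open>s\<close> and rise before it. So the left end dominates if
  \<open>s \<le> 1 + a\<close> and the right end otherwise; adding both ends avoids the
  distinction.\<close>

lemma expterm_interpolate:
  assumes "D \<ge> 0" "0 \<le> a" "a \<le> x" "x \<le> b" "b \<le> a + D" "s > 0"
  shows "expterm x s \<le> ((1 + D) powr D + (1 + D)) * (expterm a s + expterm b s)"
proof (cases "s \<le> 1 + a")
  case True
  have pos: "Gamma (x + 1) > 0" "Gamma (a + 1) > 0" using assms by (auto intro: Gamma_real_pos)
  have "Gamma (a + 1) * (a + 1) powr (x - a) \<le> Gamma (x + 1) * (1 + (x - a))"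
    using Gamma_add_ge'[of "a + 1" "x - a"] assms by (simp add: algebra_simps)
  also have "\<dots> \<le> Gamma (x + 1) * (1 + D)" using assms pos by (intro mult_left_mono) auto
  finally have *: "Gamma (a + 1) * (a + 1) powr (x - a) \<le> Gamma (x + 1) * (1 + D)" .
  have "s powr x = s powr a * s powr (x - a)" by (simp add: powr_add[symmetric])
  also have "\<dots> \<le> s powr a * (a + 1) powr (x - a)"
    using assms True by (intro mult_left_mono powr_mono2) auto
  finally have "s powr x * Gamma (a + 1) \<le> s powr a * (a + 1) powr (x - a) * Gamma (a + 1)"
    using pos by (intro mult_right_mono) auto
  also have "\<dots> \<le> s powr a * (Gamma (x + 1) * (1 + D))"
    using mult_left_mono[OF *, of "s powr a"] by (simp add: mult_ac)
  finally have "expterm x s \<le> (1 + D) * expterm a s"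
    unfolding expterm_def using pos by (simp add: field_simps)
  also have "\<dots> \<le> ((1 + D) powr D + (1 + D)) * (expterm a s + expterm b s)"
    using assms expterm_nonneg[of a s] expterm_nonneg[of b s] by (intro mult_mono) auto
  finally show ?thesis .
next
  case False
  have pos: "Gamma (x + 1) > 0" "Gamma (b + 1) > 0" using assms by (auto intro: Gamma_real_pos)
  have *: "Gamma (b + 1) \<le> Gamma (x + 1) * (b + 1) powr (b - x)"
    using Gamma_add_le[of "x + 1" "b - x"] assms by (simp add: algebra_simps)
  have "b + 1 \<le> (1 + D) * (a + 1)"
    using assms mult_nonneg_nonneg[OF \<open>D \<ge> 0\<close> \<open>0 \<le> a\<close>] unfolding distrib_left distrib_right by linarith
  also have "\<dots> \<le> (1 + D) * s" using False assms by (intro mult_left_mono) auto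
  finally have "(b + 1) powr (b - x) \<le> ((1 + D) * s) powr (b - x)"
    using assms by (intro powr_mono2) auto
  also have "\<dots> = (1 + D) powr (b - x) * s powr (b - x)" using assms by (simp add: powr_mult)
  also have "\<dots> \<le> (1 + D) powr D * s powr (b - x)"
    using assms by (intro mult_right_mono powr_mono) auto
  finally have **: "(b + 1) powr (b - x) \<le> (1 + D) powr D * s powr (b - x)" .
  have "s powr x * Gamma (b + 1) \<le> s powr x * (Gamma (x + 1) * (b + 1) powr (b - x))"
    using * by (intro mult_left_mono) auto
  also have "\<dots> \<le> s powr x * (Gamma (x + 1) * ((1 + D) powr D * s powr (b - x)))"
    using ** pos by (intro mult_left_mono) auto
  also have "\<dots> = (1 + D) powr D * (s powr x * s powr (b - x)) * Gamma (x + 1)" by (simp add: mult_ac)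
  also have "s powr x * s powr (b - x) = s powr b" by (simp add: powr_add[symmetric])
  finally have "expterm x s \<le> (1 + D) powr D * expterm b s"
    unfolding expterm_def using pos by (simp add: field_simps)
  also have "\<dots> \<le> ((1 + D) powr D + (1 + D)) * (expterm a s + expterm b s)"
    using assms expterm_nonneg[of a s] expterm_nonneg[of b s] by (intro mult_mono) auto
  finally show ?thesis .
qed

text \<open>For a natural number \<open>B\<close>, \<open>S^x / (x - B)!\<close> is
  \<open>S^B\<close> times the term of index \<open>x - B\<close>, and also a falling factorial of
  \<open>x\<close> times the term of index \<open>x\<close>. A power of the index thus acts as a
  shift by \<open>B\<close>; up to a constant this persists for real \<open>B\<close> of either
  sign.\<close>

lemma expterm_shift_upper:
  assumes "x \<ge> 0" "x - B \<ge> 0" "S > 0"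
  shows "(1 + x) powr B * expterm x S \<le> (1 + \<bar>B\<bar>) powr (1 + \<bar>B\<bar>) * S powr B * expterm (x - B) S"
proof -
  have pos: "Gamma (x + 1) > 0" "Gamma (x - B + 1) > 0" using assms by (auto intro!: Gamma_real_pos)
  have "(1 + x) powr B * Gamma (x - B + 1) \<le> (1 + \<bar>B\<bar>) powr (1 + \<bar>B\<bar>) * Gamma (x + 1)"
  proof (cases "B \<ge> 0")
    case True
    have "1 + x \<le> (x - B + 1) * (1 + B)"
      using True assms mult_nonneg_nonneg[of "x - B" B] by (simp add: algebra_simps)
    hence "(1 + x) powr B \<le> ((x - B + 1) * (1 + B)) powr B"
      using True assms by (intro powr_mono2) auto
    also have "\<dots> = (x - B + 1) powr B * (1 + B) powr B" using True assms by (simp add: powr_mult)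
    finally have "(1 + x) powr B * Gamma (x - B + 1) \<le>
        (x - B + 1) powr B * (1 + B) powr B * Gamma (x - B + 1)"
      using pos by (intro mult_right_mono) auto
    also have "\<dots> = (1 + B) powr B * (Gamma (x - B + 1) * (x - B + 1) powr B)" by (simp add: mult_ac)
    also have "\<dots> \<le> (1 + B) powr B * (Gamma (x - B + 1 + B) * (1 + B))"
      using True assms by (intro mult_left_mono Gamma_add_ge') auto
    also have "\<dots> = (1 + \<bar>B\<bar>) powr (1 + \<bar>B\<bar>) * Gamma (x + 1)"
      using True by (simp add: powr_add algebra_simps)
    finally show ?thesis .
  next
    case False
    have "(1 + x) powr B * Gamma (x + 1 + (- B)) \<le>
        (1 + x) powr B * (Gamma (x + 1) * (x + 1) powr (- B) * (1 + (- B)) powr (- B))"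
      using False assms by (intro mult_left_mono Gamma_add_le') auto
    also have "\<dots> = ((1 + x) powr B * (1 + x) powr (- B)) * (1 + (- B)) powr (- B) * Gamma (x + 1)"
      by (simp only: mult_ac add.commute)
    also have "(1 + x) powr B * (1 + x) powr (- B) = 1"
      using assms by (simp add: powr_add[symmetric])
    also have "1 * (1 + (- B)) powr (- B) \<le> (1 + \<bar>B\<bar>) powr (1 + \<bar>B\<bar>)"
      using False by (simp add: powr_mono)
    finally show ?thesis using pos by (simp add: algebra_simps)
  qed
  hence "S powr x * ((1 + x) powr B * Gamma (x - B + 1)) \<le>
      S powr x * ((1 + \<bar>B\<bar>) powr (1 + \<bar>B\<bar>) * Gamma (x + 1))"
    by (intro mult_left_mono) auto
  hence "(1 + x) powr B * expterm x S \<le> (1 + \<bar>B\<bar>) powr (1 + \<bar>B\<bar>) * (S powr x / Gamma (x - B + 1))"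
    unfolding expterm_def using pos by (simp add: field_simps)
  also have "S powr x = S powr B * S powr (x - B)" by (simp add: powr_add[symmetric])
  finally show ?thesis unfolding expterm_def by (simp add: mult_ac)
qed

text \<open>The direction opposite to \<open>expterm_shift_upper\<close>, for nonnegative shifts;
  \<open>Gamma_add_le\<close> carries no constant, so neither does this bound.\<close>

lemma expterm_shift_lower:
  assumes "0 \<le> A" "A \<le> x" "S > 0"
  shows "S powr A * expterm (x - A) S \<le> (1 + x) powr A * expterm x S"
proof -
  have pos: "Gamma (x + 1) > 0" "Gamma (x - A + 1) > 0" using assms by (auto intro!: Gamma_real_pos)
  have "Gamma (x + 1) \<le> Gamma (x - A + 1) * (1 + x) powr A"
    using Gamma_add_le[of "x - A + 1" A] assms by (simp add: algebra_simps)
  hence "S powr x * Gamma (x + 1) \<le> S powr x * (Gamma (x - A + 1) * (1 + x) powr A)"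
    by (intro mult_left_mono) auto
  moreover have "S powr A * S powr (x - A) = S powr x" by (simp add: powr_add[symmetric])
  ultimately show ?thesis
    unfolding expterm_def using pos by (simp add: field_simps)
qed

section \<open>Sums of exponential type\<close>

text \<open>Growth over two steps means that \<open>\<psi>\<close> takes each value at most twice:
  its even and odd subsequences are strictly increasing. It will be the integer part of an
  arithmetic progression whose step is at least 1/2.\<close>

lemma suminf_reindex_le:
  fixes u :: "nat \<Rightarrow> ennreal"
  assumes "\<And>k. \<psi> k < \<psi> (k + 2)"
  shows "(\<Sum>k. u (\<psi> k)) \<le> 2 * (\<Sum>k. u k)"
proof -
  have mono: "strict_mono (\<lambda>i. \<psi> (2 * i + e))" for e
    unfolding strict_mono_Suc_iff using assms[of "2 * _ + e"] by (simp add: algebra_simps)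
  have half: "(\<Sum>i<N. u (\<psi> (2 * i + e))) \<le> (\<Sum>k. u k)" for N e
  proof -
    have inj: "inj_on (\<lambda>i. \<psi> (2 * i + e)) {..<N}"
      using strict_mono_imp_inj_on[OF mono[of e]] by (blast intro: inj_on_subset)
    have "(\<Sum>i<N. u (\<psi> (2 * i + e))) = sum u ((\<lambda>i. \<psi> (2 * i + e)) ` {..<N})"
      by (simp add: sum.reindex[OF inj])
    also have "\<dots> \<le> (\<Sum>k. u k)" by (intro sum_le_suminf) auto
    finally show ?thesis .
  qed
  have "(\<Sum>k<N. u (\<psi> k)) \<le> 2 * (\<Sum>k. u k)" for N
  proof -
    have split: "(\<Sum>k<2 * N. u (\<psi> k)) = (\<Sum>i<N. u (\<psi> (2 * i + 0))) + (\<Sum>i<N. u (\<psi> (2 * i + 1)))"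
      by (induction N) (simp_all add: add_ac)
    have "(\<Sum>k<N. u (\<psi> k)) \<le> (\<Sum>k<2 * N. u (\<psi> k))" by (intro sum_mono2) auto
    also have "\<dots> \<le> (\<Sum>k. u k) + (\<Sum>k. u k)"
      unfolding split by (intro add_mono half)
    finally show ?thesis by (simp add: mult_2)
  qed
  thus ?thesis by (intro suminf_le_const) auto
qed

text \<open>Up to the factor \<open>exp S\<close> this is the Poisson law of mean \<open>S\<close>,
  whose variance is again \<open>S\<close>: each of the two summands contributes
  \<open>S * exp S\<close>. The square is expanded in factorial moments, which are shifted
  exponential series.\<close>

lemma sums_poisson_variance:
  fixes S :: real
  shows "(\<lambda>j. S ^ j / fact j * ((S - real j)\<^sup>2 + S)) sums (2 * S * exp S)"
proof -
  have 0: "(\<lambda>j. S ^ j / fact j) sums exp S"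
    using exp_converges[of S] by (simp add: field_simps scaleR_conv_of_real)
  have "(\<lambda>j. S * (S ^ j / fact j)) sums (S * exp S)"
    by (intro sums_mult 0)
  also have "(\<lambda>j. S * (S ^ j / fact j)) = (\<lambda>j. real (Suc j) * (S ^ Suc j / fact (Suc j)))"
    by (rule ext) (simp add: divide_simps)
  finally have 1: "(\<lambda>j. real j * (S ^ j / fact j)) sums (S * exp S)"
    by (subst (asm) sums_Suc_iff) simp
  have "(\<lambda>j. S * (real j * (S ^ j / fact j))) sums (S * (S * exp S))"
    by (intro sums_mult 1)
  also have "(\<lambda>j. S * (real j * (S ^ j / fact j))) =
      (\<lambda>j. real (Suc j) * (real (Suc j) - 1) * (S ^ Suc j / fact (Suc j)))"
    by (rule ext) (simp add: divide_simps)
  finally have 2: "(\<lambda>j. real j * (real j - 1) * (S ^ j / fact j)) sums (S * (S * exp S))"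
    by (subst (asm) sums_Suc_iff) simp
  have "(\<lambda>j. (S\<^sup>2 + S) * (S ^ j / fact j) + (1 - 2 * S) * (real j * (S ^ j / fact j)) +
      real j * (real j - 1) * (S ^ j / fact j)) sums
      ((S\<^sup>2 + S) * exp S + (1 - 2 * S) * (S * exp S) + S * (S * exp S))"
    by (intro sums_add sums_mult 0 1 2)
  also have "(\<lambda>j. (S\<^sup>2 + S) * (S ^ j / fact j) + (1 - 2 * S) * (real j * (S ^ j / fact j)) +
      real j * (real j - 1) * (S ^ j / fact j)) = (\<lambda>j. S ^ j / fact j * ((S - real j)\<^sup>2 + S))"
    by (rule ext) (simp add: power2_eq_square algebra_simps add_divide_distrib diff_divide_distrib)
  also have "(S\<^sup>2 + S) * exp S + (1 - 2 * S) * (S * exp S) + S * (S * exp S) = 2 * S * exp S"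
    by (simp add: power2_eq_square algebra_simps)
  finally show ?thesis .
qed

lemma suminf_expterm_nat:
  assumes "S > 0"
  shows "(\<Sum>j. ennreal (expterm (real j) S)) = ennreal (exp S)"
proof -
  have "(\<lambda>j. S ^ j / fact j) sums exp S"
    using exp_converges[of S] by (simp add: field_simps scaleR_conv_of_real)
  thus ?thesis
    using assms by (subst suminf_ennreal_eq[symmetric, of "\<lambda>j. S ^ j / fact j"]) (simp_all add: expterm_nat)
qed

lemma suminf_expterm_variance_nat:
  assumes "S > 0"
  shows "(\<Sum>j. ennreal (expterm (real j) S * ((S - real j)\<^sup>2 + S))) = ennreal (2 * S * exp S)"
  using assms by (subst suminf_ennreal_eq[OF _ sums_poisson_variance[of S], symmetric])
    (simp_all add: expterm_nat)

text \<open>The factor 4 counts two neighbouring points, each used for at most two values of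
  \<open>k\<close>.\<close>

lemma suminf_two_point_le:
  fixes f u :: "nat \<Rightarrow> ennreal"
  assumes "\<And>k. f k \<le> C * (u (\<psi> k) + u (Suc (\<psi> k)))" "\<And>k. \<psi> k < \<psi> (k + 2)"
  shows "(\<Sum>k. f k) \<le> 4 * C * (\<Sum>k. u k)"
proof -
  have "(\<Sum>k. f k) \<le> (\<Sum>k. C * (u (\<psi> k) + u (Suc (\<psi> k))))"
    using assms(1) by (intro suminf_le) auto
  also have "\<dots> = C * ((\<Sum>k. u (\<psi> k)) + (\<Sum>k. u (Suc (\<psi> k))))"
    by (simp add: ennreal_suminf_cmult suminf_add[symmetric])
  also have "\<dots> \<le> C * (2 * (\<Sum>k. u k) + 2 * (\<Sum>k. u k))"
    using suminf_reindex_le[of \<psi> u] suminf_reindex_le[of "\<lambda>k. Suc (\<psi> k)" u] assms(2)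
    by (intro mult_left_mono add_mono) auto
  also have "\<dots> = 4 * C * (\<Sum>k. u k)"
    by (simp add: mult_2[symmetric] mult.assoc[symmetric]) (simp add: mult_ac)
  finally show ?thesis .
qed

lemma nat_floor_less_add:
  fixes x y :: real
  assumes "x \<ge> 0" "y \<ge> x + 1"
  shows "nat \<lfloor>x\<rfloor> < nat \<lfloor>y\<rfloor>"
  using assms by linarith

text \<open>Every grid point lies between consecutive integers, and a step of at least 1/2 makes the
  integer part advance within two steps. In the application \<open>d = 1 / m\<close>, so this is
  where \<open>m < 2\<close> enters. The 16 is the constant 4 of \<open>expterm_interpolate\<close>
  for \<open>D = 1\<close> times the 4 of \<open>suminf_two_point_le\<close>.\<close>

lemma suminf_expterm_le:
  assumes "1 / 2 \<le> d" "V > 0"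
  shows "(\<Sum>k. ennreal (expterm (d * real k) V)) \<le> ennreal (16 * exp V)"
proof -
  have "ennreal (expterm (d * real k) V) \<le> ennreal 4 *
      (ennreal (expterm (real (nat \<lfloor>d * real k\<rfloor>)) V) + ennreal (expterm (real (Suc (nat \<lfloor>d * real k\<rfloor>))) V))" for k
  proof -
    define j where "j = nat \<lfloor>d * real k\<rfloor>"
    have "d * real k \<ge> 0" using assms by simp
    hence j: "real j \<le> d * real k" "d * real k \<le> real (Suc j)" unfolding j_def by linarith+
    have "expterm (d * real k) V \<le> ((1 + 1) powr 1 + (1 + 1)) * (expterm (real j) V + expterm (real (Suc j)) V)"
      using j assms by (intro expterm_interpolate) auto
    hence "expterm (d * real k) V \<le> 4 * (expterm (real j) V + expterm (real (Suc j)) V)" by simp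
    thus ?thesis unfolding j_def[symmetric]
      by (simp add: expterm_nonneg ennreal_mult'[symmetric] ennreal_plus[symmetric] ennreal_leI
          del: ennreal_plus of_nat_Suc ennreal_numeral)
  qed
  moreover have "nat \<lfloor>d * real k\<rfloor> < nat \<lfloor>d * real (k + 2)\<rfloor>" for k
    using assms by (intro nat_floor_less_add) (auto simp: algebra_simps)
  ultimately have "(\<Sum>k. ennreal (expterm (d * real k) V)) \<le>
      4 * ennreal 4 * (\<Sum>j. ennreal (expterm (real j) V))"
    by (rule suminf_two_point_le)
  also have "\<dots> = ennreal (16 * exp V)"
    using assms by (simp add: suminf_expterm_nat ennreal_mult')
  finally show ?thesis .
qed

text \<open>The roles are exchanged: now the exponential series is distributed over a grid of step
  at most 2. The term \<open>j\<close> is looked up at the real index \<open>j + A\<close>, so that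
  the index power \<open>A\<close> shifts it back to \<open>j\<close> and releases
  \<open>S powr A\<close>.\<close>

lemma suminf_expterm_lower:
  assumes "0 < d" "d \<le> 2" "A \<ge> 0"
  shows "\<exists>C>0. \<forall>S>0. ennreal (S powr A * exp S) \<le>
    ennreal C * (\<Sum>k. ennreal ((1 + d * real k) powr A * expterm (d * real k) S))"
proof (intro exI conjI allI impI)
  \<comment> \<open>12 is the constant of \<open>expterm_interpolate\<close> for windows of length
    2, and \<open>3 powr A\<close> pays for replacing \<open>1 + x\<close> by
    \<open>3 * (1 + d * real k)\<close>.\<close>
  define C where "C = 12 * 3 powr A"
  have C: "C > 0" by (simp add: C_def)
  show "4 * C > 0" using C by simp
  fix S :: real assume S: "S > 0"
  define w where "w k = ennreal ((1 + d * real k) powr A * expterm (d * real k) S)" for k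
  have "ennreal (S powr A * expterm (real j) S) \<le> ennreal C *
      (w (nat \<lfloor>(real j + A) / d\<rfloor>) + w (Suc (nat \<lfloor>(real j + A) / d\<rfloor>)))" for j
  proof -
    define x where "x = real j + A"
    define k where "k = nat \<lfloor>x / d\<rfloor>"
    have "x / d \<ge> 0" using assms by (simp add: x_def)
    hence k: "real k \<le> x / d" "x / d \<le> real k + 1" unfolding k_def by linarith+
    hence k: "d * real k \<le> x" "x \<le> d * real (Suc k)" using assms by (auto simp: field_simps)
    have x3: "1 + x \<le> 3 * (1 + d * real k)"
      using k assms mult_nonneg_nonneg[of d "real k"] unfolding of_nat_Suc distrib_left by linarith
    have pos: "d * real k \<ge> 0" "d * real (Suc k) \<ge> 0" using assms by auto
    have "S powr A * expterm (real j) S = S powr A * expterm (x - A) S" by (simp add: x_def)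
    also have "\<dots> \<le> (1 + x) powr A * expterm x S"
      using S assms by (intro expterm_shift_lower) (auto simp: x_def)
    also have "\<dots> \<le> (1 + x) powr A * (((1 + 2) powr 2 + (1 + 2)) *
        (expterm (d * real k) S + expterm (d * real (Suc k)) S))"
      using k assms S pos by (intro mult_left_mono expterm_interpolate) (auto simp: algebra_simps)
    also have "\<dots> = 12 * ((1 + x) powr A * expterm (d * real k) S +
        (1 + x) powr A * expterm (d * real (Suc k)) S)" by (simp add: algebra_simps)
    also have "\<dots> \<le> 12 * ((3 * (1 + d * real k)) powr A * expterm (d * real k) S +
        (3 * (1 + d * real (Suc k))) powr A * expterm (d * real (Suc k)) S)"
    proof (intro mult_left_mono add_mono mult_right_mono powr_mono2 expterm_nonneg pos x3)
      have "d * real k \<le> d * real (Suc k)" using assms by (intro mult_left_mono) auto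
      thus "1 + x \<le> 3 * (1 + d * real (Suc k))" using x3 by simp
    qed (use assms in \<open>auto simp: x_def\<close>)
    also have "\<dots> = C * ((1 + d * real k) powr A * expterm (d * real k) S +
        (1 + d * real (Suc k)) powr A * expterm (d * real (Suc k)) S)"
      unfolding C_def powr_mult
      by (simp only: distrib_left mult_ac)
    finally show ?thesis
      using C expterm_nonneg[OF pos(1), of S] expterm_nonneg[OF pos(2), of S]
      unfolding w_def k_def[symmetric] x_def[symmetric]
      by (simp add: ennreal_mult'[symmetric] ennreal_plus[symmetric] ennreal_leI del: ennreal_plus of_nat_Suc)
  qed
  moreover have "nat \<lfloor>(real j + A) / d\<rfloor> < nat \<lfloor>(real (j + 2) + A) / d\<rfloor>" for j
    using assms by (intro nat_floor_less_add) (auto simp: field_simps)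
  ultimately have "(\<Sum>j. ennreal (S powr A * expterm (real j) S)) \<le> 4 * ennreal C * (\<Sum>k. w k)"
    by (rule suminf_two_point_le)
  also have "(\<Sum>j. ennreal (S powr A * expterm (real j) S)) = ennreal (S powr A * exp S)"
    using S suminf_expterm_nat[OF S] by (simp add: ennreal_mult' expterm_nonneg ennreal_mult)
  also have "4 * ennreal C = ennreal (4 * C)" using C by (simp add: ennreal_mult')
  finally show "ennreal (S powr A * exp S) \<le> ennreal (4 * C) *
    (\<Sum>k. ennreal ((1 + d * real k) powr A * expterm (d * real k) S))" by (simp add: w_def)
qed

text \<open>The power of the index becomes a shift by \<open>B\<close> and a factor
  \<open>S powr B\<close>. The deviation weight changes only by a constant under bounded shifts,
  since \<open>S \<ge> 1\<close> lets the summand \<open>S\<close> absorb the error; what remains is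
  the Poisson variance, which supplies the additional factor \<open>S\<close>.\<close>

lemma suminf_expterm_variance_le:
  assumes d: "1 / 2 \<le> d"
  shows "\<exists>C>0. \<forall>S\<ge>1. (\<Sum>k. ennreal ((1 + d * real k) powr B * ((S - d * real k)\<^sup>2 + S) *
      expterm (d * real k) S)) \<le> ennreal (C * S powr (B + 1) * exp S)"
proof -
  \<comment> \<open>Below \<open>k0\<close> the shifted index \<open>d * real k - B\<close> could be
    negative. These finitely many terms are estimated by hand, with total constant
    \<open>M\<close>.\<close>
  define k0 where "k0 = nat \<lceil>B / d\<rceil>"
  have k0: "d * real k \<ge> B" if "k \<ge> k0" for k
  proof -
    have "B / d \<le> real k" using that unfolding k0_def by linarith
    thus ?thesis using d by (simp add: field_simps)
  qed
  have k0': "d * real k \<le> B" if "k < k0" for k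
  proof -
    have "real k \<le> B / d" using that unfolding k0_def by linarith
    thus ?thesis using d by (simp add: field_simps)
  qed
  define C1 where "C1 = (1 + \<bar>B\<bar>) powr (1 + \<bar>B\<bar>)"
  define C2 where "C2 = 2 + 2 * B\<^sup>2"
  define C3 where "C3 = C1 * C2 * 16"
  have C: "C1 > 0" "C2 > 0" "C3 > 0" by (auto simp: C1_def C2_def C3_def add_pos_nonneg)
  define M where "M = (\<Sum>k<k0. (1 + d * real k) powr B * (\<bar>B\<bar> + 1)\<^sup>2 * 2 / Gamma (d * real k + 1))"
  have Gpos: "Gamma (d * real k + 1) > 0" for k using d by (intro Gamma_real_pos add_nonneg_pos) auto
  have M: "M \<ge> 0" unfolding M_def using Gpos by (intro sum_nonneg) (auto intro!: divide_nonneg_pos)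
  define f where "f S k = (1 + d * real k) powr B * ((S - d * real k)\<^sup>2 + S) * expterm (d * real k) S" for S k
  have f: "f S k \<ge> 0" if "S \<ge> 1" for S k
    unfolding f_def using that d by (intro mult_nonneg_nonneg expterm_nonneg) auto
  have main: "(\<Sum>k. ennreal (f S k)) \<le> ennreal ((8 * C3 + M) * S powr (B + 1) * exp S)" if S: "S \<ge> 1" for S
  proof -
    have tail: "ennreal (f S (k + k0)) \<le> ennreal (C3 * S powr B) *
       (ennreal (expterm (real j) S * ((S - real j)\<^sup>2 + S)) +
        ennreal (expterm (real (Suc j)) S * ((S - real (Suc j))\<^sup>2 + S)))"
      if j_def: "j = nat \<lfloor>d * real (k + k0) - B\<rfloor>" for k j
    proof -
      define x where "x = d * real (k + k0)"
      have x: "x \<ge> 0" "x - B \<ge> 0" using k0[of "k + k0"] d by (auto simp: x_def)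
      have j: "real j \<le> x - B" "x - B \<le> real (Suc j)" using x unfolding j_def x_def[symmetric] by linarith+
      have "\<bar>S - x\<bar>\<^sup>2 \<le> (\<bar>S - (x - B)\<bar> + \<bar>B\<bar>)\<^sup>2" by (intro power_mono) auto
      also have "\<dots> \<le> 2 * (S - (x - B))\<^sup>2 + 2 * B\<^sup>2"
        using sum_squares_bound[of "\<bar>S - (x - B)\<bar>" "\<bar>B\<bar>"] by (simp add: power2_sum)
      also have "2 * B\<^sup>2 \<le> 2 * B\<^sup>2 * S" using S mult_left_mono[of 1 S "2 * B\<^sup>2"] by simp
      finally have "(S - x)\<^sup>2 + S \<le> 2 * (S - (x - B))\<^sup>2 + (1 + 2 * B\<^sup>2) * S" by (simp add: algebra_simps)
      also have "\<dots> \<le> C2 * (S - (x - B))\<^sup>2 + C2 * S"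
        using S by (intro add_mono mult_right_mono) (auto simp: C2_def)
      finally have v1: "(S - x)\<^sup>2 + S \<le> C2 * ((S - (x - B))\<^sup>2 + S)" by (simp add: algebra_simps)
      have v2: "(S - (x - B))\<^sup>2 + S \<le> 4 * ((S - i)\<^sup>2 + S)" if "\<bar>i - (x - B)\<bar> \<le> 1" for i
      proof -
        have "\<bar>S - (x - B)\<bar>\<^sup>2 \<le> (\<bar>S - i\<bar> + 1)\<^sup>2" using that by (intro power_mono) auto
        also have "\<dots> \<le> 2 * (S - i)\<^sup>2 + 2"
          using sum_squares_bound[of "\<bar>S - i\<bar>" 1] by (simp add: power2_sum)
        finally have "(S - (x - B))\<^sup>2 \<le> 2 * (S - i)\<^sup>2 + 2" by simp
        moreover have "a + S \<le> 4 * (b + S)" if "a \<le> 2 * b + 2" "0 \<le> b" for a b :: real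
          using S that by simp
        ultimately show ?thesis by simp
      qed
      have e: "expterm (x - B) S \<le> 4 * (expterm (real j) S + expterm (real (Suc j)) S)"
        using expterm_interpolate[of 1 "real j" "x - B" "real (Suc j)" S] j S by simp
      have "f S (k + k0) \<le> ((1 + x) powr B * expterm x S) * (C2 * ((S - (x - B))\<^sup>2 + S))"
        using mult_left_mono[OF v1, of "(1 + x) powr B * expterm x S"] expterm_nonneg[OF x(1), of S]
        unfolding f_def x_def[symmetric] by (simp add: mult_ac)
      also have "\<dots> \<le> (C1 * S powr B * expterm (x - B) S) * (C2 * ((S - (x - B))\<^sup>2 + S))"
        unfolding C1_def using x S C by (intro mult_right_mono expterm_shift_upper) auto
      also have "\<dots> \<le> (C1 * S powr B * (4 * (expterm (real j) S + expterm (real (Suc j)) S))) *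
          (C2 * ((S - (x - B))\<^sup>2 + S))"
        using x S C e by (intro mult_right_mono mult_left_mono) auto
      also have "\<dots> = C1 * C2 * 4 * S powr B * (expterm (real j) S * ((S - (x - B))\<^sup>2 + S) +
          expterm (real (Suc j)) S * ((S - (x - B))\<^sup>2 + S))" by (simp add: algebra_simps)
      also have "\<dots> \<le> C1 * C2 * 4 * S powr B * (expterm (real j) S * (4 * ((S - real j)\<^sup>2 + S)) +
          expterm (real (Suc j)) S * (4 * ((S - real (Suc j))\<^sup>2 + S)))"
        using j C by (intro mult_left_mono add_mono v2 expterm_nonneg) auto
      also have "\<dots> = C3 * S powr B * (expterm (real j) S * ((S - real j)\<^sup>2 + S) +
          expterm (real (Suc j)) S * ((S - real (Suc j))\<^sup>2 + S))" unfolding C3_def by (simp add: algebra_simps)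
      finally show ?thesis
        using C S by (simp add: expterm_nonneg ennreal_mult'[symmetric] ennreal_plus[symmetric] ennreal_leI
            del: ennreal_plus of_nat_Suc)
    qed
    have "(\<Sum>k. ennreal (f S (k + k0))) \<le> 4 * ennreal (C3 * S powr B) *
        (\<Sum>j. ennreal (expterm (real j) S * ((S - real j)\<^sup>2 + S)))"
    proof (rule suminf_two_point_le)
      show "nat \<lfloor>d * real (k + k0) - B\<rfloor> < nat \<lfloor>d * real (k + 2 + k0) - B\<rfloor>" for k
        using d k0[of "k + k0"] by (intro nat_floor_less_add) (auto simp: algebra_simps)
    qed (use tail in blast)
    also have "\<dots> = ennreal (8 * C3 * (S powr B * S) * exp S)"
      using S C by (simp add: suminf_expterm_variance_nat ennreal_mult'[symmetric] mult_ac
          flip: ennreal_numeral)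
    also have "S powr B * S = S powr (B + 1)" using S by (simp add: powr_add)
    finally have t: "(\<Sum>k. ennreal (f S (k + k0))) \<le> ennreal (8 * C3 * S powr (B + 1) * exp S)" .
    have "(\<Sum>k<k0. f S k) \<le> (\<Sum>k<k0. (1 + d * real k) powr B * (\<bar>B\<bar> + 1)\<^sup>2 * 2 / Gamma (d * real k + 1) *
        (S powr (B + 1) * exp S))"
    proof (intro sum_mono)
      fix k assume "k \<in> {..<k0}"
      hence x: "d * real k \<le> B" "d * real k \<ge> 0" using k0'[of k] d by auto
      have "\<bar>S - d * real k\<bar>\<^sup>2 \<le> (S * (\<bar>B\<bar> + 1))\<^sup>2"
      proof (intro power_mono)
        have "\<bar>B\<bar> \<le> S * \<bar>B\<bar>" using S mult_right_mono[of 1 S "\<bar>B\<bar>"] by simp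
        thus "\<bar>S - d * real k\<bar> \<le> S * (\<bar>B\<bar> + 1)" using x S unfolding distrib_left by linarith
      qed simp
      moreover have "S * 1 \<le> S * S * (\<bar>B\<bar> + 1)\<^sup>2"
        using S unfolding mult.assoc
        by (intro mult_left_mono mult_ge1_I) (auto simp: one_le_power)
      ultimately have v: "(S - d * real k)\<^sup>2 + S \<le> (\<bar>B\<bar> + 1)\<^sup>2 * 2 * (S * S)"
        by (simp add: power_mult_distrib power2_eq_square mult_ac)
      \<comment> \<open>Of the two surplus factors \<open>S\<close>, one is absorbed by
        \<open>exp S\<close> and the other raises the exponent from \<open>B\<close> to
        \<open>B + 1\<close>.\<close>
      have "S powr (d * real k) \<le> S powr B" using x S by (intro powr_mono) auto
      moreover have "S \<le> exp S" using exp_ge_add_one_self[of S] by linarith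
      ultimately have "(S * S) * S powr (d * real k) \<le> (S * exp S) * S powr B"
        using S by (intro mult_mono) auto
      also have "\<dots> = S powr (B + 1) * exp S" using S by (simp add: powr_add)
      finally have w: "(S * S) * S powr (d * real k) \<le> S powr (B + 1) * exp S" .
      have "f S k = (1 + d * real k) powr B / Gamma (d * real k + 1) *
          (((S - d * real k)\<^sup>2 + S) * S powr (d * real k))"
        unfolding f_def expterm_def by simp
      also have "\<dots> \<le> (1 + d * real k) powr B / Gamma (d * real k + 1) *
          ((\<bar>B\<bar> + 1)\<^sup>2 * 2 * (S * S) * S powr (d * real k))"
        using v Gpos[of k] by (intro mult_left_mono mult_right_mono) auto
      also have "\<dots> \<le> (1 + d * real k) powr B / Gamma (d * real k + 1) *
          ((\<bar>B\<bar> + 1)\<^sup>2 * 2 * (S powr (B + 1) * exp S))"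
        using w Gpos[of k] unfolding mult.assoc by (intro mult_left_mono) (auto simp: mult.assoc)
      finally show "f S k \<le> (1 + d * real k) powr B * (\<bar>B\<bar> + 1)\<^sup>2 * 2 / Gamma (d * real k + 1) *
          (S powr (B + 1) * exp S)" by (simp add: mult_ac)
    qed
    also have "\<dots> = M * S powr (B + 1) * exp S"
      by (simp only: M_def sum_distrib_right mult.assoc)
    finally have h: "(\<Sum>k<k0. f S k) \<le> M * S powr (B + 1) * exp S" .
    have "(\<Sum>k. ennreal (f S k)) = (\<Sum>k. ennreal (f S (k + k0))) + (\<Sum>k<k0. ennreal (f S k))"
      by (intro suminf_offset) auto
    also have "\<dots> \<le> ennreal (8 * C3 * S powr (B + 1) * exp S) + ennreal (M * S powr (B + 1) * exp S)"
      using t h f[OF S] by (intro add_mono) (auto intro: ennreal_leI)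
    also have "\<dots> = ennreal ((8 * C3 + M) * S powr (B + 1) * exp S)"
      using C M by (simp add: ennreal_plus[symmetric] algebra_simps del: ennreal_plus)
    finally show ?thesis .
  qed
  show ?thesis
    using main C M unfolding f_def by (intro exI[of _ "8 * C3 + M"]) auto
qed

section \<open>The coefficients of the kernel\<close>

definition kcoeff :: "nat \<Rightarrow> real \<Rightarrow> nat \<Rightarrow> real" where
  "kcoeff n m k = Gamma (real n + real k) / (fact k * Gamma ((real n + real k) / m))"

lemma kcoeff_pos:
  assumes "n \<ge> 1" "m > 0"
  shows "kcoeff n m k > 0"
  unfolding kcoeff_def using assms
  by (intro divide_pos_pos mult_pos_pos Gamma_real_pos) auto

text \<open>\<open>Gamma (n + k) / fact k\<close> grows like \<open>k^(n - 1)\<close>, and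
  \<open>(n + k) / m\<close> exceeds \<open>k / m + 1\<close> by \<open>d = n / m - 1\<close>, which
  costs the power \<open>d\<close> of \<open>k / m\<close>. The exponent is
  \<open>(n - 1) - d\<close>; \<open>d\<close> is nonnegative because
  \<open>m < 2 \<le> n\<close>.\<close>

lemma kcoeff_upper:
  assumes n: "n \<ge> 2" and m: "1 < m" "m < 2"
  shows "\<exists>C>0. \<forall>k. kcoeff n m k \<le> C * (1 + real k / m) powr (real n - real n / m) / Gamma (real k / m + 1)"
proof -
  define d where "d = real n / m - 1"
  have d: "d \<ge> 0" using n m by (simp add: d_def field_simps)
  define e where "e = real n - 1"
  have e: "e \<ge> 0" using n by (simp add: e_def)
  have "kcoeff n m k \<le> (2 powr e * (1 + e) powr e * (1 + d)) *
      (1 + real k / m) powr (real n - real n / m) / Gamma (real k / m + 1)" for k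
  proof -
    define y where "y = real k / m + 1"
    have y: "y \<ge> 1" using m by (simp add: y_def)
    have G: "Gamma y > 0" "Gamma (y + d) > 0" using y d by (auto intro!: Gamma_real_pos)
    have ky: "real k + 1 \<le> 2 * y" using m mult_right_mono[of m 2 "real k"] by (simp add: y_def field_simps)
    have "Gamma (real k + 1 + e) \<le> Gamma (real k + 1) * (real k + 1) powr e * (1 + e) powr e"
      using e by (intro Gamma_add_le') auto
    also have "\<dots> \<le> Gamma (real k + 1) * (2 * y) powr e * (1 + e) powr e"
      using e ky by (intro mult_left_mono mult_right_mono powr_mono2) auto
    also have "Gamma (real k + 1) = fact k" by (simp add: Gamma_fact add.commute)
    finally have 1: "Gamma (real n + real k) / fact k \<le> 2 powr e * (1 + e) powr e * y powr e"
      by (simp add: e_def powr_mult field_simps)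
    have 2: "Gamma y * y powr d \<le> Gamma (y + d) * (1 + d)" using y d by (intro Gamma_add_ge') auto
    hence 2: "1 / Gamma (y + d) \<le> (1 + d) / (Gamma y * y powr d)"
      using G y by (simp add: field_simps)
    have "kcoeff n m k = Gamma (real n + real k) / fact k * (1 / Gamma (y + d))"
      by (simp add: kcoeff_def y_def d_def add_divide_distrib add_ac)
    also have "\<dots> \<le> (2 powr e * (1 + e) powr e * y powr e) * ((1 + d) / (Gamma y * y powr d))"
      using 1 2 G e d by (intro mult_mono) auto
    also have "\<dots> = (2 powr e * (1 + e) powr e * (1 + d)) * (y powr e / y powr d) / Gamma y"
      by (simp add: mult_ac)
    also have "y powr e / y powr d = y powr (real n - real n / m)"
      by (simp add: powr_diff[symmetric] e_def d_def)
    finally show ?thesis by (simp add: y_def add_ac)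
  qed
  thus ?thesis using e d by (intro exI[of _ "2 powr e * (1 + e) powr e * (1 + d)"]) auto
qed

lemma kcoeff_lower:
  assumes n: "n \<ge> 2" and m: "1 < m" "m < 2"
  shows "\<exists>c>0. \<forall>k. c * (1 + real k / m) powr (real n - real n / m) / Gamma (real k / m + 1) \<le> kcoeff n m k"
proof -
  define d where "d = real n / m - 1"
  have d: "d \<ge> 0" using n m by (simp add: d_def field_simps)
  define e where "e = real n - 1"
  have e: "e \<ge> 0" using n by (simp add: e_def)
  have "(1 / (1 + e) * (1 / (1 + d) powr d)) * (1 + real k / m) powr (real n - real n / m) / Gamma (real k / m + 1) \<le> kcoeff n m k" for k
  proof -
    define y where "y = real k / m + 1"
    have y: "y \<ge> 1" using m by (simp add: y_def)
    have G: "Gamma y > 0" "Gamma (y + d) > 0" using y d by (auto intro!: Gamma_real_pos)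
    have ky: "y \<le> real k + 1" using m mult_left_mono[of 1 m "real k"] by (simp add: y_def field_simps)
    have "Gamma (real k + 1) * y powr e \<le> Gamma (real k + 1) * (real k + 1) powr e"
      using e ky y by (intro mult_left_mono mult_right_mono powr_mono2) auto
    also have "\<dots> \<le> Gamma (real k + 1 + e) * (1 + e)"
      using e by (intro Gamma_add_ge') auto
    finally have "fact k * y powr e \<le> Gamma (real n + real k) * (1 + e)"
      using Gamma_fact[of k, where 'a = real] by (simp add: e_def add.commute)
    hence 1: "1 / (1 + e) * y powr e \<le> Gamma (real n + real k) / fact k"
      using e by (simp add: field_simps)
    have "Gamma (y + d) \<le> Gamma y * y powr d * (1 + d) powr d" using y d by (intro Gamma_add_le') auto
    hence 2: "1 / (1 + d) powr d / (Gamma y * y powr d) \<le> 1 / Gamma (y + d)"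
      using G y d by (simp add: field_simps)
    have "(1 / (1 + e) * (1 / (1 + d) powr d)) * (y powr e / y powr d) / Gamma y =
        (1 / (1 + e) * y powr e) * (1 / (1 + d) powr d / (Gamma y * y powr d))" by simp
    also have "\<dots> \<le> Gamma (real n + real k) / fact k * (1 / Gamma (y + d))"
      using 1 2 G e d n by (intro mult_mono) (auto intro!: divide_nonneg_nonneg less_imp_le[OF Gamma_real_pos])
    also have "\<dots> = kcoeff n m k"
      by (simp add: kcoeff_def y_def d_def add_divide_distrib add_ac)
    also have "y powr e / y powr d = y powr (real n - real n / m)"
      by (simp add: powr_diff[symmetric] e_def d_def)
    finally show ?thesis by (simp add: y_def add_ac)
  qed
  thus ?thesis using e d by (intro exI[of _ "1 / (1 + e) * (1 / (1 + d) powr d)"]) auto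
qed

section \<open>Legendre duplication and the half power it produces\<close>

lemma Gamma_double:
  fixes z :: real
  assumes "z \<ge> 0"
  shows "4 powr z * (Gamma (z + 1 / 2) * Gamma (z + 1)) = sqrt pi * Gamma (2 * z + 1)"
proof -
  define w where "w = z + 1 / 2"
  have w: "w > 0" using assms by (simp add: w_def)
  have "complex_of_real w \<notin> \<int>\<^sub>\<le>\<^sub>0" "complex_of_real w + 1 / 2 \<notin> \<int>\<^sub>\<le>\<^sub>0"
    using w by (auto elim!: nonpos_Ints_cases simp: complex_eq_iff)
  from Gamma_legendre_duplication[OF this]
  have "complex_of_real (Gamma w * Gamma (w + 1 / 2)) =
      complex_of_real (exp ((1 - 2 * w) * ln 2) * sqrt pi * Gamma (2 * w))"
    by (simp flip: Gamma_complex_of_real exp_of_real)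
  hence "Gamma w * Gamma (w + 1 / 2) = exp ((1 - 2 * w) * ln 2) * sqrt pi * Gamma (2 * w)"
    by (simp only: of_real_eq_iff)
  hence "Gamma (z + 1 / 2) * Gamma (z + 1 / 2 + 1 / 2) =
      exp ((1 - 2 * (z + 1 / 2)) * ln 2) * sqrt pi * Gamma (2 * (z + 1 / 2))"
    unfolding w_def .
  also have "exp ((1 - 2 * (z + 1 / 2)) * ln 2) = 4 powr (- z)"
    using ln_realpow[of 2 2] by (simp add: powr_def)
  finally have "4 powr z * (Gamma (z + 1 / 2) * Gamma (z + 1)) =
      (4 powr z * 4 powr (- z)) * sqrt pi * Gamma (2 * z + 1)"
    by (simp add: algebra_simps del: powr_minus)
  also have "4 powr z * 4 powr (- z) = 1" by (simp add: powr_add[symmetric])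
  finally show ?thesis by simp
qed

text \<open>Duplication pairs \<open>Gamma (z + 1)\<close> with \<open>Gamma (z + 1 / 2)\<close>.
  Replacing the latter by \<open>Gamma (z + 1)\<close> costs the factor
  \<open>(1 + z) powr (1 / 2)\<close>, the origin of the half powers in all later bounds for squares
  of coefficients.\<close>

lemma Gamma_double_upper:
  fixes z :: real
  assumes "z \<ge> 0"
  shows "Gamma (2 * z + 1) * (1 + z) powr (1 / 2) \<le> 4 * (4 powr z * (Gamma (z + 1))\<^sup>2)"
proof -
  have G: "Gamma (z + 1) > 0" "Gamma (z + 1 / 2) > 0" "Gamma (2 * z + 1) > 0"
    using assms by (auto intro!: Gamma_real_pos)
  have "Gamma (z + 1 / 2) * (1 + z) powr (1 / 2) \<le> Gamma (z + 1 / 2) * (4 * (z + 1 / 2)) powr (1 / 2)"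
    using assms G by (intro mult_left_mono powr_mono2) auto
  also have "\<dots> = 2 * (Gamma (z + 1 / 2) * (z + 1 / 2) powr (1 / 2))"
    unfolding powr_mult by (simp add: powr_half_sqrt)
  also have "\<dots> \<le> 2 * (Gamma (z + 1 / 2 + 1 / 2) * ((z + 1 / 2 + 1 / 2) / (z + 1 / 2)))"
    using assms by (intro mult_left_mono Gamma_add_ge) auto
  also have "z + 1 / 2 + 1 / 2 = z + 1" by simp
  also have "2 * (Gamma (z + 1) * ((z + 1) / (z + 1 / 2))) \<le> 2 * (Gamma (z + 1) * 2)"
    using assms G by (intro mult_left_mono) (auto simp: field_simps)
  finally have *: "Gamma (z + 1 / 2) * (1 + z) powr (1 / 2) \<le> 4 * Gamma (z + 1)" by simp
  have "1 * Gamma (2 * z + 1) \<le> sqrt pi * Gamma (2 * z + 1)"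
    using pi_gt3 G by (intro mult_right_mono) (auto simp: real_le_rsqrt)
  also have "\<dots> = 4 powr z * (Gamma (z + 1 / 2) * Gamma (z + 1))" using Gamma_double[OF assms] by simp
  finally have "Gamma (2 * z + 1) * (1 + z) powr (1 / 2) \<le>
      4 powr z * (Gamma (z + 1 / 2) * Gamma (z + 1)) * (1 + z) powr (1 / 2)"
    by (intro mult_right_mono) auto
  also have "\<dots> = 4 powr z * Gamma (z + 1) * (Gamma (z + 1 / 2) * (1 + z) powr (1 / 2))" by (simp add: mult_ac)
  also have "\<dots> \<le> 4 powr z * Gamma (z + 1) * (4 * Gamma (z + 1))"
    using * G by (intro mult_left_mono) auto
  finally show ?thesis by (simp add: power2_eq_square mult_ac)
qed

lemma Gamma_double_lower:
  fixes z :: real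
  assumes "z \<ge> 0"
  shows "4 powr z * (Gamma (z + 1))\<^sup>2 \<le> 2 * (Gamma (2 * z + 1) * (1 + z) powr (1 / 2))"
proof -
  have G: "Gamma (z + 1) > 0" "Gamma (z + 1 / 2) > 0" "Gamma (2 * z + 1) > 0"
    using assms by (auto intro!: Gamma_real_pos)
  have "Gamma (z + 1) \<le> Gamma (z + 1 / 2) * (1 + z) powr (1 / 2)"
    using Gamma_add_le[of "z + 1 / 2" "1 / 2"] assms by (simp add: add_ac)
  hence "4 powr z * Gamma (z + 1) * Gamma (z + 1) \<le>
      4 powr z * Gamma (z + 1) * (Gamma (z + 1 / 2) * (1 + z) powr (1 / 2))"
    using G by (intro mult_left_mono) auto
  also have "\<dots> = sqrt pi * Gamma (2 * z + 1) * (1 + z) powr (1 / 2)"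
    by (subst Gamma_double[OF assms, symmetric]) (simp add: mult_ac)
  also have "\<dots> \<le> 2 * Gamma (2 * z + 1) * (1 + z) powr (1 / 2)"
    using G pi_less_4 by (intro mult_right_mono) (auto simp: real_sqrt_le_iff intro: real_le_lsqrt)
  finally show ?thesis by (simp add: power2_eq_square mult_ac)
qed

lemma abs_powr_minus_one_le:
  fixes u d :: real
  assumes "u > 0" "0 \<le> d" "d \<le> 1"
  shows "\<bar>u powr d - 1\<bar> \<le> \<bar>u - 1\<bar>"
proof (cases "u \<ge> 1")
  case True
  have "u powr d \<le> u powr 1" using True assms by (intro powr_mono) auto
  moreover have "u powr d \<ge> 1" using True assms by (simp add: ge_one_powr_ge_zero)
  ultimately show ?thesis using True by simp
next
  case False
  have "u powr d \<ge> u powr 1" using False assms by (intro powr_mono') auto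
  moreover have "u powr d \<le> 1 powr d" using False assms by (intro powr_mono2) auto
  ultimately show ?thesis using False assms by simp
qed

text \<open>The quotient of consecutive terms is \<open>(n + k) / (k + 1)\<close> times
  \<open>q\<close>, and log-convexity encloses \<open>q\<close> between \<open>s / y\<close> and
  \<open>s / y'\<close> raised to the power \<open>1 / m\<close>. Both bases are
  \<open>k / m\<close> up to a bounded error, so the quotient is close to 1 near the peak
  \<open>k / m = s\<close>, and its deviation is linear in the distance from there.\<close>

lemma kcoeff_step:
  assumes n: "n \<ge> 2" and m: "1 < m" "m < 2" and s: "s > 0"
  shows "\<bar>kcoeff n m (Suc k) * s powr (1 / m) - kcoeff n m k\<bar> \<le>
    kcoeff n m k * (8 * (real n)\<^sup>2 * (\<bar>s - real k / m\<bar> + 1) / (1 + real k / m))"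
proof -
  define d where "d = 1 / m"
  have d: "0 < d" "d \<le> 1" using m by (auto simp: d_def)
  define y where "y = (real n + real k) / m"
  \<comment> \<open>The base in the lower Gamma bound. It stays above \<open>(k + 1) / 2\<close>
    because \<open>n \<ge> 2\<close> and \<open>m < 2\<close>.\<close>
  define y' where "y' = y + d - 1"
  have kp: "kcoeff n m k > 0" using n m by (intro kcoeff_pos) auto
  define q where "q = s powr d * (Gamma y / Gamma (y + d))"
  define N where "N = real n"
  have N: "N \<ge> 2" using n by (simp add: N_def)
  have y0: "y > 0" using n m by (auto simp: y_def)
  have "y + d = (N + real k + 1) / m" by (simp add: y_def d_def N_def add_divide_distrib)
  moreover have "(real k + 3) / 2 \<le> (N + real k + 1) / m" using N m by (intro frac_le) auto
  ultimately have y': "y' \<ge> (real k + 1) / 2" by (simp add: y'_def)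
  have yy: "y' \<le> y" using d by (simp add: y'_def)
  have y'0: "y' > 0" using y' by (smt (verit) divide_pos_pos of_nat_0_le_iff)
  have G: "Gamma y > 0" "Gamma (y + d) > 0" using y0 d by (auto intro!: Gamma_real_pos)
  have up: "Gamma (y + d) \<le> Gamma y * y powr d" using y0 d by (intro Gamma_add_le_unit) auto
  have lo: "Gamma y * y' powr d \<le> Gamma (y + d)"
    unfolding y'_def using y'0 d by (intro Gamma_add_ge_unit) (auto simp: y'_def)
  have q1: "(s / y) powr d \<le> q"
    using up G y0 s unfolding q_def by (simp add: powr_divide field_simps mult_left_mono)
  have q2: "q \<le> (s / y') powr d"
    using lo G y'0 s unfolding q_def by (simp add: powr_divide field_simps mult_left_mono)
  define mu where "mu = real k / m"
  have mu: "mu \<ge> 0" "mu \<le> real k" using m mult_left_mono[of 1 m "real k"] by (auto simp: mu_def field_simps)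
  have dev: "\<bar>(s / v) powr d - 1\<bar> \<le> 2 * (\<bar>s - mu\<bar> + N) / (1 + mu)" if "y' \<le> v" "v \<le> y" for v
  proof -
    have v: "v \<ge> (1 + mu) / 2" using that y' mu by simp
    hence v0: "v > 0" using mu by simp
    have "\<bar>(s / v) powr d - 1\<bar> \<le> \<bar>s / v - 1\<bar>" using s v0 d by (intro abs_powr_minus_one_le) auto
    also have "\<dots> = \<bar>s - v\<bar> / v" using v0 by (simp add: abs_div_pos diff_divide_distrib)
    also have "\<dots> \<le> (\<bar>s - mu\<bar> + N) / ((1 + mu) / 2)"
    proof (intro frac_le v)
      have "y = mu + N / m" by (simp add: y_def mu_def N_def add_divide_distrib)
      moreover have "N / m \<le> N" using m N by (simp add: field_simps)
      moreover have "N / m \<ge> 1" using m N by (simp add: field_simps)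
      ultimately have "\<bar>v - mu\<bar> \<le> N" using that d N by (simp add: y'_def)
      thus "\<bar>s - v\<bar> \<le> \<bar>s - mu\<bar> + N" by linarith
    qed (use mu N in auto)
    also have "\<dots> = 2 * (\<bar>s - mu\<bar> + N) / (1 + mu)" by (simp add: mult_ac)
    finally show ?thesis .
  qed
  have q: "\<bar>q - 1\<bar> \<le> 2 * (\<bar>s - mu\<bar> + N) / (1 + mu)"
    using dev[of y] dev[of y'] yy q1 q2 by linarith
  have Gn: "Gamma (real n + real (Suc k)) = (N + real k) * Gamma (real n + real k)"
    using Gamma_plus1[of "real n + real k"] n nonpos_Ints_nonpos[of "real n + real k"]
    by (auto simp: add_ac N_def)
  have yd: "(real n + real (Suc k)) / m = y + d" by (simp add: y_def d_def add_divide_distrib add_ac)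
  have "kcoeff n m (Suc k) * s powr (1 / m) = kcoeff n m k * (((N + real k) / (real k + 1)) * q)"
    unfolding kcoeff_def Gn yd y_def[symmetric] d_def[symmetric] q_def fact_Suc
    using less_imp_neq[OF G(1)] by (simp add: mult_ac add_ac)
  also have "(N + real k) / (real k + 1) = 1 + (N - 1) / (real k + 1)" by (simp add: field_simps)
  finally have "kcoeff n m (Suc k) * s powr (1 / m) - kcoeff n m k =
      kcoeff n m k * ((1 + (N - 1) / (real k + 1)) * (q - 1) + (N - 1) / (real k + 1))"
    by (simp only: ring_distribs mult_1_left mult_1_right)
  also have "\<bar>\<dots>\<bar> = kcoeff n m k * \<bar>(1 + (N - 1) / (real k + 1)) * (q - 1) + (N - 1) / (real k + 1)\<bar>"
    using kp by (simp add: abs_mult)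
  also have "\<dots> \<le> kcoeff n m k * (8 * N\<^sup>2 * (\<bar>s - mu\<bar> + 1) / (1 + mu))"
  proof (intro mult_left_mono)
    have f1: "(N - 1) / (real k + 1) \<le> (N - 1) / (1 + mu)" using mu N by (intro divide_left_mono) auto
    have f2: "(N - 1) / (1 + mu) \<le> N - 1"
      using divide_left_mono[of 1 "1 + mu" "N - 1"] mu N by simp
    have f3: "0 \<le> (N - 1) / (real k + 1)" using N by simp
    have "\<bar>(1 + (N - 1) / (real k + 1)) * (q - 1) + (N - 1) / (real k + 1)\<bar> \<le>
        (1 + (N - 1) / (real k + 1)) * \<bar>q - 1\<bar> + (N - 1) / (real k + 1)"
      using f3 abs_triangle_ineq[of "(1 + (N - 1) / (real k + 1)) * (q - 1)" "(N - 1) / (real k + 1)"]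
      by (simp add: abs_mult)
    also have "\<dots> \<le> N * (2 * (\<bar>s - mu\<bar> + N) / (1 + mu)) + (N - 1) / (1 + mu)"
      using f1 f2 f3 q N by (intro add_mono mult_mono) auto
    also have "\<dots> = (N * (2 * (\<bar>s - mu\<bar> + N)) + (N - 1)) / (1 + mu)"
      by (simp only: times_divide_eq_right add_divide_distrib[symmetric])
    also have "\<dots> \<le> 8 * N\<^sup>2 * (\<bar>s - mu\<bar> + 1) / (1 + mu)"
    proof (intro divide_right_mono)
      have "N * (2 * (a + N)) + (N - 1) \<le> 8 * N\<^sup>2 * (a + 1)" if a: "a \<ge> 0" for a
      proof -
        define P where "P = N * a"
        define R where "R = N * N"
        have "P \<ge> 0" using a N by (simp add: P_def)
        hence "P \<le> N * P" using mult_right_mono[of 1 N P] N by simp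
        moreover have "2 * N \<le> R" using N unfolding R_def by (intro mult_right_mono) auto
        moreover have "0 \<le> N * P" using a N by (simp add: P_def)
        moreover have 1: "N * (2 * (a + N)) + (N - 1) = 2 * P + 2 * R + N - 1"
          by (simp add: algebra_simps P_def R_def)
        moreover have 2: "8 * N\<^sup>2 * (a + 1) = 8 * (N * P) + 8 * R"
          by (simp add: power2_eq_square algebra_simps P_def R_def)
        ultimately show ?thesis using N unfolding 1 2 by linarith
      qed
      thus "N * (2 * (\<bar>s - mu\<bar> + N)) + (N - 1) \<le> 8 * N\<^sup>2 * (\<bar>s - mu\<bar> + 1)" by simp
    qed (use mu in simp)
    finally show "\<bar>(1 + (N - 1) / (real k + 1)) * (q - 1) + (N - 1) / (real k + 1)\<bar> \<le>
        8 * N\<^sup>2 * (\<bar>s - mu\<bar> + 1) / (1 + mu)" .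
  qed (use kp in simp)
  finally show ?thesis unfolding N_def mu_def .
qed

text \<open>By duplication the square of a term of index \<open>u\<close> at \<open>s\<close> is a
  term of index \<open>2 * u\<close> at \<open>2 * s\<close>, with half a power of the index gained.
  The hypothesis on \<open>n - n / m\<close> keeps the exponent nonnegative, so \<open>1 + u\<close>
  may be enlarged to \<open>1 + 2 * u\<close>.\<close>

lemma kcoeff_square_upper:
  assumes n: "n \<ge> 2" and m: "1 < m" "m < 2" and H: "real n - real n / m \<ge> 1 / 2"
  shows "\<exists>C>0. \<forall>k s. s > 0 \<longrightarrow> (kcoeff n m k * s powr (real k / m))\<^sup>2 \<le>
    C * ((1 + 2 / m * real k) powr (2 * (real n - real n / m) - 1 / 2) * expterm (2 / m * real k) (2 * s))"
proof -
  define h where "h = real n - real n / m"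
  have h: "h \<ge> 1 / 2" using H by (simp add: h_def)
  obtain C where C: "C > 0" "\<And>k. kcoeff n m k \<le> C * (1 + real k / m) powr h / Gamma (real k / m + 1)"
    using kcoeff_upper[OF n m] unfolding h_def by blast
  have "(kcoeff n m k * s powr (real k / m))\<^sup>2 \<le>
    (4 * C\<^sup>2) * ((1 + 2 / m * real k) powr (2 * h - 1 / 2) * expterm (2 / m * real k) (2 * s))"
    if s: "s > 0" for k s
  proof -
    define u where "u = real k / m"
    have u: "u \<ge> 0" using m by (simp add: u_def)
    have G: "Gamma (u + 1) > 0" "Gamma (2 * u + 1) > 0" using u by (auto intro!: Gamma_real_pos)
    have pos: "kcoeff n m k > 0" using n m by (intro kcoeff_pos) auto
    have k2: "2 / m * real k = 2 * u" by (simp add: u_def)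
    have g: "1 / (Gamma (u + 1))\<^sup>2 \<le> 4 * (4 powr u * (1 + u) powr (- 1 / 2) / Gamma (2 * u + 1))"
    proof -
      have "1 / (Gamma (u + 1))\<^sup>2 = (Gamma (2 * u + 1) * (1 + u) powr (1 / 2)) /
          ((Gamma (u + 1))\<^sup>2 * Gamma (2 * u + 1) * (1 + u) powr (1 / 2))"
        using less_imp_neq[OF G(1)] less_imp_neq[OF G(2)] u by simp
      also have "\<dots> \<le> (4 * (4 powr u * (Gamma (u + 1))\<^sup>2)) /
          ((Gamma (u + 1))\<^sup>2 * Gamma (2 * u + 1) * (1 + u) powr (1 / 2))"
        using G u Gamma_double_upper[OF u] by (intro divide_right_mono) auto
      also have "\<dots> = 4 * (4 powr u * (1 / (1 + u) powr (1 / 2)) / Gamma (2 * u + 1))"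
        using G by simp
      finally show ?thesis by (simp add: powr_minus_divide)
    qed
    have "(kcoeff n m k * s powr u)\<^sup>2 \<le> (C * (1 + u) powr h / Gamma (u + 1) * s powr u)\<^sup>2"
      using C(2)[of k] pos unfolding u_def[symmetric] by (intro power_mono mult_right_mono mult_nonneg_nonneg) auto
    also have "\<dots> = C\<^sup>2 * ((1 + u) powr h)\<^sup>2 * (s powr u)\<^sup>2 * (1 / (Gamma (u + 1))\<^sup>2)"
      by (simp add: power_mult_distrib power_divide mult_ac)
    also have "\<dots> \<le> C\<^sup>2 * ((1 + u) powr h)\<^sup>2 * (s powr u)\<^sup>2 *
        (4 * (4 powr u * (1 + u) powr (- 1 / 2) / Gamma (2 * u + 1)))"
      by (intro mult_left_mono g) auto
    also have "((1 + u) powr h)\<^sup>2 = (1 + u) powr (2 * h)"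
      by (simp add: power2_eq_square powr_add[symmetric])
    also have "(s powr u)\<^sup>2 = s powr (2 * u)"
      by (simp add: power2_eq_square powr_add[symmetric])
    also have "C\<^sup>2 * (1 + u) powr (2 * h) * s powr (2 * u) *
        (4 * (4 powr u * (1 + u) powr (- 1 / 2) / Gamma (2 * u + 1))) =
        4 * C\<^sup>2 * (((1 + u) powr (2 * h) * (1 + u) powr (- 1 / 2)) *
        (4 powr u * s powr (2 * u) / Gamma (2 * u + 1)))" by (simp add: mult_ac)
    also have "4 powr u * s powr (2 * u) = (2 * s) powr (2 * u)"
      using s powr_powr[of 2 2 u] by (simp add: powr_mult mult_ac)
    also have "(1 + u) powr (2 * h) * (1 + u) powr (- 1 / 2) = (1 + u) powr (2 * h - 1 / 2)"
      by (simp add: powr_add[symmetric])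
    also have "(2 * s) powr (2 * u) / Gamma (2 * u + 1) = expterm (2 * u) (2 * s)" by (simp add: expterm_def)
    also have "4 * C\<^sup>2 * ((1 + u) powr (2 * h - 1 / 2) * expterm (2 * u) (2 * s)) \<le>
        4 * C\<^sup>2 * ((1 + 2 * u) powr (2 * h - 1 / 2) * expterm (2 * u) (2 * s))"
      using u h by (intro mult_left_mono mult_right_mono powr_mono2 expterm_nonneg) auto
    finally show ?thesis unfolding k2 u_def[symmetric] .
  qed
  thus ?thesis using C(1) unfolding h_def by (intro exI[of _ "4 * C\<^sup>2"]) auto
qed

text \<open>The square mean of the first differences gains a factor of order \<open>1 / s\<close> over that of
  the terms themselves; this is the source of the sharp bound for the kernel on circles.\<close>

lemma kcoeff_difference_sum:
  assumes n: "n \<ge> 2" and m: "1 < m" "m < 2" and H: "real n - real n / m \<ge> 1 / 2"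
  shows "\<exists>C>0. \<forall>s\<ge>1. (\<Sum>k. ennreal (
      (kcoeff n m (Suc k) * s powr (real (Suc k) / m) - kcoeff n m k * s powr (real k / m))\<^sup>2 +
      (kcoeff n m k * s powr (real k / m))\<^sup>2 / s)) \<le>
    ennreal (C * s powr (2 * (real n - real n / m) - 3 / 2) * exp (2 * s))"
proof -
  define h where "h = real n - real n / m"
  define B where "B = 2 * h - 1 / 2"
  obtain C1 where C1: "C1 > 0" "\<And>k s. s > 0 \<Longrightarrow> (kcoeff n m k * s powr (real k / m))\<^sup>2 \<le>
      C1 * ((1 + 2 / m * real k) powr B * expterm (2 / m * real k) (2 * s))"
    using kcoeff_square_upper[OF n m H] unfolding B_def h_def by blast
  have "1 / 2 \<le> 2 / m" using m by (simp add: field_simps)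
  then obtain C2 where C2: "C2 > 0" "\<And>S. S \<ge> 1 \<Longrightarrow> (\<Sum>k. ennreal ((1 + 2 / m * real k) powr (B - 2) *
      ((S - 2 / m * real k)\<^sup>2 + S) * expterm (2 / m * real k) S)) \<le> ennreal (C2 * S powr (B - 2 + 1) * exp S)"
    using suminf_expterm_variance_le[of "2 / m" "B - 2"] by blast
  define K where "K = 8 * (real n)\<^sup>2"
  have K: "K \<ge> 0" by (simp add: K_def)
  define C3 where "C3 = C1 * (8 * K\<^sup>2 + 16)"
  have C3: "C3 > 0" using C1 by (simp add: C3_def add_nonneg_pos)
  have term_le: "(kcoeff n m (Suc k) * s powr (real (Suc k) / m) - kcoeff n m k * s powr (real k / m))\<^sup>2 +
      (kcoeff n m k * s powr (real k / m))\<^sup>2 / s \<le>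
      C3 * ((1 + 2 / m * real k) powr (B - 2) * ((2 * s - 2 / m * real k)\<^sup>2 + 2 * s) * expterm (2 / m * real k) (2 * s))"
    if s: "s \<ge> 1" for k s
  proof -
    define u where "u = real k / m"
    define t where "t = kcoeff n m k * s powr u"
    define x where "x = 2 / m * real k"
    define S where "S = 2 * s"
    have u: "u \<ge> 0" "x = 2 * u" using m by (auto simp: u_def x_def)
    have t: "t \<ge> 0" unfolding t_def using kcoeff_pos[of n m k] n m by simp
    have "kcoeff n m (Suc k) * s powr (real (Suc k) / m) - t =
        (kcoeff n m (Suc k) * s powr (1 / m) - kcoeff n m k) * s powr u"
      by (simp add: t_def u_def algebra_simps add_divide_distrib powr_add)
    also have "\<bar>\<dots>\<bar> \<le> (kcoeff n m k * (K * (\<bar>s - u\<bar> + 1) / (1 + u))) * s powr u"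
      using kcoeff_step[OF n m, of s k] s unfolding abs_mult K_def u_def by (intro mult_mono) auto
    also have "\<dots> = t * (K * (\<bar>s - u\<bar> + 1) / (1 + u))" by (simp add: t_def)
    finally have "\<bar>kcoeff n m (Suc k) * s powr (real (Suc k) / m) - t\<bar>\<^sup>2 \<le> (t * (K * (\<bar>s - u\<bar> + 1) / (1 + u)))\<^sup>2"
      by (intro power_mono) auto
    hence 1: "(kcoeff n m (Suc k) * s powr (real (Suc k) / m) - t)\<^sup>2 \<le>
        t\<^sup>2 * (K\<^sup>2 * ((\<bar>s - u\<bar> + 1) / (1 + u))\<^sup>2)"
      by (simp add: power_mult_distrib power_divide)
    have "((\<bar>s - u\<bar> + 1) / (1 + u))\<^sup>2 \<le> ((\<bar>S - x\<bar> + 2) / (1 + x))\<^sup>2"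
    proof (intro power_mono)
      have "(\<bar>s - u\<bar> + 1) / (1 + u) = (2 * \<bar>s - u\<bar> + 2) / (2 + x)" using u by (simp add: field_simps)
      also have "2 * \<bar>s - u\<bar> = \<bar>S - x\<bar>" using abs_mult[of 2 "s - u"] unfolding u(2) S_def by simp
      also have "(\<bar>S - x\<bar> + 2) / (2 + x) \<le> (\<bar>S - x\<bar> + 2) / (1 + x)"
        using u by (intro divide_left_mono) auto
      finally show "(\<bar>s - u\<bar> + 1) / (1 + u) \<le> (\<bar>S - x\<bar> + 2) / (1 + x)" .
    qed (use u in auto)
    also have "\<dots> \<le> 8 * ((S - x)\<^sup>2 + S) / (1 + x)\<^sup>2"
      unfolding power_divide
    proof (intro divide_right_mono)
      have "(\<bar>S - x\<bar> + 2)\<^sup>2 \<le> 2 * (S - x)\<^sup>2 + 8"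
        using sum_squares_bound[of "\<bar>S - x\<bar>" 2] by (simp add: power2_sum)
      also have "\<dots> \<le> 8 * ((S - x)\<^sup>2 + S)"
        using s zero_le_power2[of "S - x"] unfolding distrib_left S_def by linarith
      finally show "(\<bar>S - x\<bar> + 2)\<^sup>2 \<le> 8 * ((S - x)\<^sup>2 + S)" .
    qed auto
    finally have 2: "((\<bar>s - u\<bar> + 1) / (1 + u))\<^sup>2 \<le> 8 * (((S - x)\<^sup>2 + S) / (1 + x)\<^sup>2)" by simp
    \<comment> \<open>The summand with \<open>1 / s\<close> obeys the same weight: near the peak
      \<open>1 + x\<close> is comparable with \<open>s\<close>, and for larger \<open>x\<close> the
      square of \<open>S - x\<close> takes over.\<close>
    have 3: "1 / s \<le> 16 * (((S - x)\<^sup>2 + S) / (1 + x)\<^sup>2)"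
    proof -
      have "(1 + x)\<^sup>2 \<le> ((1 + S) + \<bar>S - x\<bar>)\<^sup>2" using u by (intro power_mono) auto
      also have "\<dots> \<le> 2 * (1 + S)\<^sup>2 + 2 * (S - x)\<^sup>2"
        using sum_squares_bound[of "1 + S" "\<bar>S - x\<bar>"] by (simp add: power2_sum)
      also have "(1 + S)\<^sup>2 \<le> (2 * S)\<^sup>2" using s by (intro power_mono) (auto simp: S_def)
      also have "2 * (2 * S)\<^sup>2 + 2 * (S - x)\<^sup>2 = 16 * s * S + 2 * (S - x)\<^sup>2"
        by (simp add: S_def power2_eq_square)
      also have "2 * (S - x)\<^sup>2 \<le> 16 * s * (S - x)\<^sup>2" using s by (intro mult_right_mono) auto
      finally have "(1 + x)\<^sup>2 \<le> 16 * ((S - x)\<^sup>2 + S) * s" by (simp add: algebra_simps)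
      thus ?thesis using s u by (simp add: field_simps)
    qed
    have "(kcoeff n m (Suc k) * s powr (real (Suc k) / m) - t)\<^sup>2 + t\<^sup>2 * (1 / s) \<le>
        t\<^sup>2 * (K\<^sup>2 * (8 * (((S - x)\<^sup>2 + S) / (1 + x)\<^sup>2))) + t\<^sup>2 * (16 * (((S - x)\<^sup>2 + S) / (1 + x)\<^sup>2))"
      by (intro add_mono order_trans[OF 1] mult_left_mono 2 3) auto
    also have "\<dots> = t\<^sup>2 * ((8 * K\<^sup>2 + 16) * (((S - x)\<^sup>2 + S) / (1 + x)\<^sup>2))" by (simp add: algebra_simps)
    also have "\<dots> \<le> (C1 * ((1 + x) powr B * expterm x S)) * ((8 * K\<^sup>2 + 16) * (((S - x)\<^sup>2 + S) / (1 + x)\<^sup>2))"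
      using C1(2)[of s k] s unfolding t_def u_def x_def S_def
      by (intro mult_right_mono) (auto intro!: mult_nonneg_nonneg divide_nonneg_nonneg)
    also have "\<dots> = C3 * (((1 + x) powr B / (1 + x)\<^sup>2) * ((S - x)\<^sup>2 + S) * expterm x S)"
      by (simp add: C3_def mult_ac)
    also have "(1 + x) powr B / (1 + x)\<^sup>2 = (1 + x) powr (B - 2)"
      using u by (simp add: powr_diff)
    finally show ?thesis by (simp add: t_def u_def x_def S_def)
  qed
  show ?thesis
  proof (intro exI conjI allI impI)
    show "C3 * C2 * 2 powr (B - 1) > 0" using C2 C3 by simp
    fix s :: real assume s: "s \<ge> 1"
    have "(\<Sum>k. ennreal (
      (kcoeff n m (Suc k) * s powr (real (Suc k) / m) - kcoeff n m k * s powr (real k / m))\<^sup>2 +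
      (kcoeff n m k * s powr (real k / m))\<^sup>2 / s)) \<le>
      (\<Sum>k. ennreal C3 * ennreal ((1 + 2 / m * real k) powr (B - 2) *
      ((2 * s - 2 / m * real k)\<^sup>2 + 2 * s) * expterm (2 / m * real k) (2 * s)))"
      using C3 term_le[OF s] by (intro suminf_le) (auto simp flip: ennreal_mult' intro!: ennreal_leI)
    also have "\<dots> \<le> ennreal C3 * ennreal (C2 * (2 * s) powr (B - 2 + 1) * exp (2 * s))"
      using C2(2)[of "2 * s"] s by (simp add: mult_left_mono)
    also have "\<dots> = ennreal (C3 * C2 * 2 powr (B - 1) * s powr (2 * h - 3 / 2) * exp (2 * s))"
      using C3 s by (simp add: ennreal_mult'[symmetric] powr_mult mult_ac B_def)
    finally show "(\<Sum>k. ennreal (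
      (kcoeff n m (Suc k) * s powr (real (Suc k) / m) - kcoeff n m k * s powr (real k / m))\<^sup>2 +
      (kcoeff n m k * s powr (real k / m))\<^sup>2 / s)) \<le>
      ennreal (C3 * C2 * 2 powr (B - 1) * s powr (2 * (real n - real n / m) - 3 / 2) * exp (2 * s))"
      by (simp only: h_def)
  qed
qed

text \<open>The power of \<open>1 + k / m\<close> is swallowed by
  \<open>(1 + \<epsilon>) powr (k / m)\<close>, which merges with \<open>s powr (k / m)\<close> into
  the exponential series at \<open>(1 + \<epsilon>) * s\<close>.\<close>

lemma kcoeff_series_le:
  assumes n: "n \<ge> 2" and m: "1 < m" "m < 2" and e: "\<epsilon> > 0"
  shows "\<exists>C>0. \<forall>s>0. (\<Sum>k. ennreal (kcoeff n m k * s powr (real k / m))) \<le> ennreal (C * exp ((1 + \<epsilon>) * s))"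
proof -
  define h where "h = real n - real n / m"
  have "real n * 1 < real n * m" using n m by (intro mult_strict_left_mono) auto
  hence h: "h > 0" using m by (simp add: h_def field_simps)
  obtain C where C: "C > 0" "\<And>k. kcoeff n m k \<le> C * (1 + real k / m) powr h / Gamma (real k / m + 1)"
    using kcoeff_upper[OF n m] unfolding h_def by blast
  \<comment> \<open>Chosen so that \<open>exp (d * u)\<close> to the power \<open>h\<close> equals
    \<open>(1 + \<epsilon>) powr u\<close>.\<close>
  define d where "d = ln (1 + \<epsilon>) / h"
  have d: "d > 0" using e h by (simp add: d_def)
  have pw: "(1 + u) powr h \<le> (1 + 1 / d) powr h * (1 + \<epsilon>) powr u" if u: "u \<ge> 0" for u
  proof -
    have "d * u \<le> exp (d * u)" using exp_ge_add_one_self[of "d * u"] by linarith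
    hence "u \<le> (1 / d) * exp (d * u)" using d by (simp add: field_simps)
    moreover have "1 \<le> exp (d * u)" using d u by simp
    ultimately have "1 + u \<le> exp (d * u) + (1 / d) * exp (d * u)" by linarith
    hence "(1 + u) powr h \<le> ((1 + 1 / d) * exp (d * u)) powr h"
      using h u by (intro powr_mono2) (auto simp: algebra_simps)
    also have "\<dots> = (1 + 1 / d) powr h * exp (d * u) powr h" unfolding powr_mult by simp
    also have "exp (d * u) powr h = exp (d * h * u)" by (simp add: powr_def mult_ac)
    also have "d * h = ln (1 + \<epsilon>)" using h by (simp add: d_def)
    also have "exp (ln (1 + \<epsilon>) * u) = (1 + \<epsilon>) powr u" using e by (simp add: powr_def mult_ac)
    finally show ?thesis .
  qed
  define C' where "C' = C * (1 + 1 / d) powr h"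
  have C': "C' > 0" using C add_pos_pos[OF zero_less_one, of "1 / d"] d unfolding C'_def by (intro mult_pos_pos) auto
  have "kcoeff n m k * s powr (real k / m) \<le> C' * expterm (1 / m * real k) ((1 + \<epsilon>) * s)" if s: "s > 0" for s k
  proof -
    define u where "u = real k / m"
    have u: "u \<ge> 0" using m by (simp add: u_def)
    have G: "Gamma (u + 1) > 0" using u by (auto intro!: Gamma_real_pos)
    have "kcoeff n m k * s powr u \<le> C * (1 + u) powr h / Gamma (u + 1) * s powr u"
      using C(2)[of k] unfolding u_def by (intro mult_right_mono) auto
    also have "\<dots> \<le> C * ((1 + 1 / d) powr h * (1 + \<epsilon>) powr u) / Gamma (u + 1) * s powr u"
      using pw[OF u] G C by (intro mult_right_mono divide_right_mono mult_left_mono) auto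
    also have "\<dots> = C' * expterm u ((1 + \<epsilon>) * s)"
      by (simp add: C'_def expterm_def powr_mult)
    finally show ?thesis by (simp add: u_def)
  qed
  hence "(\<Sum>k. ennreal (kcoeff n m k * s powr (real k / m))) \<le>
      (\<Sum>k. ennreal C' * ennreal (expterm (1 / m * real k) ((1 + \<epsilon>) * s)))" if "s > 0" for s
    using C' that by (intro suminf_le) (auto simp flip: ennreal_mult' intro!: ennreal_leI)
  moreover have "(\<Sum>k. ennreal C' * ennreal (expterm (1 / m * real k) ((1 + \<epsilon>) * s))) \<le>
      ennreal (C' * 16 * exp ((1 + \<epsilon>) * s))" if s: "s > 0" for s
  proof -
    have "1 / 2 \<le> 1 / m" using m by (simp add: field_simps)
    hence "(\<Sum>k. ennreal (expterm (1 / m * real k) ((1 + \<epsilon>) * s))) \<le> ennreal (16 * exp ((1 + \<epsilon>) * s))"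
      using s e by (intro suminf_expterm_le) auto
    hence "ennreal C' * (\<Sum>k. ennreal (expterm (1 / m * real k) ((1 + \<epsilon>) * s))) \<le>
        ennreal C' * ennreal (16 * exp ((1 + \<epsilon>) * s))" by (intro mult_left_mono) auto
    also have "ennreal C' * ennreal (16 * exp ((1 + \<epsilon>) * s)) = ennreal (C' * 16 * exp ((1 + \<epsilon>) * s))"
      using C' by (simp add: ennreal_mult'[symmetric] mult_ac)
    finally show ?thesis by (simp only: ennreal_suminf_cmult)
  qed
  ultimately have "\<forall>s>0. (\<Sum>k. ennreal (kcoeff n m k * s powr (real k / m))) \<le>
      ennreal (C' * 16 * exp ((1 + \<epsilon>) * s))"
    by (meson order_trans)
  thus ?thesis using C' by (intro exI[of _ "C' * 16"]) simp
qed

text \<open>Coefficients of the comparison series in \<open>|z|^(2k)\<close>, built backwards from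
  the integral: integrating \<open>|cinner x y|^(2k)\<close> against
  \<open>exp (- b |y|^(2m))\<close> cancels all Gamma factors of \<open>kcoeff\<close> and leaves
  \<open>1 / Gamma (k / m + 1)\<close>. The power of 4 produces the 4 in
  \<open>\<beta>^2 / (4 b)\<close>.\<close>

definition bcoeff :: "nat \<Rightarrow> real \<Rightarrow> nat \<Rightarrow> real" where
  "bcoeff n m k = kcoeff n m k / (4 powr (real k / m) * Gamma (real k / m + 1))"

lemma bcoeff_pos:
  assumes "n \<ge> 1" "m > 0"
  shows "bcoeff n m k > 0"
  unfolding bcoeff_def using assms
  by (intro divide_pos_pos mult_pos_pos kcoeff_pos Gamma_real_pos) (auto intro: add_nonneg_pos)

text \<open>By duplication \<open>4^u Gamma(u + 1)^2\<close> is \<open>Gamma (2 * u + 1)\<close>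
  times half a power, with \<open>u = k / m\<close>. So \<open>bcoeff\<close> is of the order of the
  coefficients of an exponential series on the grid \<open>2 k / m\<close> with index power
  \<open>n - n / m - 1/2\<close>, which is nonnegative by hypothesis.\<close>

lemma bcoeff_series_ge:
  assumes n: "n \<ge> 2" and m: "1 < m" "m < 2" and H: "real n - real n / m \<ge> 1 / 2"
  shows "\<exists>C>0. \<forall>s>0. ennreal (s powr (real n - real n / m - 1 / 2) * exp s) \<le>
    ennreal C * (\<Sum>k. ennreal (bcoeff n m k * s powr (2 / m * real k)))"
proof -
  define h where "h = real n - real n / m"
  have h: "h \<ge> 1 / 2" using H by (simp add: h_def)
  obtain c where c: "c > 0" "\<And>k. c * (1 + real k / m) powr h / Gamma (real k / m + 1) \<le> kcoeff n m k"
    using kcoeff_lower[OF n m] unfolding h_def by blast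
  have "2 / m > 0" "2 / m \<le> 2" "h - 1 / 2 \<ge> 0" using m h by (auto simp: field_simps)
  then obtain C where C: "C > 0" "\<And>S. S > 0 \<Longrightarrow> ennreal (S powr (h - 1 / 2) * exp S) \<le>
      ennreal C * (\<Sum>k. ennreal ((1 + 2 / m * real k) powr (h - 1 / 2) * expterm (2 / m * real k) S))"
    using suminf_expterm_lower[of "2 / m" "h - 1 / 2"] by blast
  define C' where "C' = 2 powr (h - 1 / 2) * 2 / c"
  have C': "C' > 0" using c by (simp add: C'_def)
  have "(1 + 2 / m * real k) powr (h - 1 / 2) * expterm (2 / m * real k) s \<le>
      C' * (bcoeff n m k * s powr (2 / m * real k))" if s: "s > 0" for s k
  proof -
    define u where "u = real k / m"
    have u: "u \<ge> 0" using m by (simp add: u_def)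
    have k2: "2 / m * real k = 2 * u" by (simp add: u_def)
    have G: "Gamma (u + 1) > 0" "Gamma (2 * u + 1) > 0" using u by (auto intro!: Gamma_real_pos)
    have "(1 + 2 * u) powr (h - 1 / 2) / Gamma (2 * u + 1) \<le> (2 * (1 + u)) powr (h - 1 / 2) / Gamma (2 * u + 1)"
      using u h G by (intro divide_right_mono powr_mono2) auto
    also have "\<dots> = 2 powr (h - 1 / 2) * (1 + u) powr h / ((1 + u) powr (1 / 2) * Gamma (2 * u + 1))"
      unfolding powr_mult powr_diff by simp
    also have "\<dots> = 2 * 2 powr (h - 1 / 2) * (1 + u) powr h / (2 * (Gamma (2 * u + 1) * (1 + u) powr (1 / 2)))"
      by (simp add: mult_ac)
    also have "\<dots> \<le> 2 * 2 powr (h - 1 / 2) * (1 + u) powr h / (4 powr u * (Gamma (u + 1))\<^sup>2)"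
      using Gamma_double_lower[OF u] G u less_imp_neq[OF G(1)]
      by (intro divide_left_mono mult_pos_pos mult_nonneg_nonneg) (auto simp: zero_less_power2)
    also have "\<dots> = C' * ((c * (1 + u) powr h / Gamma (u + 1)) / (4 powr u * Gamma (u + 1)))"
      using c by (simp add: C'_def power2_eq_square mult_ac)
    also have "\<dots> \<le> C' * (kcoeff n m k / (4 powr u * Gamma (u + 1)))"
      using c(2)[of k] C' G unfolding u_def by (intro mult_left_mono divide_right_mono) auto
    also have "\<dots> = C' * bcoeff n m k" by (simp add: bcoeff_def u_def)
    finally have "(1 + 2 * u) powr (h - 1 / 2) / Gamma (2 * u + 1) * s powr (2 * u) \<le> C' * bcoeff n m k * s powr (2 * u)"
      by (intro mult_right_mono) auto
    thus ?thesis unfolding k2 expterm_def by (simp add: mult_ac)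
  qed
  hence *: "(\<Sum>k. ennreal ((1 + 2 / m * real k) powr (h - 1 / 2) * expterm (2 / m * real k) s)) \<le>
      (\<Sum>k. ennreal C' * ennreal (bcoeff n m k * s powr (2 / m * real k)))" if "s > 0" for s
    using C' that by (intro suminf_le) (auto simp flip: ennreal_mult' intro!: ennreal_leI)
  have "ennreal (s powr (h - 1 / 2) * exp s) \<le>
    ennreal (C * C') * (\<Sum>k. ennreal (bcoeff n m k * s powr (2 / m * real k)))" if s: "s > 0" for s
  proof -
    have "ennreal (s powr (h - 1 / 2) * exp s) \<le> ennreal C *
        (\<Sum>k. ennreal C' * ennreal (bcoeff n m k * s powr (2 / m * real k)))"
      by (rule order_trans[OF C(2)[OF s] mult_left_mono[OF *[OF s]]]) auto
    thus ?thesis using C C' by (simp add: ennreal_mult' mult_ac)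
  qed
  thus ?thesis using C C' unfolding h_def by (intro exI[of _ "C * C'"]) auto
qed

section \<open>Lebesgue measure on complex vector spaces\<close>

lemma nn_integral_lborel_affine:
  fixes f :: "'a::euclidean_space \<Rightarrow> ennreal"
  assumes [measurable]: "f \<in> borel_measurable borel" and "c \<noteq> 0"
  shows "(\<integral>\<^sup>+x. f x \<partial>lborel) = ennreal (\<bar>c\<bar> ^ DIM('a)) * (\<integral>\<^sup>+x. f (t + c *\<^sub>R x) \<partial>lborel)"
  by (subst lborel_affine[OF \<open>c \<noteq> 0\<close>, of t])
    (simp add: nn_integral_density nn_integral_distr nn_integral_cmult)

lemma nn_integral_lborel_shift:
  fixes f :: "'a::euclidean_space \<Rightarrow> ennreal"
  assumes "f \<in> borel_measurable borel"
  shows "(\<integral>\<^sup>+x. f (t + x) \<partial>lborel) = (\<integral>\<^sup>+x. f x \<partial>lborel)"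
  using nn_integral_lborel_affine[OF assms, of 1 t] by simp

lemma nn_integral_lborel_reflect:
  fixes f :: "'a::euclidean_space \<Rightarrow> ennreal"
  assumes "f \<in> borel_measurable borel"
  shows "(\<integral>\<^sup>+x. f (t - x) \<partial>lborel) = (\<integral>\<^sup>+x. f x \<partial>lborel)"
  using nn_integral_lborel_affine[OF assms, of "-1" t] by simp

text \<open>Uniqueness of Haar measure in disguise: the image measure is again translation invariant,
  and Fubini compares it with Lebesgue measure through the unit ball.\<close>

lemma distr_lborel_isometry:
  fixes T :: "'a::euclidean_space \<Rightarrow> 'a"
  assumes T: "linear T" "\<And>x. norm (T x) = norm x"
  shows "distr lborel borel T = lborel"
proof (rule measure_eqI)
  have [measurable]: "T \<in> borel_measurable borel"
    by (intro borel_measurable_continuous_onI linear_continuous_on linear_conv_bounded_linear[THEN iffD1] T)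
  have "inj T" using T(2) by (simp add: linear_injective_0[OF T(1)]) (metis norm_eq_zero)
  hence surj: "surj T" using T(1) by (simp add: linear_injective_imp_surjective)
  fix A :: "'a set" assume "A \<in> sets (distr lborel borel T)"
  hence A[measurable]: "A \<in> sets borel" by simp
  define B where "B = ball (0::'a) 1"
  have B[measurable]: "B \<in> sets borel" by (simp add: B_def)
  define I where "I X = (\<lambda>x. indicator X x :: ennreal)" for X :: "'a set"
  have [measurable]: "I A \<in> borel_measurable borel" "I B \<in> borel_measurable borel"
    by (simp_all add: I_def)
  have em: "emeasure (distr lborel borel T) X = (\<integral>\<^sup>+x. I X (T x) \<partial>lborel)" if "X \<in> sets borel" for X
    using that unfolding I_def
    by (subst nn_integral_indicator[symmetric], simp) (subst nn_integral_distr, simp_all)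
  have em': "emeasure lborel X = (\<integral>\<^sup>+x. I X x \<partial>lborel)" if "X \<in> sets borel" for X
    using that unfolding I_def by simp
  have "emeasure (distr lborel borel T) A * emeasure lborel B =
      (\<integral>\<^sup>+x. \<integral>\<^sup>+y. I A (T x) * I B y \<partial>lborel \<partial>lborel)"
    by (simp add: em em' nn_integral_cmult nn_integral_multc)
  also have "\<dots> = (\<integral>\<^sup>+x. \<integral>\<^sup>+y. I A (T x) * I B (T x + y) \<partial>lborel \<partial>lborel)"
    by (rule nn_integral_cong) (simp add: nn_integral_cmult nn_integral_lborel_shift)
  also have "\<dots> = (\<integral>\<^sup>+y. \<integral>\<^sup>+x. I A (T x) * I B (T x + y) \<partial>lborel \<partial>lborel)"
    by (rule lborel_pair.Fubini') simp
  also have "\<dots> = (\<integral>\<^sup>+y. \<integral>\<^sup>+x. I A (T x - y) * I B (T x) \<partial>lborel \<partial>lborel)"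
  proof (rule nn_integral_cong)
    fix y :: 'a
    obtain w where w: "T w = y" using surj by (metis surjD)
    have "(\<integral>\<^sup>+x. I A (T x - y) * I B (T x) \<partial>lborel) =
        (\<integral>\<^sup>+x. I A (T (w + x) - y) * I B (T (w + x)) \<partial>lborel)"
      by (rule nn_integral_lborel_shift[symmetric]) simp
    thus "(\<integral>\<^sup>+x. I A (T x) * I B (T x + y) \<partial>lborel) = (\<integral>\<^sup>+x. I A (T x - y) * I B (T x) \<partial>lborel)"
      by (simp add: linear_add[OF T(1)] w add.commute)
  qed
  also have "\<dots> = (\<integral>\<^sup>+x. \<integral>\<^sup>+y. I A (T x - y) * I B (T x) \<partial>lborel \<partial>lborel)"
    by (rule lborel_pair.Fubini') simp
  also have "\<dots> = (\<integral>\<^sup>+x. emeasure lborel A * I B (T x) \<partial>lborel)"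
    by (rule nn_integral_cong) (simp add: nn_integral_multc nn_integral_lborel_reflect em')
  also have "\<dots> = emeasure lborel A * emeasure (distr lborel borel T) B"
    by (simp add: nn_integral_cmult em)
  \<comment> \<open>Here the isometry enters: the indicator of the ball depends on the norm only.
    Its volume is positive and finite and can be cancelled.\<close>
  also have "emeasure (distr lborel borel T) B = emeasure lborel B"
    unfolding em[OF B] em'[OF B] by (intro nn_integral_cong) (simp add: I_def B_def T(2) indicator_def)
  finally have "emeasure (distr lborel borel T) A * emeasure lborel B = emeasure lborel A * emeasure lborel B" .
  moreover have "emeasure lborel B \<noteq> 0" "emeasure lborel B \<noteq> \<infinity>"
    using less_imp_neq[OF unit_ball_vol_pos[of "real DIM('a)"]] by (auto simp: B_def emeasure_ball)
  ultimately show "emeasure (distr lborel borel T) A = emeasure lborel A"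
    using ennreal_mult_divide_eq by (metis infinity_ennreal_def)
qed simp

lemma nn_integral_lborel_isometry:
  fixes T :: "'a::euclidean_space \<Rightarrow> 'a" and f :: "'a \<Rightarrow> ennreal"
  assumes "linear T" "\<And>x. norm (T x) = norm x" and [measurable]: "f \<in> borel_measurable borel"
  shows "(\<integral>\<^sup>+x. f (T x) \<partial>lborel) = (\<integral>\<^sup>+x. f x \<partial>lborel)"
proof -
  have [measurable]: "T \<in> borel_measurable borel"
    by (intro borel_measurable_continuous_onI linear_continuous_on linear_conv_bounded_linear[THEN iffD1] assms)
  show ?thesis
    by (subst (2) distr_lborel_isometry[OF assms(1,2), symmetric]) (simp add: nn_integral_distr)
qed

lemma integral_lborel_isometry:
  fixes T :: "'a::euclidean_space \<Rightarrow> 'a" and f :: "'a \<Rightarrow> complex"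
  assumes "linear T" "\<And>x. norm (T x) = norm x" and [measurable]: "f \<in> borel_measurable borel"
  shows "(\<integral>x. f (T x) \<partial>lborel) = (\<integral>x. f x \<partial>lborel)"
proof -
  have [measurable]: "T \<in> borel_measurable borel"
    by (intro borel_measurable_continuous_onI linear_continuous_on linear_conv_bounded_linear[THEN iffD1] assms)
  show ?thesis
    by (subst (2) distr_lborel_isometry[OF assms(1,2), symmetric]) (simp add: integral_distr)
qed

section \<open>Product structure of Lebesgue measure on vectors\<close>

lemma borel_measurable_vec_lambda [measurable]:
  "(\<lambda>f. \<chi> i. f i) \<in> borel_measurable (\<Pi>\<^sub>M i\<in>(UNIV::'n::finite set). (lborel :: 'a::euclidean_space measure))"
proof (subst borel_measurable_euclidean_space, intro ballI)
  fix b :: "'a ^ 'n" assume "b \<in> Basis"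
  then obtain i u where b: "b = axis i u" "u \<in> Basis" by (auto simp: Basis_vec_def)
  show "(\<lambda>x. (\<chi> i. x i) \<bullet> b) \<in> borel_measurable (\<Pi>\<^sub>M i\<in>(UNIV::'n set). (lborel :: 'a measure))"
    unfolding b by (simp add: inner_axis)
qed

text \<open>Lebesgue measure is determined by its values on boxes, and a box of vectors is a product
  of boxes in the coordinates. This lets integrals of products of functions of single coordinates
  factor.\<close>

lemma lborel_vec_eq:
  "(lborel :: ('a::euclidean_space ^ 'n::finite) measure) =
    distr (\<Pi>\<^sub>M i\<in>UNIV. lborel) borel (\<lambda>f. \<chi> i. f i)"
proof (rule lborel_eqI)
  interpret product_sigma_finite "\<lambda>_::'n. lborel :: 'a measure" ..
  fix l u :: "'a ^ 'n" assume lu: "\<And>b. b \<in> Basis \<Longrightarrow> l \<bullet> b \<le> u \<bullet> b"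
  have lu': "l $ i \<bullet> b \<le> u $ i \<bullet> b" if "b \<in> Basis" for i b
    using lu[of "axis i b"] that by (simp add: inner_axis axis_in_Basis_iff)
  have Basis: "(Basis :: ('a ^ 'n) set) = (\<lambda>(i, b). axis i b) ` (UNIV \<times> Basis)"
    by (auto simp: Basis_vec_def)
  have inj: "inj_on (\<lambda>(i::'n, b::'a). axis i b) (UNIV \<times> Basis)"
    by (auto simp: inj_on_def axis_eq_axis)
  have "(\<lambda>f. \<chi> i. f i) -` box l u \<inter> space (\<Pi>\<^sub>M i\<in>(UNIV::'n set). (lborel :: 'a measure)) =
      (\<Pi>\<^sub>E i\<in>UNIV. box (l $ i) (u $ i))"
    by (auto simp: mem_box Basis inner_axis space_PiM PiE_def Pi_iff)
  hence "emeasure (distr (\<Pi>\<^sub>M i\<in>(UNIV::'n set). (lborel :: 'a measure)) borel (\<lambda>f. \<chi> i. f i)) (box l u) =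
      emeasure (\<Pi>\<^sub>M i\<in>(UNIV::'n set). (lborel :: 'a measure)) (\<Pi>\<^sub>E i\<in>UNIV. box (l $ i) (u $ i))"
    by (simp add: emeasure_distr)
  also have "\<dots> = (\<Prod>i\<in>UNIV. emeasure lborel (box (l $ i) (u $ i)))"
    by (intro emeasure_PiM) auto
  also have "\<dots> = (\<Prod>i\<in>UNIV. ennreal (\<Prod>b\<in>Basis. (u $ i - l $ i) \<bullet> b))"
    using lu' by (intro prod.cong) (auto simp: emeasure_lborel_box)
  also have "\<dots> = ennreal (\<Prod>i\<in>UNIV. \<Prod>b\<in>Basis. (u $ i - l $ i) \<bullet> b)"
    using lu' by (intro prod_ennreal prod_nonneg) (auto simp: inner_diff_left)
  also have "(\<Prod>i\<in>UNIV. \<Prod>b\<in>Basis. (u $ i - l $ i) \<bullet> b) = (\<Prod>b\<in>Basis. (u - l) \<bullet> b)"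
    unfolding Basis prod.reindex[OF inj] by (simp add: prod.cartesian_product inner_axis case_prod_beta)
  finally show "emeasure (distr (\<Pi>\<^sub>M i\<in>(UNIV::'n set). (lborel :: 'a measure)) borel (\<lambda>f. \<chi> i. f i)) (box l u) =
      ennreal (\<Prod>b\<in>Basis. (u - l) \<bullet> b)" .
qed simp

lemma nn_integral_lborel_vec_prod:
  fixes f :: "'n::finite \<Rightarrow> 'a::euclidean_space \<Rightarrow> ennreal"
  assumes [measurable]: "\<And>i. f i \<in> borel_measurable borel"
  shows "(\<integral>\<^sup>+x. (\<Prod>i\<in>UNIV. f i (x $ i)) \<partial>lborel) = (\<Prod>i\<in>UNIV. \<integral>\<^sup>+z. f i z \<partial>lborel)"
proof -
  interpret product_sigma_finite "\<lambda>_::'n. lborel :: 'a measure" ..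
  have [measurable]: "(\<lambda>x :: 'a ^ 'n. x $ i) \<in> borel_measurable borel" for i
    by (intro borel_measurable_continuous_onI continuous_intros)
  show ?thesis
    by (subst lborel_vec_eq, subst nn_integral_distr)
      (simp_all add: product_nn_integral_prod)
qed

section \<open>Gamma integrals and radial exponential weights\<close>

lemma nn_integral_Gamma:
  assumes "x > 0"
  shows "(\<integral>\<^sup>+t. ennreal (indicator {0<..} t * t powr (x - 1) * exp (- t)) \<partial>lborel) = ennreal (Gamma x)"
proof -
  have "((\<lambda>t. t powr (x - 1) / exp t) has_integral Gamma x) {0..}"
    by (rule Gamma_integral_real[OF assms])
  hence "(\<integral>\<^sup>+t. ennreal (indicator {0..} t * (t powr (x - 1) / exp t)) \<partial>lborel) = ennreal (Gamma x)"
    by (intro nn_integral_has_integral_lebesgue) auto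
  also have "(\<integral>\<^sup>+t. ennreal (indicator {0..} t * (t powr (x - 1) / exp t)) \<partial>lborel) =
      (\<integral>\<^sup>+t. ennreal (indicator {0<..} t * t powr (x - 1) * exp (- t)) \<partial>lborel)"
    by (intro nn_integral_cong) (auto simp: indicator_def exp_minus field_simps)
  finally show ?thesis .
qed

lemma nn_integral_exp_tail:
  "(\<integral>\<^sup>+t. ennreal (indicator {a<..} t * exp (- t)) \<partial>lborel) = ennreal (exp (- a))"
proof -
  have "(\<integral>\<^sup>+t. ennreal (indicator {a<..} t * exp (- t)) \<partial>lborel) =
      (\<integral>\<^sup>+t. ennreal (indicator {a<..} (a + t) * exp (- (a + t))) \<partial>lborel)"
    by (rule nn_integral_lborel_shift[symmetric]) simp
  also have "\<dots> = (\<integral>\<^sup>+t. ennreal (exp (- a)) * ennreal (indicator {0<..} t * t powr (1 - 1) * exp (- t)) \<partial>lborel)"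
    by (intro nn_integral_cong)
      (auto simp: indicator_def exp_add exp_diff exp_minus field_simps simp flip: ennreal_mult')
  also have "\<dots> = ennreal (exp (- a))"
    by (subst nn_integral_cmult, simp) (use nn_integral_Gamma[of 1] in simp)
  finally show ?thesis .
qed

text \<open>Layer cake: only the ball masses of \<open>h\<close>, which scale like a power, enter the integral.\<close>

lemma nn_integral_homogeneous_exp:
  fixes h :: "'a::euclidean_space \<Rightarrow> real"
  assumes [measurable]: "h \<in> borel_measurable borel" and h: "\<And>x. h x \<ge> 0"
    and hom: "\<And>t x. t > 0 \<Longrightarrow> h (t *\<^sub>R x) = t powr d * h x"
    and d: "d \<ge> 0" and ac: "a > 0" "c > 0"
  shows "(\<integral>\<^sup>+y. ennreal (h y * exp (- c * norm y powr a)) \<partial>lborel) =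
    (\<integral>\<^sup>+y. ennreal (h y * indicator (ball 0 1) y) \<partial>lborel) *
      ennreal (c powr (- (d + DIM('a)) / a) * Gamma ((d + DIM('a)) / a + 1))"
proof -
  have [measurable]: "(\<lambda>y. indicator (ball 0 1) y :: real) \<in> borel_measurable (borel :: 'a measure)"
    by (intro borel_measurable_indicator) simp
  define e where "e = d + real DIM('a)"
  have e: "e > 0" using d by (simp add: e_def add_nonneg_pos)
  define N where "N = (\<integral>\<^sup>+y. ennreal (h y * indicator (ball 0 1) y) \<partial>lborel)"
  have "(\<integral>\<^sup>+y. ennreal (h y * exp (- c * norm y powr a)) \<partial>lborel) =
      (\<integral>\<^sup>+y. \<integral>\<^sup>+t. ennreal (h y * (indicator {c * norm y powr a<..} t * exp (- t))) \<partial>lborel \<partial>lborel)"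
  proof (intro nn_integral_cong)
    fix y :: 'a
    have "(\<integral>\<^sup>+t. ennreal (h y * (indicator {c * norm y powr a<..} t * exp (- t))) \<partial>lborel) =
        (\<integral>\<^sup>+t. ennreal (h y) * ennreal (indicator {c * norm y powr a<..} t * exp (- t)) \<partial>lborel)"
      by (intro nn_integral_cong) (simp add: ennreal_mult' h)
    also have "\<dots> = ennreal (h y * exp (- c * norm y powr a))"
      by (subst nn_integral_cmult, simp, subst nn_integral_exp_tail) (simp add: ennreal_mult' h)
    finally show "ennreal (h y * exp (- c * norm y powr a)) =
        (\<integral>\<^sup>+t. ennreal (h y * (indicator {c * norm y powr a<..} t * exp (- t))) \<partial>lborel)" ..
  qed
  also have "\<dots> = (\<integral>\<^sup>+y. \<integral>\<^sup>+t. ennreal (h y * (if c * norm y powr a < t then exp (- t) else 0)) \<partial>lborel \<partial>lborel)"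
    by (intro nn_integral_cong) (auto simp: indicator_def)
  also have "\<dots> = (\<integral>\<^sup>+t. \<integral>\<^sup>+y. ennreal (h y * (if c * norm y powr a < t then exp (- t) else 0)) \<partial>lborel \<partial>lborel)"
    by (rule lborel_pair.Fubini') simp
  also have "\<dots> = (\<integral>\<^sup>+t. N * ennreal (c powr (- e / a)) *
      ennreal (indicator {0<..} t * t powr (e / a + 1 - 1) * exp (- t)) \<partial>lborel)"
  proof (intro nn_integral_cong)
    fix t :: real
    show "(\<integral>\<^sup>+y. ennreal (h y * (if c * norm y powr a < t then exp (- t) else 0)) \<partial>lborel) =
        N * ennreal (c powr (- e / a)) * ennreal (indicator {0<..} t * t powr (e / a + 1 - 1) * exp (- t))"
    proof (cases "t > 0")
      case False
      have "0 \<le> c * norm y powr a" for y :: 'a using ac by simp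
      hence "\<not> c * norm y powr a < t" for y :: 'a
        using False by (meson not_less order_trans)
      thus ?thesis using False by simp
    next
      case True
      \<comment> \<open>The radius of the ball on which \<open>c * norm y powr a < t\<close>.
        Rescaling by \<open>r\<close> maps it to the unit ball and extracts a power of
        \<open>t\<close>.\<close>
      define r where "r = (t / c) powr (1 / a)"
      have r: "r > 0" using True ac by (simp add: r_def)
      have iff: "c * norm (r *\<^sub>R y) powr a < t \<longleftrightarrow> y \<in> ball 0 1" for y :: 'a
      proof -
        have "c * norm (r *\<^sub>R y) powr a = t * norm y powr a"
          using r True ac by (simp add: powr_mult r_def powr_powr)
        also have "\<dots> < t \<longleftrightarrow> norm y powr a < 1 powr a" using True by simp
        also have "\<dots> \<longleftrightarrow> norm y < 1"
          using ac by (meson norm_ge_zero not_less powr_less_mono2 powr_mono2 less_imp_le zero_le_one)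
        finally show ?thesis by simp
      qed
      have "(\<integral>\<^sup>+y. ennreal (h y * (if c * norm y powr a < t then exp (- t) else 0)) \<partial>lborel) =
          ennreal (\<bar>r\<bar> ^ DIM('a)) * (\<integral>\<^sup>+y. ennreal (h (0 + r *\<^sub>R y) *
            (if c * norm (0 + r *\<^sub>R y) powr a < t then exp (- t) else 0)) \<partial>lborel)"
        using r by (intro nn_integral_lborel_affine) auto
      also have "(\<integral>\<^sup>+y. ennreal (h (0 + r *\<^sub>R y) *
            (if c * norm (0 + r *\<^sub>R y) powr a < t then exp (- t) else 0)) \<partial>lborel) =
          (\<integral>\<^sup>+y. ennreal (r powr d * exp (- t)) * ennreal (h y * indicator (ball 0 1) y) \<partial>lborel)"
        unfolding add_0_left iff
        using r by (intro nn_integral_cong) (auto simp: hom h indicator_def simp flip: ennreal_mult')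
      also have "\<dots> = ennreal (r powr d * exp (- t)) * N"
        unfolding N_def by (intro nn_integral_cmult) simp
      also have "ennreal (\<bar>r\<bar> ^ DIM('a)) * (ennreal (r powr d * exp (- t)) * N) =
          N * ennreal (r powr e * exp (- t))"
        using r by (simp add: e_def powr_add powr_realpow ennreal_mult' mult_ac)
      also have "r powr e = c powr (- e / a) * t powr (e / a)"
        using True ac by (simp add: r_def powr_powr powr_divide powr_minus_divide)
      finally show ?thesis using True by (simp add: ennreal_mult' mult_ac)
    qed
  qed
  also have "\<dots> = N * ennreal (c powr (- e / a)) * ennreal (Gamma (e / a + 1))"
    using e ac by (subst nn_integral_cmult, simp, subst nn_integral_Gamma) (auto intro: add_pos_pos)
  also have "\<dots> = N * ennreal (c powr (- e / a) * Gamma (e / a + 1))"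
    by (simp add: ennreal_mult' mult.assoc)
  finally show ?thesis unfolding N_def e_def .
qed

section \<open>Moments and orthogonality of monomials\<close>

text \<open>Replaces polar coordinates. The complementary integrand \<open>1 - |z|^s\<close> is the
  length of the interval from \<open>|z|^s\<close> to 1, and by Fubini its integral becomes that of
  the disc areas \<open>pi * t powr (2 / s)\<close>. The case \<open>k = 0\<close> is apart because
  the radius \<open>t powr (1 / s)\<close> needs \<open>s > 0\<close>.\<close>

lemma nn_integral_disc_moment:
  assumes "q > 0"
  shows "(\<integral>\<^sup>+z. ennreal ((norm z ^ k) powr q * indicator (ball 0 1) z) \<partial>(lborel :: complex measure)) =
    ennreal (2 * pi / (q * real k + 2))"
proof (cases "k = 0")
  case True
  have "(\<integral>\<^sup>+z. ennreal ((norm z ^ k) powr q * indicator (ball 0 1) z) \<partial>(lborel :: complex measure)) =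
      emeasure lborel (ball (0::complex) 1)"
    using True by (simp add: ennreal_indicator)
  thus ?thesis using True unit_ball_vol_even[of 1] by (simp add: emeasure_ball)
next
  case False
  define s where "s = q * real k"
  have s: "s > 0" using False assms by (simp add: s_def)
  have pw: "(norm z ^ k) powr q = norm z powr s" for z :: complex
    using False by (cases "z = 0") (simp_all add: s_def powr_powr powr_realpow[symmetric] mult.commute)
  define I where "I = (\<integral>\<^sup>+z. ennreal (norm z powr s * indicator (ball 0 1) z) \<partial>(lborel :: complex measure))"
  define J where "J = (\<integral>\<^sup>+z. ennreal ((1 - norm z powr s) * indicator (ball 0 1) z) \<partial>(lborel :: complex measure))"
  have le1: "norm z powr s \<le> 1" if "z \<in> ball 0 1" for z :: complex
    using that s powr_mono2[of s "norm z" 1] by simp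
  have [measurable]: "(\<lambda>y. indicator (ball 0 1) y :: real) \<in> borel_measurable (borel :: complex measure)"
    by (intro borel_measurable_indicator) simp
  have "I + J = (\<integral>\<^sup>+z. ennreal (norm z powr s * indicator (ball 0 1) z) +
      ennreal ((1 - norm z powr s) * indicator (ball 0 1) z) \<partial>(lborel :: complex measure))"
    unfolding I_def J_def by (subst nn_integral_add) simp_all
  also have "\<dots> = (\<integral>\<^sup>+z. indicator (ball 0 1) z \<partial>(lborel :: complex measure))"
    using le1 by (intro nn_integral_cong) (auto simp: indicator_def simp flip: ennreal_plus)
  also have "\<dots> = ennreal pi" using unit_ball_vol_even[of 1] by (simp add: emeasure_ball)
  finally have IJ: "I + J = ennreal pi" .
  have "J = (\<integral>\<^sup>+z. \<integral>\<^sup>+t. indicator {norm z powr s..<1} t \<partial>lborel \<partial>(lborel :: complex measure))"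
    unfolding J_def
  proof (rule nn_integral_cong)
    fix z :: complex
    have *: "1 \<le> norm z powr s" if "\<not> norm z < 1"
      using that s powr_mono2[of s 1 "norm z"] by auto
    have "(\<integral>\<^sup>+t. indicator {norm z powr s..<1} t \<partial>lborel) = emeasure lborel {norm z powr s..<1}"
      by simp
    also have "\<dots> = ennreal ((1 - norm z powr s) * indicator (ball 0 1) z)"
      using le1[of z] * by (cases "norm z < 1") auto
    finally show "ennreal ((1 - norm z powr s) * indicator (ball 0 1) z) =
        (\<integral>\<^sup>+t. indicator {norm z powr s..<1} t \<partial>lborel)" ..
  qed
  also have "\<dots> = (\<integral>\<^sup>+z. \<integral>\<^sup>+t. (if norm z powr s \<le> t \<and> t < 1 then 1 else 0) \<partial>lborel \<partial>(lborel :: complex measure))"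
    by (simp add: indicator_def of_bool_def)
  also have "\<dots> = (\<integral>\<^sup>+t. \<integral>\<^sup>+z. (if norm z powr s \<le> t \<and> t < 1 then 1 else 0) \<partial>(lborel :: complex measure) \<partial>lborel)"
    by (rule lborel_pair.Fubini') simp
  also have "\<dots> = (\<integral>\<^sup>+t. ennreal (indicator {0..1} t * (pi * t powr (2 / s))) \<partial>lborel)"
  proof (rule nn_integral_cong_AE)
    have "AE t in lborel. t \<noteq> (1::real)" by (rule AE_lborel_singleton)
    thus "AE t in lborel. (\<integral>\<^sup>+z. (if norm z powr s \<le> t \<and> t < 1 then 1 else 0) \<partial>(lborel :: complex measure)) =
        ennreal (indicator {0..1} t * (pi * t powr (2 / s)))"
    proof eventually_elim
      fix t :: real assume "t \<noteq> 1"
      show "(\<integral>\<^sup>+z. (if norm z powr s \<le> t \<and> t < 1 then 1 else 0) \<partial>(lborel :: complex measure)) =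
        ennreal (indicator {0..1} t * (pi * t powr (2 / s)))"
      proof (cases "0 \<le> t \<and> t < 1")
        case False
        hence "\<not> (norm z powr s \<le> t \<and> t < 1)" for z :: complex
          using powr_ge_zero[of "norm z" s] by linarith
        thus ?thesis using False \<open>t \<noteq> 1\<close> by (auto simp: indicator_def)
      next
        case True
        have "norm z powr s \<le> t \<longleftrightarrow> norm z \<le> t powr (1 / s)" for z :: complex
        proof
          assume "norm z powr s \<le> t"
          hence "(norm z powr s) powr (1 / s) \<le> t powr (1 / s)" using s by (intro powr_mono2) auto
          thus "norm z \<le> t powr (1 / s)" using s by (simp add: powr_powr)
        next
          assume "norm z \<le> t powr (1 / s)"
          hence "norm z powr s \<le> (t powr (1 / s)) powr s" using s by (intro powr_mono2) auto
          thus "norm z powr s \<le> t" using s True by (simp add: powr_powr)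
        qed
        hence "(\<integral>\<^sup>+z. (if norm z powr s \<le> t \<and> t < 1 then 1 else 0) \<partial>(lborel :: complex measure)) =
            (\<integral>\<^sup>+z. indicator (cball 0 (t powr (1 / s))) z \<partial>(lborel :: complex measure))"
          using True by (intro nn_integral_cong) (auto simp: indicator_def)
        also have "\<dots> = ennreal (pi * (t powr (1 / s)) ^ 2)"
          using unit_ball_vol_even[of 1] by (simp add: emeasure_cball)
        also have "(t powr (1 / s)) ^ 2 = t powr (2 / s)"
          by (simp add: power2_eq_square powr_add[symmetric])
        finally show ?thesis using True by (simp add: indicator_def)
      qed
    qed
  qed
  also have "\<dots> = ennreal (pi * (1 powr (2 / s + 1) / (2 / s + 1)))"
    using s by (intro nn_integral_has_integral_lebesgue has_integral_mult_right has_integral_powr_from_0)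
      (auto intro: less_trans[of _ 0])
  also have "1 powr (2 / s + 1) / (2 / s + 1) = s / (s + 2)" using s by (simp add: field_simps)
  finally have J: "J = ennreal (pi * (s / (s + 2)))" .
  have "I = (I + J) - J" by (simp add: J)
  also have "\<dots> = ennreal (pi - pi * (s / (s + 2)))"
    by (subst IJ, subst J, rule ennreal_minus) (use s in auto)
  also have "pi - pi * (s / (s + 2)) = 2 * pi / (s + 2)" using s by (simp add: field_simps)
  finally show ?thesis unfolding I_def pw s_def .
qed

lemma nn_integral_gaussian_moment:
  assumes "q > 0"
  shows "(\<integral>\<^sup>+z. ennreal ((norm z ^ k) powr q * exp (- (norm z)\<^sup>2)) \<partial>(lborel :: complex measure)) =
    ennreal (pi * Gamma (q * real k / 2 + 1))"
proof -
  define s where "s = q * real k"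
  have s: "s \<ge> 0" using assms by (simp add: s_def)
  have [simp]: "norm z powr 2 = (norm z)\<^sup>2" for z :: complex by simp
  have "(\<integral>\<^sup>+z. ennreal ((norm z ^ k) powr q * exp (- 1 * norm z powr 2)) \<partial>(lborel :: complex measure)) =
      (\<integral>\<^sup>+z. ennreal ((norm z ^ k) powr q * indicator (ball 0 1) z) \<partial>(lborel :: complex measure)) *
      ennreal (1 powr (- (s + DIM(complex)) / 2) * Gamma ((s + DIM(complex)) / 2 + 1))"
  proof (rule nn_integral_homogeneous_exp)
    fix t :: real and x :: complex assume t: "t > 0"
    show "(norm (t *\<^sub>R x) ^ k) powr q = t powr s * (norm x ^ k) powr q"
      using t by (simp add: power_mult_distrib powr_mult s_def powr_powr powr_realpow[symmetric] mult.commute)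
  qed (use s in auto)
  also have "\<dots> = ennreal (2 * pi / (s + 2) * Gamma ((s + 2) / 2 + 1))"
    using s by (simp add: nn_integral_disc_moment[OF assms] s_def ennreal_mult'[symmetric])
  also have "Gamma ((s + 2) / 2 + 1) = (s + 2) / 2 * Gamma ((s + 2) / 2)"
    using s nonpos_Ints_nonpos[of "(s + 2) / 2"] by (intro Gamma_plus1) auto
  also have "2 * pi / (s + 2) * ((s + 2) / 2 * Gamma ((s + 2) / 2)) = pi * Gamma ((s + 2) / 2)"
    using s by simp
  also have "(s + 2) / 2 = s / 2 + 1" by simp
  finally show ?thesis by (simp add: s_def)
qed

definition vmono :: "('n::finite \<Rightarrow> nat) \<Rightarrow> complex ^ 'n \<Rightarrow> complex" where
  "vmono \<nu> y = (\<Prod>i\<in>UNIV. (y $ i) ^ \<nu> i)"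

lemma norm_vmono: "norm (vmono \<nu> y) = (\<Prod>i\<in>UNIV. norm (y $ i) ^ \<nu> i)"
  by (simp add: vmono_def prod_norm[symmetric] norm_power)

lemma continuous_on_vmono [continuous_intros]: "continuous_on A (vmono \<nu>)"
  unfolding vmono_def[abs_def] by (intro continuous_intros)

lemma borel_measurable_vmono [measurable]: "vmono \<nu> \<in> borel_measurable borel"
  by (intro borel_measurable_continuous_onI continuous_intros)

lemma norm_vec_square: "(norm (y :: complex ^ 'n::finite))\<^sup>2 = (\<Sum>i\<in>UNIV. (norm (y $ i))\<^sup>2)"
  by (simp add: norm_vec_def L2_set_def sum_nonneg)

text \<open>The value of the integral of \<open>|y^\<nu>|^q exp (- c |y|^(2m))\<close>. Here
  \<open>2 * D\<close> is the degree of homogeneity of \<open>|y^\<nu>|^q\<close> plus the real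
  dimension.\<close>

definition moment :: "('n::finite \<Rightarrow> nat) \<Rightarrow> real \<Rightarrow> real \<Rightarrow> real \<Rightarrow> real" where
  "moment \<nu> m q c =
    (let D = q * real (\<Sum>i\<in>UNIV. \<nu> i) / 2 + real CARD('n)
     in pi ^ CARD('n) * (\<Prod>i\<in>UNIV. Gamma (q * real (\<nu> i) / 2 + 1)) *
       (c powr (- D / m) * Gamma (D / m + 1) / Gamma (D + 1)))"

text \<open>By homogeneity the weight \<open>exp (- c |y|^a)\<close> contributes an explicit factor
  to the unknown unit ball integral \<open>N\<close>. For \<open>a = 2\<close> and
  \<open>c = 1\<close> the integral factors over the coordinates and reveals \<open>N\<close>; the
  same \<open>N\<close> then serves \<open>a = 2 * m\<close>.\<close>

lemma nn_integral_vmono: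
  fixes \<nu> :: "'n::finite \<Rightarrow> nat"
  assumes q: "q > 0" and c: "c > 0" and m: "m > 0"
  shows "(\<integral>\<^sup>+y. ennreal (norm (vmono \<nu> y) powr q * exp (- c * norm y powr (2 * m))) \<partial>lborel) =
    ennreal (moment \<nu> m q c)"
proof -
  define K where "K = q * real (\<Sum>i\<in>UNIV. \<nu> i)"
  define D where "D = K / 2 + real CARD('n)"
  define g where "g = pi ^ CARD('n) * (\<Prod>i\<in>UNIV. Gamma (q * real (\<nu> i) / 2 + 1))"
  define N where "N = (\<integral>\<^sup>+y. ennreal (norm (vmono \<nu> y) powr q * indicator (ball 0 1) y) \<partial>lborel)"
  have K: "K \<ge> 0" using q by (simp add: K_def sum_nonneg)
  have D: "D > 0" using K by (simp add: D_def add_nonneg_pos)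
  have DIM: "(K + DIM(complex ^ 'n)) = 2 * D" by (simp add: D_def)
  have hom: "norm (vmono \<nu> (t *\<^sub>R y)) powr q = t powr K * norm (vmono \<nu> y) powr q" if "t > 0" for t y
  proof -
    have "norm (vmono \<nu> (t *\<^sub>R y)) = t ^ (\<Sum>i\<in>UNIV. \<nu> i) * norm (vmono \<nu> y)"
      using that by (simp add: norm_vmono power_mult_distrib prod.distrib power_sum)
    moreover have "(t ^ (\<Sum>i\<in>UNIV. \<nu> i)) powr q = t powr K"
      using that by (simp add: K_def powr_powr mult.commute flip: powr_realpow del: of_nat_sum)
    ultimately show ?thesis by (simp add: powr_mult)
  qed
  have general: "(\<integral>\<^sup>+y. ennreal (norm (vmono \<nu> y) powr q * exp (- c * norm y powr a)) \<partial>lborel) =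
      N * ennreal (c powr (- (2 * D) / a) * Gamma ((2 * D) / a + 1))" if "c > 0" "a > 0" for c a
    unfolding N_def DIM[symmetric]
    by (rule nn_integral_homogeneous_exp) (use K that hom in auto)
  have "(\<integral>\<^sup>+y. ennreal (norm (vmono \<nu> y) powr q * exp (- 1 * norm y powr 2)) \<partial>lborel) =
      (\<integral>\<^sup>+y. (\<Prod>i\<in>UNIV. ennreal ((norm ((y :: complex ^ 'n) $ i) ^ \<nu> i) powr q * exp (- (norm (y $ i))\<^sup>2))) \<partial>lborel)"
  proof (rule nn_integral_cong)
    fix y :: "complex ^ 'n"
    have "exp (- 1 * norm y powr 2) = (\<Prod>i\<in>UNIV. exp (- (norm (y $ i))\<^sup>2))"
      by (simp add: norm_vec_square sum_negf[symmetric] exp_sum)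
    thus "ennreal (norm (vmono \<nu> y) powr q * exp (- 1 * norm y powr 2)) =
        (\<Prod>i\<in>UNIV. ennreal ((norm (y $ i) ^ \<nu> i) powr q * exp (- (norm (y $ i))\<^sup>2)))"
      by (simp add: norm_vmono prod_powr_distrib prod.distrib prod_ennreal)
  qed
  also have "\<dots> = (\<Prod>i\<in>UNIV. \<integral>\<^sup>+z. ennreal ((norm (z :: complex) ^ \<nu> i) powr q * exp (- (norm z)\<^sup>2)) \<partial>lborel)"
    by (rule nn_integral_lborel_vec_prod) simp
  also have "\<dots> = ennreal g"
    using q unfolding nn_integral_gaussian_moment[OF q] g_def
    by (subst prod_ennreal) (auto simp: prod.distrib intro!: mult_nonneg_nonneg less_imp_le[OF Gamma_real_pos] add_nonneg_pos)
  finally have "N * ennreal (Gamma (D + 1)) = ennreal g"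
    using general[of 1 2] by simp
  moreover have G: "Gamma (D + 1) > 0" using D by (intro Gamma_real_pos) simp
  ultimately have N: "N = ennreal g / ennreal (Gamma (D + 1))"
    by (metis ennreal_eq_0_iff ennreal_mult_divide_eq ennreal_neq_top not_less)
  have g: "g \<ge> 0" unfolding g_def using q
    by (intro mult_nonneg_nonneg prod_nonneg) (auto intro!: less_imp_le[OF Gamma_real_pos] add_nonneg_pos)
  have "(\<integral>\<^sup>+y. ennreal (norm (vmono \<nu> y) powr q * exp (- c * norm y powr (2 * m))) \<partial>lborel) =
      ennreal (g / Gamma (D + 1)) * ennreal (c powr (- D / m) * Gamma (D / m + 1))"
    using general[of c "2 * m"] c m g G by (simp add: N divide_ennreal)
  also have "\<dots> = ennreal (moment \<nu> m q c)"
    using g G unfolding moment_def Let_def K_def[symmetric] D_def[symmetric] g_def[symmetric]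
    by (simp add: ennreal_mult'[symmetric])
  finally show ?thesis .
qed

lemma moment_pos:
  assumes "q > 0" "c > 0" "m > 0"
  shows "moment \<nu> m q c > 0"
  unfolding moment_def Let_def using assms
  by (intro mult_pos_pos divide_pos_pos prod_pos)
    (auto intro!: Gamma_real_pos add_nonneg_pos add_nonneg_nonneg divide_nonneg_pos mult_nonneg_nonneg sum_nonneg)

section \<open>Orthogonality of monomials by coordinate rotations\<close>

lemma cnj_measurable [measurable]: "cnj \<in> borel_measurable borel"
  by (intro borel_measurable_continuous_onI continuous_intros)

definition coord_rot :: "'n \<Rightarrow> real \<Rightarrow> complex ^ 'n::finite \<Rightarrow> complex ^ 'n" where
  "coord_rot i t y = (\<chi> j. if j = i then cis t * y $ j else y $ j)"

lemma linear_coord_rot: "linear (coord_rot i t)"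
  by (rule linearI) (auto simp: coord_rot_def vec_eq_iff algebra_simps)

lemma norm_coord_rot: "norm (coord_rot i t y) = norm y"
proof -
  have "norm (coord_rot i t y $ j) = norm (y $ j)" for j
    by (simp add: coord_rot_def norm_mult)
  thus ?thesis by (simp add: norm_vec_def)
qed

lemma vmono_coord_rot: "vmono \<nu> (coord_rot i t y) = cis (real (\<nu> i) * t) * vmono \<nu> y"
proof -
  have "vmono \<nu> (coord_rot i t y) = (\<Prod>j\<in>UNIV. (if j = i then cis t ^ \<nu> i else 1) * (y $ j) ^ \<nu> j)"
    unfolding vmono_def by (intro prod.cong) (auto simp: coord_rot_def power_mult_distrib)
  also have "\<dots> = cis t ^ \<nu> i * vmono \<nu> y"
    by (simp add: prod.distrib vmono_def)
  finally show ?thesis by (simp add: Complex.DeMoivre)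
qed

text \<open>If the exponents differ at \<open>i\<close>, turning coordinate \<open>i\<close> by
  \<open>pi / (\<nu> i - e i)\<close> multiplies the integrand by -1, while Lebesgue measure and the
  radial weight do not change. The integral is its own negative.\<close>

lemma integral_vmono_orthogonal:
  fixes \<nu> e :: "'n::finite \<Rightarrow> nat" and w :: "real \<Rightarrow> real"
  assumes [measurable]: "w \<in> borel_measurable borel" and "\<nu> \<noteq> e"
  shows "(\<integral>y. vmono \<nu> y * cnj (vmono e y) * of_real (w (norm y)) \<partial>lborel) = 0"
proof -
  obtain i where i: "\<nu> i \<noteq> e i" using assms by auto
  define t where "t = pi / (real (\<nu> i) - real (e i))"
  define f where "f y = vmono \<nu> y * cnj (vmono e y) * of_real (w (norm y))" for y :: "complex ^ 'n"
  have t: "real (\<nu> i) * t - real (e i) * t = pi"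
    using i unfolding t_def left_diff_distrib[symmetric] by simp
  have "f (coord_rot i t y) = - f y" for y
  proof -
    have "f (coord_rot i t y) = (cis (real (\<nu> i) * t) * cnj (cis (real (e i) * t))) * f y"
      by (simp add: f_def vmono_coord_rot norm_coord_rot)
    also have "cis (real (\<nu> i) * t) * cnj (cis (real (e i) * t)) = -1"
      using t by (simp add: cis_cnj cis_mult)
    finally show ?thesis by simp
  qed
  moreover have "f \<in> borel_measurable borel"
    unfolding f_def[abs_def] by measurable
  ultimately have "(\<integral>y. f y \<partial>lborel) = - (\<integral>y. f y \<partial>lborel)"
    using integral_lborel_isometry[OF linear_coord_rot norm_coord_rot, of f i t] by simp
  thus ?thesis by (simp add: f_def equal_neg_zero)
qed

text \<open>Total functions forced to vanish off \<open>A\<close>: this makes the set finite and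
  lets an induction over \<open>A\<close> extend an index by a function update.\<close>

definition multi_indices :: "'i set \<Rightarrow> nat \<Rightarrow> ('i \<Rightarrow> nat) set" where
  "multi_indices A k = {e. (\<forall>i. i \<notin> A \<longrightarrow> e i = 0) \<and> sum e A = k}"

lemma finite_multi_indices: "finite A \<Longrightarrow> finite (multi_indices A k)"
proof -
  assume A: "finite A"
  have "e \<in> {e. \<forall>i. (i \<in> A \<longrightarrow> e i \<in> {..k}) \<and> (i \<notin> A \<longrightarrow> e i = 0)}" if "e \<in> multi_indices A k" for e
    using that member_le_sum[of _ A e] A by (auto simp: multi_indices_def)
  hence "multi_indices A k \<subseteq> {e. \<forall>i. (i \<in> A \<longrightarrow> e i \<in> {..k}) \<and> (i \<notin> A \<longrightarrow> e i = 0)}" by blast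
  thus ?thesis by (rule finite_subset) (use finite_set_of_finite_funs[OF A, of "{..k}" 0] in simp)
qed

text \<open>In divided powers the multinomial formula has no coefficients, and its induction step is
  exactly the binomial formula.\<close>

lemma multinomial_power:
  fixes z :: "'i \<Rightarrow> complex"
  assumes "finite A"
  shows "(\<Sum>i\<in>A. z i) ^ k / fact k = (\<Sum>e\<in>multi_indices A k. \<Prod>i\<in>A. z i ^ e i / fact (e i))"
  using assms
proof (induction A arbitrary: k rule: finite_induct)
  case empty
  have "multi_indices {} k = (if k = 0 then {\<lambda>_. 0} else {} :: ('i \<Rightarrow> nat) set)"
    by (auto simp: multi_indices_def)
  thus ?case by simp
next
  case (insert a A)
  have "(\<Sum>i\<in>insert a A. z i) ^ k / fact k = (z a + (\<Sum>i\<in>A. z i)) ^ k / fact k"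
    using insert by simp
  also have "\<dots> = (\<Sum>j\<le>k. z a ^ j / fact j * ((\<Sum>i\<in>A. z i) ^ (k - j) / fact (k - j)))"
    unfolding binomial_ring sum_divide_distrib
    by (intro sum.cong) (auto simp: binomial_fact)
  also have "\<dots> = (\<Sum>j\<le>k. \<Sum>e\<in>multi_indices A (k - j). z a ^ j / fact j * (\<Prod>i\<in>A. z i ^ e i / fact (e i)))"
    unfolding insert.IH by (simp add: sum_distrib_left)
  also have "\<dots> = (\<Sum>(j, e)\<in>(SIGMA j:{..k}. multi_indices A (k - j)). z a ^ j / fact j * (\<Prod>i\<in>A. z i ^ e i / fact (e i)))"
    using insert.hyps by (subst sum.Sigma) (auto simp: finite_multi_indices)
  also have "\<dots> = (\<Sum>e\<in>multi_indices (insert a A) k. \<Prod>i\<in>insert a A. z i ^ e i / fact (e i))"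
  proof (rule sum.reindex_bij_witness[where j = "\<lambda>(j, e). e(a := j)" and i = "\<lambda>e. (e a, e(a := 0))"])
    fix p assume "p \<in> (SIGMA j:{..k}. multi_indices A (k - j))"
    then obtain j e where p: "p = (j, e)" "j \<le> k" "e \<in> multi_indices A (k - j)" by auto
    have ea: "e a = 0" using p insert by (auto simp: multi_indices_def)
    have c: "sum (e(a := j)) A = sum e A" using insert by (intro sum.cong) auto
    show "(case case p of (j, e) \<Rightarrow> e(a := j) of e \<Rightarrow> (e a, e(a := 0))) = p"
      using p ea by (auto simp: fun_upd_idem)
    show "(case p of (j, e) \<Rightarrow> e(a := j)) \<in> multi_indices (insert a A) k"
      using p c insert by (auto simp: multi_indices_def)
    have "(\<Prod>i\<in>A. z i ^ (e(a := j)) i / fact ((e(a := j)) i)) = (\<Prod>i\<in>A. z i ^ e i / fact (e i))"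
      using insert by (intro prod.cong) auto
    thus "(\<Prod>i\<in>insert a A. z i ^ (case p of (j, e) \<Rightarrow> e(a := j)) i / fact ((case p of (j, e) \<Rightarrow> e(a := j)) i)) =
        (case p of (j, e) \<Rightarrow> z a ^ j / fact j * (\<Prod>i\<in>A. z i ^ e i / fact (e i)))"
      using p insert by simp
  next
    fix e assume e: "e \<in> multi_indices (insert a A) k"
    have c: "sum (e(a := 0)) A = sum e A" using insert by (intro sum.cong) auto
    show "(case (e a, e(a := 0)) of (j, e) \<Rightarrow> e(a := j)) = e" by simp
    show "(e a, e(a := 0)) \<in> (SIGMA j:{..k}. multi_indices A (k - j))"
      using e c insert by (auto simp: multi_indices_def)
  qed
  finally show ?case .
qed

section \<open>Integrals of powers of the inner product\<close>

lemma vec_nth_measurable [measurable]: "(\<lambda>x :: complex ^ 'n::finite. x $ i) \<in> borel_measurable borel"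
  by (intro borel_measurable_continuous_onI continuous_intros)

lemma cinner_measurable [measurable]:
  assumes [measurable]: "f \<in> borel_measurable M" "g \<in> borel_measurable M"
  shows "(\<lambda>x. cinner (f x) (g x)) \<in> borel_measurable M"
  unfolding cinner_def by measurable

lemma norm_cinner_le: "norm (cinner x y) \<le> norm x * norm y"
proof -
  have "norm (cinner x y) \<le> (\<Sum>i\<in>UNIV. norm (x $ i) * norm (y $ i))"
    unfolding cinner_def by (rule order_trans[OF norm_sum]) (simp add: norm_mult)
  also have "\<dots> \<le> L2_set (\<lambda>i. norm (x $ i)) UNIV * L2_set (\<lambda>i. norm (y $ i)) UNIV"
    using L2_set_mult_ineq[of "\<lambda>i. norm (x $ i)" "\<lambda>i. norm (y $ i)" UNIV] by simp
  finally show ?thesis by (simp add: norm_vec_def)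
qed

lemma cinner_commute: "cinner y x = cnj (cinner x y)"
  by (simp add: cinner_def mult.commute)

definition mfact :: "('n::finite \<Rightarrow> nat) \<Rightarrow> real" where
  "mfact e = (\<Prod>i\<in>UNIV. fact (e i))"

lemma mfact_pos: "mfact e > 0"
  unfolding mfact_def by (intro prod_pos) simp

lemma cinner_power:
  "cinner x y ^ k = (\<Sum>e\<in>multi_indices UNIV k. of_real (fact k / mfact e) * vmono e x * cnj (vmono e y))"
proof -
  have "cinner x y ^ k = fact k * ((\<Sum>i\<in>UNIV. x $ i * cnj (y $ i)) ^ k / fact k)"
    by (simp add: cinner_def)
  also have "\<dots> = (\<Sum>e\<in>multi_indices UNIV k. fact k * (\<Prod>i\<in>UNIV. (x $ i * cnj (y $ i)) ^ e i / fact (e i)))"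
    by (subst multinomial_power) (simp_all add: sum_distrib_left)
  also have "\<dots> = (\<Sum>e\<in>multi_indices UNIV k. of_real (fact k / mfact e) * vmono e x * cnj (vmono e y))"
    by (intro sum.cong) (simp_all add: mfact_def vmono_def prod_dividef power_mult_distrib prod.distrib)
  finally show ?thesis .
qed

lemma moment_2:
  "moment e m 2 b = pi ^ CARD('n) * mfact (e :: 'n::finite \<Rightarrow> nat) *
    (b powr (- (real (\<Sum>i\<in>UNIV. e i) + real CARD('n)) / m) *
      Gamma ((real (\<Sum>i\<in>UNIV. e i) + real CARD('n)) / m + 1) / Gamma (real (\<Sum>i\<in>UNIV. e i) + real CARD('n) + 1))"
proof -
  have "Gamma (real (e i) + 1) = fact (e i)" for i by (simp add: Gamma_fact add.commute)
  moreover have "2 * real (\<Sum>i\<in>UNIV. e i) / 2 = real (\<Sum>i\<in>UNIV. e i)" "2 * real (e i) / 2 = real (e i)" for i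
    by simp_all
  ultimately show ?thesis by (simp only: moment_def Let_def mfact_def)
qed

section \<open>Monomials against radial weights below an exponential, covering both the full weight
  and its truncations\<close>

context
  fixes w :: "real \<Rightarrow> real" and b m :: real
  assumes w [measurable]: "w \<in> borel_measurable borel"
    and w_nonneg: "\<And>t. 0 \<le> w t" and w_le: "\<And>t. w t \<le> exp (- b * t powr (2 * m))"
    and b: "b > 0" and m: "m > 0"
begin

lemma integrable_vmono_square: "integrable lborel (\<lambda>y. (norm (vmono \<nu> y))\<^sup>2 * w (norm y))"
proof -
  have "(\<integral>\<^sup>+y. ennreal (norm ((norm (vmono \<nu> y))\<^sup>2 * w (norm y))) \<partial>lborel) \<le>
      (\<integral>\<^sup>+y. ennreal (norm (vmono \<nu> y) powr 2 * exp (- b * norm y powr (2 * m))) \<partial>lborel)"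
    using w_nonneg w_le by (intro nn_integral_mono ennreal_leI) (auto intro!: mult_left_mono)
  also have "\<dots> < \<infinity>" using b m by (subst nn_integral_vmono) auto
  finally show ?thesis by (intro integrableI_bounded) auto
qed

lemma integrable_vmono_cnj: "integrable lborel (\<lambda>y. vmono \<nu> y * cnj (vmono e y) * of_real (w (norm y)))"
proof (rule Bochner_Integration.integrable_bound)
  show "integrable lborel (\<lambda>y. (norm (vmono \<nu> y))\<^sup>2 * w (norm y) + (norm (vmono e y))\<^sup>2 * w (norm y))"
    by (intro Bochner_Integration.integrable_add integrable_vmono_square)
  have "norm (vmono \<nu> y * cnj (vmono e y) * of_real (w (norm y))) \<le>
      norm ((norm (vmono \<nu> y))\<^sup>2 * w (norm y) + (norm (vmono e y))\<^sup>2 * w (norm y))" for y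
  proof -
    have "norm (vmono \<nu> y) * norm (vmono e y) \<le> (norm (vmono \<nu> y))\<^sup>2 + (norm (vmono e y))\<^sup>2"
    proof -
      have "a * b \<le> a\<^sup>2 + b\<^sup>2" if "a \<ge> 0" "b \<ge> 0" for a b :: real
        using sum_squares_bound[of a b] mult_nonneg_nonneg[OF that] by linarith
      thus ?thesis by simp
    qed
    hence "norm (vmono \<nu> y) * norm (vmono e y) * w (norm y) \<le>
        ((norm (vmono \<nu> y))\<^sup>2 + (norm (vmono e y))\<^sup>2) * w (norm y)"
      using w_nonneg by (rule mult_right_mono)
    thus ?thesis using w_nonneg[of "norm y"] by (simp add: norm_mult distrib_right)
  qed
  thus "AE y in lborel. norm (vmono \<nu> y * cnj (vmono e y) * of_real (w (norm y))) \<le>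
      norm ((norm (vmono \<nu> y))\<^sup>2 * w (norm y) + (norm (vmono e y))\<^sup>2 * w (norm y))" by simp
qed measurable

lemma integral_vmono_square:
  "(\<integral>y. vmono \<nu> y * cnj (vmono \<nu> y) * of_real (w (norm y)) \<partial>lborel) =
    of_real (\<integral>y. (norm (vmono \<nu> y))\<^sup>2 * w (norm y) \<partial>lborel)"
  by (subst integral_complex_of_real[symmetric]) (simp only: of_real_mult complex_norm_square)

text \<open>The power of \<open>cinner x y\<close> expands into \<open>vmono e x\<close> times the
  conjugate of \<open>vmono e y\<close>, and orthogonality retains only \<open>e = \<nu>\<close>.
  This is why the projection maps \<open>y^\<nu>\<close> times a radial function to a multiple of
  \<open>x^\<nu>\<close>.\<close>

lemma
  shows integrable_vmono_cinner:
      "integrable lborel (\<lambda>y. vmono \<nu> y * cinner x y ^ k * of_real (w (norm y)))"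
    and integral_vmono_cinner:
      "(\<integral>y. vmono \<nu> y * cinner x y ^ k * of_real (w (norm y)) \<partial>lborel) =
        (if k = (\<Sum>i\<in>UNIV. \<nu> i) then of_real (fact k / mfact \<nu> *
          (\<integral>y. (norm (vmono \<nu> y))\<^sup>2 * w (norm y) \<partial>lborel)) * vmono \<nu> x else 0)"
proof -
  have eq: "vmono \<nu> y * cinner x y ^ k * of_real (w (norm y)) =
      (\<Sum>e\<in>multi_indices UNIV k. of_real (fact k / mfact e) * vmono e x *
        (vmono \<nu> y * cnj (vmono e y) * of_real (w (norm y))))" for y
    unfolding cinner_power sum_distrib_left sum_distrib_right by (intro sum.cong) (simp_all add: mult_ac)
  show "integrable lborel (\<lambda>y. vmono \<nu> y * cinner x y ^ k * of_real (w (norm y)))"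
    unfolding eq by (intro Bochner_Integration.integrable_sum integrable_mult_right integrable_vmono_cnj)
  have "(\<integral>y. vmono \<nu> y * cinner x y ^ k * of_real (w (norm y)) \<partial>lborel) =
      (\<Sum>e\<in>multi_indices UNIV k. of_real (fact k / mfact e) * vmono e x *
        (\<integral>y. vmono \<nu> y * cnj (vmono e y) * of_real (w (norm y)) \<partial>lborel))"
    unfolding eq by (subst Bochner_Integration.integral_sum)
      (auto intro!: integrable_mult_right integrable_vmono_cnj)
  also have "\<dots> = (\<Sum>e\<in>multi_indices UNIV k. if e = \<nu> then of_real (fact k / mfact \<nu>) * vmono \<nu> x *
        of_real (\<integral>y. (norm (vmono \<nu> y))\<^sup>2 * w (norm y) \<partial>lborel) else 0)"
    by (intro sum.cong) (auto simp: integral_vmono_square integral_vmono_orthogonal[OF w])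
  also have "\<dots> = (if \<nu> \<in> multi_indices UNIV k then of_real (fact k / mfact \<nu>) * vmono \<nu> x *
        of_real (\<integral>y. (norm (vmono \<nu> y))\<^sup>2 * w (norm y) \<partial>lborel) else 0)"
    by (simp add: finite_multi_indices)
  finally show "(\<integral>y. vmono \<nu> y * cinner x y ^ k * of_real (w (norm y)) \<partial>lborel) =
        (if k = (\<Sum>i\<in>UNIV. \<nu> i) then of_real (fact k / mfact \<nu> *
          (\<integral>y. (norm (vmono \<nu> y))\<^sup>2 * w (norm y) \<partial>lborel)) * vmono \<nu> x else 0)"
    by (auto simp: multi_indices_def mult_ac)
qed

end

lemma integral_vmono_square_exp:
  assumes "b > 0" "m > 0"
  shows "(\<integral>y. (norm (vmono \<nu> y))\<^sup>2 * exp (- b * norm y powr (2 * m)) \<partial>lborel) = moment \<nu> m 2 b"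
proof -
  have "(\<integral>\<^sup>+y. ennreal ((norm (vmono \<nu> y))\<^sup>2 * exp (- b * norm y powr (2 * m))) \<partial>lborel) =
      (\<integral>\<^sup>+y. ennreal (norm (vmono \<nu> y) powr 2 * exp (- b * norm y powr (2 * m))) \<partial>lborel)"
    by (intro nn_integral_cong) simp
  also have "\<dots> = ennreal (moment \<nu> m 2 b)" using assms by (intro nn_integral_vmono) auto
  finally show ?thesis
    using moment_pos[of 2 b m \<nu>] assms by (subst integral_eq_nn_integral) auto
qed

text \<open>The modulus is split into a conjugate power, expanded in monomials, and a plain power
  handled by \<open>integral_vmono_cinner\<close>. The \<open>mfact e\<close> in the second moment
  cancels one of the two multinomial denominators, so the sum closes up again to a multiple of
  \<open>cinner x x ^ k\<close>.\<close>

lemma nn_integral_cinner_power: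
  fixes x :: "complex ^ 'n::finite"
  assumes b: "b > 0" and m: "m > 0"
  shows "(\<integral>\<^sup>+y. ennreal (norm (cinner x y) ^ (2 * k) * exp (- b * norm y powr (2 * m))) \<partial>lborel) =
    ennreal (pi ^ CARD('n) * fact k * norm x ^ (2 * k) *
      (b powr (- (real k + real CARD('n)) / m) * Gamma ((real k + real CARD('n)) / m + 1) / Gamma (real k + real CARD('n) + 1)))"
proof -
  define w where "w t = exp (- b * t powr (2 * m))" for t
  have w: "w \<in> borel_measurable borel" "\<And>t. 0 \<le> w t" "\<And>t. w t \<le> exp (- b * t powr (2 * m))"
    unfolding w_def by simp_all
  define R where "R = b powr (- (real k + real CARD('n)) / m) * Gamma ((real k + real CARD('n)) / m + 1) / Gamma (real k + real CARD('n) + 1)"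
  have kn: "real k + real CARD('n) > 0" by (simp add: add_nonneg_pos)
  have R: "R \<ge> 0" unfolding R_def using m kn
    by (intro divide_nonneg_nonneg mult_nonneg_nonneg) (auto intro!: less_imp_le[OF Gamma_real_pos] add_pos_pos)
  have cnj: "cnj (cinner x y) ^ k = (\<Sum>e\<in>multi_indices UNIV k. of_real (fact k / mfact e) * cnj (vmono e x) * vmono e y)" for y
    unfolding complex_cnj_power[symmetric] cinner_power by (simp add: cnj_sum)
  have eq: "complex_of_real (norm (cinner x y) ^ (2 * k) * w (norm y)) =
      (\<Sum>e\<in>multi_indices UNIV k. of_real (fact k / mfact e) * cnj (vmono e x) *
        (vmono e y * cinner x y ^ k * of_real (w (norm y))))" for y
  proof -
    have "complex_of_real (norm (cinner x y) ^ (2 * k) * w (norm y)) =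
        cnj (cinner x y) ^ k * cinner x y ^ k * of_real (w (norm y))"
      unfolding power_mult of_real_mult of_real_power[of "(norm (cinner x y))\<^sup>2" k]
        complex_norm_square power_mult_distrib by (simp only: mult_ac)
    thus ?thesis
      unfolding cnj sum_distrib_right by (simp add: mult_ac)
  qed
  have int: "integrable lborel (\<lambda>y. complex_of_real (norm (cinner x y) ^ (2 * k) * w (norm y)))"
    unfolding eq by (intro Bochner_Integration.integrable_sum integrable_mult_right
        integrable_vmono_cinner[OF w b m])
  hence int': "integrable lborel (\<lambda>y. norm (cinner x y) ^ (2 * k) * w (norm y))"
    using complex_of_real_integrable_eq by blast
  have "complex_of_real (\<integral>y. norm (cinner x y) ^ (2 * k) * w (norm y) \<partial>lborel) =
      (\<integral>y. complex_of_real (norm (cinner x y) ^ (2 * k) * w (norm y)) \<partial>lborel)"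
    by (rule integral_complex_of_real[symmetric])
  also have "\<dots> = (\<Sum>e\<in>multi_indices UNIV k. of_real (fact k / mfact e) * cnj (vmono e x) *
        (\<integral>y. vmono e y * cinner x y ^ k * of_real (w (norm y)) \<partial>lborel))"
    unfolding eq by (subst Bochner_Integration.integral_sum)
      (auto intro!: integrable_mult_right integrable_vmono_cinner[OF w b m])
  also have "\<dots> = (\<Sum>e\<in>multi_indices UNIV k. pi ^ CARD('n) * of_real R * fact k *
      cnj (of_real (fact k / mfact e) * vmono e x * cnj (vmono e x)))"
  proof (rule sum.cong)
    fix e :: "'n \<Rightarrow> nat" assume e: "e \<in> multi_indices UNIV k"
    hence k: "(\<Sum>i\<in>UNIV. e i) = k" by (simp add: multi_indices_def)
    have M: "(\<integral>y. (norm (vmono e y))\<^sup>2 * w (norm y) \<partial>lborel) = pi ^ CARD('n) * mfact e * R"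
      unfolding w_def integral_vmono_square_exp[OF b m] moment_2 k R_def by simp
    show "of_real (fact k / mfact e) * cnj (vmono e x) *
        (\<integral>y. vmono e y * cinner x y ^ k * of_real (w (norm y)) \<partial>lborel) =
        pi ^ CARD('n) * of_real R * fact k * cnj (of_real (fact k / mfact e) * vmono e x * cnj (vmono e x))"
      unfolding integral_vmono_cinner[OF w b m] if_P[OF k[symmetric]] M
      using mfact_pos[of e] by (simp add: mult_ac)
  qed simp
  also have "\<dots> = pi ^ CARD('n) * of_real R * fact k * cnj (cinner x x ^ k)"
    unfolding cinner_power cnj_sum sum_distrib_left ..
  also have "cinner x x = of_real ((norm x)\<^sup>2)"
    unfolding norm_vec_square cinner_def of_real_sum complex_norm_square ..
  also have "pi ^ CARD('n) * of_real R * fact k * cnj (of_real ((norm x)\<^sup>2) ^ k) =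
      complex_of_real (pi ^ CARD('n) * fact k * norm x ^ (2 * k) * R)"
    by (simp add: power_mult mult_ac) (simp add: power2_eq_square power_mult_distrib)
  finally have "(\<integral>y. norm (cinner x y) ^ (2 * k) * w (norm y) \<partial>lborel) = pi ^ CARD('n) * fact k * norm x ^ (2 * k) * R"
    by (simp only: of_real_eq_iff)
  thus ?thesis
    using nn_integral_eq_integral[OF int'] w(2) by (simp add: w_def R_def)
qed

section \<open>Square means on the circle\<close>

lemma has_integral_norm_trig_poly_square:
  fixes a :: "nat \<Rightarrow> complex"
  shows "((\<lambda>t. (norm (\<Sum>k<N. a k * cis t ^ k))\<^sup>2) has_integral (2 * pi * (\<Sum>k<N. (norm (a k))\<^sup>2))) {0..2 * pi}"
proof -
  have base: "((\<lambda>t. cis t ^ j * cnj (cis t) ^ k) has_integral (if j = k then of_real (2 * pi) else 0)) {0..2 * pi}" for j k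
  proof (cases "j = k")
    case True
    have "cis t ^ j * cnj (cis t) ^ k = (cis t * cnj (cis t)) ^ k" for t
      unfolding True power_mult_distrib ..
    hence "cis t ^ j * cnj (cis t) ^ k = 1" for t by (simp add: cis_cnj cis_mult)
    thus ?thesis using True has_integral_const_real[of "1::complex" 0 "2 * pi"] by (simp add: scaleR_conv_of_real)
  next
    case False
    define d where "d = real j - real k"
    have d: "d \<noteq> 0" using False by (simp add: d_def)
    have eq: "cis t ^ j * cnj (cis t) ^ k = exp (\<i> * of_real d * of_real t)" for t
    proof -
      have "cis t ^ j * cnj (cis t) ^ k = cis (real j * t) * cis (real k * (- t))"
        by (simp only: cis_cnj Complex.DeMoivre)
      also have "\<dots> = cis (d * t)" by (simp add: cis_mult d_def left_diff_distrib)
      also have "\<dots> = exp (\<i> * of_real d * of_real t)" by (simp add: cis_conv_exp mult_ac)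
      finally show ?thesis .
    qed
    have "((\<lambda>t. exp (\<i> * of_real d * of_real t)) has_integral
        (exp (\<i> * of_real d * of_real (2 * pi)) / (\<i> * of_real d) - exp (\<i> * of_real d * of_real 0) / (\<i> * of_real d))) {0..2 * pi}"
    proof (rule fundamental_theorem_of_calculus)
      fix t :: real
      have "((\<lambda>z. exp (\<i> * of_real d * z) / (\<i> * of_real d)) has_field_derivative exp (\<i> * of_real d * of_real t))
          (at (of_real t))"
        using d by (auto intro!: derivative_eq_intros)
      thus "((\<lambda>t. exp (\<i> * of_real d * of_real t) / (\<i> * of_real d)) has_vector_derivative exp (\<i> * of_real d * of_real t))
          (at t within {0..2 * pi})"
        by (rule has_vector_derivative_at_within[OF has_vector_derivative_real_field])
    qed simp
    moreover have "exp (\<i> * of_real d * of_real (2 * pi)) = 1"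
    proof -
      have "\<i> * of_real d * of_real (2 * pi) = \<i> * (of_int (int j - int k) * (of_real pi * 2))"
        by (simp add: d_def mult_ac)
      thus ?thesis by (simp only: exp_2pi_1_int)
    qed
    ultimately show ?thesis using False by (simp add: eq)
  qed
  have eq: "complex_of_real ((norm (\<Sum>k<N. a k * cis t ^ k))\<^sup>2) =
      (\<Sum>j<N. \<Sum>k<N. a j * cnj (a k) * (cis t ^ j * cnj (cis t) ^ k))" for t
    unfolding complex_norm_square cnj_sum sum_product by (simp add: mult_ac)
  have "((\<lambda>t. complex_of_real ((norm (\<Sum>k<N. a k * cis t ^ k))\<^sup>2)) has_integral
      (\<Sum>j<N. \<Sum>k<N. a j * cnj (a k) * (if j = k then of_real (2 * pi) else 0))) {0..2 * pi}"
    unfolding eq by (intro has_integral_sum has_integral_mult_right base) auto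
  also have "(\<Sum>j<N. \<Sum>k<N. a j * cnj (a k) * (if j = k then of_real (2 * pi) else 0)) =
      (\<Sum>j<N. complex_of_real (2 * pi * (norm (a j))\<^sup>2))"
  proof (intro sum.cong refl)
    fix j assume "j \<in> {..<N}"
    hence "(\<Sum>k<N. a j * cnj (a k) * (if j = k then of_real (2 * pi) else 0)) = a j * cnj (a j) * of_real (2 * pi)"
      by (simp add: if_distrib cong: if_cong)
    thus "(\<Sum>k<N. a j * cnj (a k) * (if j = k then of_real (2 * pi) else 0)) = complex_of_real (2 * pi * (norm (a j))\<^sup>2)"
      unfolding of_real_mult complex_norm_square by (simp add: mult_ac)
  qed
  finally have "((\<lambda>t. Re (complex_of_real ((norm (\<Sum>k<N. a k * cis t ^ k))\<^sup>2))) has_integral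
      Re (\<Sum>j<N. complex_of_real (2 * pi * (norm (a j))\<^sup>2))) {0..2 * pi}"
    by (rule has_integral_Re)
  thus ?thesis by (simp add: sum_distrib_left)
qed

text \<open>Parseval for the partial sums and Fatou's lemma; the inequality suffices, so no
  convergence of the integrals has to be shown.\<close>

lemma nn_integral_circle_power_series_le:
  fixes a :: "nat \<Rightarrow> complex"
  assumes "summable (\<lambda>k. norm (a k))"
  shows "(\<integral>\<^sup>+t. ennreal (indicator {0..2 * pi} t * (norm (\<Sum>k. a k * cis t ^ k))\<^sup>2) \<partial>lborel) \<le>
    ennreal (2 * pi) * (\<Sum>k. ennreal ((norm (a k))\<^sup>2))"
proof -
  define u where "u N t = ennreal (indicator {0..2 * pi} t * (norm (\<Sum>k<N. a k * cis t ^ k))\<^sup>2)" for N t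
  have [measurable]: "cis \<in> borel_measurable borel"
    by (intro borel_measurable_continuous_onI continuous_intros)
  have [measurable]: "u N \<in> borel_measurable borel" for N unfolding u_def[abs_def] by measurable
  have lim: "(\<lambda>N. u N t) \<longlonglongrightarrow> ennreal (indicator {0..2 * pi} t * (norm (\<Sum>k. a k * cis t ^ k))\<^sup>2)" for t
  proof -
    have "summable (\<lambda>k. a k * cis t ^ k)"
      by (rule summable_norm_cancel) (use assms in \<open>simp add: norm_mult norm_power\<close>)
    hence "(\<lambda>N. \<Sum>k<N. a k * cis t ^ k) \<longlonglongrightarrow> (\<Sum>k. a k * cis t ^ k)" by (rule summable_LIMSEQ)
    thus ?thesis unfolding u_def
      by (intro tendsto_ennrealI tendsto_mult[OF tendsto_const] tendsto_power tendsto_norm)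
  qed
  have le: "(\<integral>\<^sup>+t. u N t \<partial>lborel) \<le> ennreal (2 * pi) * (\<Sum>k. ennreal ((norm (a k))\<^sup>2))" for N
  proof -
    have "(\<integral>\<^sup>+t. u N t \<partial>lborel) = ennreal (2 * pi * (\<Sum>k<N. (norm (a k))\<^sup>2))"
      unfolding u_def by (intro nn_integral_has_integral_lebesgue has_integral_norm_trig_poly_square) auto
    also have "\<dots> = ennreal (2 * pi) * (\<Sum>k<N. ennreal ((norm (a k))\<^sup>2))"
      by (simp add: ennreal_mult' sum_nonneg)
    also have "\<dots> \<le> ennreal (2 * pi) * (\<Sum>k. ennreal ((norm (a k))\<^sup>2))"
      by (intro mult_left_mono sum_le_suminf) auto
    finally show ?thesis .
  qed
  have "(\<integral>\<^sup>+t. ennreal (indicator {0..2 * pi} t * (norm (\<Sum>k. a k * cis t ^ k))\<^sup>2) \<partial>lborel) =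
      (\<integral>\<^sup>+t. liminf (\<lambda>N. u N t) \<partial>lborel)"
    using lim_imp_Liminf[OF sequentially_bot lim] by simp
  also have "\<dots> \<le> liminf (\<lambda>N. \<integral>\<^sup>+t. u N t \<partial>lborel)"
    by (intro nn_integral_liminf) auto
  also have "\<dots> \<le> liminf (\<lambda>N. ennreal (2 * pi) * (\<Sum>k. ennreal ((norm (a k))\<^sup>2)))"
    using le by (intro Liminf_mono) auto
  finally show ?thesis by (simp add: Liminf_const)
qed

section \<open>Circle means of the kernel\<close>

definition kfun :: "nat \<Rightarrow> real \<Rightarrow> complex \<Rightarrow> complex" where
  "kfun n m z = (\<Sum>k. of_real (kcoeff n m k) * z ^ k)"

lemma bergK_eq_kfun:
  fixes x y :: "complex ^ 'n::finite"
  shows "bergK \<beta> m x y = of_real (m * \<beta> powr (real CARD('n) / m) / pi ^ CARD('n)) *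
    kfun CARD('n) m (of_real (\<beta> powr (1 / m)) * cinner x y)"
  unfolding bergK_def kfun_def kcoeff_def by (simp add: mult_ac)

lemma kfun_measurable [measurable]: "kfun n m \<in> borel_measurable borel"
  unfolding kfun_def[abs_def] by measurable

lemma powr_nth_power:
  fixes s m :: real
  assumes "s > 0"
  shows "s powr (real k / m) = (s powr (1 / m)) ^ k"
  using assms by (simp add: powr_powr flip: powr_realpow)

lemma summable_kcoeff:
  assumes "n \<ge> 2" "1 < m" "m < 2" "r \<ge> 0"
  shows "summable (\<lambda>k. kcoeff n m k * r ^ k)"
proof -
  \<comment> \<open>\<open>r + 1\<close> instead of \<open>r\<close> keeps \<open>s\<close> positive
    at \<open>r = 0\<close>; summability passes down to the smaller radius by comparison.\<close>
  define s where "s = (r + 1) powr m"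
  have s: "s > 0" "s powr (1 / m) = r + 1" using assms by (auto simp: s_def powr_powr)
  obtain C where "(\<Sum>k. ennreal (kcoeff n m k * s powr (real k / m))) \<le> ennreal (C * exp ((1 + 1) * s))"
    using kcoeff_series_le[OF assms(1-3) zero_less_one] s by blast
  hence "(\<Sum>k. ennreal (kcoeff n m k * (r + 1) ^ k)) \<noteq> top"
    unfolding powr_nth_power[OF s(1)] s(2) by (auto simp: top_unique)
  moreover have pos: "kcoeff n m k \<ge> 0" for k using kcoeff_pos[of n m k] assms by auto
  ultimately have "summable (\<lambda>k. kcoeff n m k * (r + 1) ^ k)"
    using assms by (intro summable_suminf_not_top) auto
  thus ?thesis
    by (rule summable_comparison_test'[where N = 0])
      (use pos assms in \<open>auto simp: abs_mult intro!: mult_left_mono power_mono\<close>)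
qed

lemma norm_kfun_le:
  assumes "n \<ge> 2" "1 < m" "m < 2"
  shows "norm (kfun n m z) \<le> (\<Sum>k. kcoeff n m k * norm z ^ k)"
proof -
  have pos: "kcoeff n m k \<ge> 0" for k using kcoeff_pos[of n m k] assms by auto
  have "summable (\<lambda>k. norm (of_real (kcoeff n m k) * z ^ k))"
    using summable_kcoeff[OF assms, of "norm z"] pos by (simp add: norm_mult norm_power)
  from summable_norm[OF this] show ?thesis
    unfolding kfun_def using pos by (simp add: norm_mult norm_power)
qed

lemma norm_kfun_exp_le:
  assumes "n \<ge> 2" "1 < m" "m < 2" "\<epsilon> > 0"
  shows "\<exists>C>0. \<forall>z. norm (kfun n m z) \<le> C * exp ((1 + \<epsilon>) * norm z powr m)"
proof -
  obtain C where C: "C > 0" "\<And>s. s > 0 \<Longrightarrow> (\<Sum>k. ennreal (kcoeff n m k * s powr (real k / m))) \<le> ennreal (C * exp ((1 + \<epsilon>) * s))"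
    using kcoeff_series_le[OF assms] by blast
  have pos: "kcoeff n m k \<ge> 0" for k using kcoeff_pos[of n m k] assms by auto
  have 1: "norm (kfun n m z) \<le> C * exp ((1 + \<epsilon>) * norm z powr m)" if z: "z \<noteq> 0" for z
  proof -
    define s where "s = norm z powr m"
    have s: "s > 0" "s powr (1 / m) = norm z" using assms z by (auto simp: s_def powr_powr)
    have "ennreal (\<Sum>k. kcoeff n m k * norm z ^ k) = (\<Sum>k. ennreal (kcoeff n m k * norm z ^ k))"
      using pos summable_kcoeff[OF assms(1-3), of "norm z"] by (intro suminf_ennreal2[symmetric]) auto
    also have "\<dots> \<le> ennreal (C * exp ((1 + \<epsilon>) * s))"
      using C(2)[OF s(1)] unfolding powr_nth_power[OF s(1)] s(2) .
    finally have "(\<Sum>k. kcoeff n m k * norm z ^ k) \<le> C * exp ((1 + \<epsilon>) * s)"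
      using C by (subst (asm) ennreal_le_iff) auto
    thus ?thesis using norm_kfun_le[OF assms(1-3), of z] by (simp add: s_def)
  qed
  have "norm (kfun n m 0) \<le> kcoeff n m 0"
    using pos by (simp add: kfun_def)
  hence "norm (kfun n m z) \<le> (C + kcoeff n m 0) * exp ((1 + \<epsilon>) * norm z powr m)" for z
    using 1[of z] pos[of 0] C by (cases "z = 0") (auto simp: distrib_right intro: order_trans add_increasing2)
  moreover have "C + kcoeff n m 0 > 0" using C pos[of 0] by linarith
  ultimately show ?thesis by blast
qed

text \<open>Multiplying by \<open>1 - \<rho> \<zeta>\<close> damps the power series off the positive axis: by Cauchy--Schwarz (here
  AM-GM with the free parameter \<open>\<eta>\<close>) and Bessel's inequality for both factors, the circle mean of
  \<open>kfun\<close> is controlled by the square sum of the differences of its terms.\<close>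

lemma circle_mean_kfun_split:
  assumes n: "n \<ge> 2" "1 < m" "m < 2" and z: "z \<noteq> 0" and \<rho>: "0 \<le> \<rho>" "\<rho> < 1" and \<eta>: "\<eta> > 0"
  defines "t \<equiv> \<lambda>k. kcoeff n m k * norm z ^ k"
  shows "(\<integral>\<^sup>+\<phi>. ennreal (indicator {0..2 * pi} \<phi> * norm (kfun n m (cis \<phi> * z))) \<partial>lborel) \<le>
    ennreal (\<eta> * pi) * (ennreal ((t 0)\<^sup>2) + (\<Sum>k. ennreal ((t (Suc k) - \<rho> * t k)\<^sup>2))) +
    ennreal (pi / \<eta> / (1 - \<rho>))"
proof -
  define u where "u = sgn z"
  have u: "norm u = 1" "z = of_real (norm z) * u" using z
    by (simp_all add: u_def norm_sgn) (simp add: sgn_div_norm scaleR_conv_of_real)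
  have pos: "t k \<ge> 0" for k unfolding t_def using kcoeff_pos[of n m k] n by auto
  have sm: "summable t" unfolding t_def by (rule summable_kcoeff[OF n]) simp
  \<comment> \<open>Coefficients of \<open>1 - \<rho> \<zeta>\<close> times the kernel series on the
    circle through \<open>z\<close>. The direction \<open>u\<close> of \<open>z\<close> is moved
    into them, so only their moduli matter for Bessel.\<close>
  define b where "b k = of_real (case k of 0 \<Rightarrow> t 0 | Suc j \<Rightarrow> t (Suc j) - \<rho> * t j) * u ^ k" for k
  define g where "g k = of_real (\<rho> ^ k) * u ^ k" for k
  have F: "kfun n m (cis \<phi> * z) = (\<Sum>k. of_real (t k) * (cis \<phi> * u) ^ k)" for \<phi>
    unfolding kfun_def by (subst u(2)) (simp add: t_def power_mult_distrib mult_ac)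
  have smF: "summable (\<lambda>k. of_real (t k) * (cis \<phi> * u) ^ k)" for \<phi>
    by (rule summable_norm_cancel) (use sm pos u in \<open>simp add: norm_mult norm_power\<close>)
  have nb: "norm (b (Suc k)) = \<bar>t (Suc k) - \<rho> * t k\<bar>" "norm (b 0) = t 0" for k
    using pos[of 0] by (simp_all add: b_def norm_mult norm_power u del: of_real_diff of_real_mult)
  have smb: "summable (\<lambda>k. norm (b k))"
  proof -
    have "summable (\<lambda>k. t (Suc k) + \<rho> * t k)"
      using sm by (intro summable_add summable_mult) (simp_all add: summable_Suc_iff)
    hence "summable (\<lambda>k. norm (b (Suc k)))"
      by (rule summable_comparison_test'[where N = 0])
        (use pos \<rho> in \<open>auto simp: nb abs_le_iff intro: add_increasing2\<close>)
    thus ?thesis using summable_Suc_iff[of "\<lambda>k. norm (b k)"] by simp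
  qed
  have smg: "summable (\<lambda>k. norm (g k))"
    using \<rho> u by (simp add: g_def norm_mult norm_power summable_geometric)
  have prod: "(1 - of_real \<rho> * (cis \<phi> * u)) * kfun n m (cis \<phi> * z) = (\<Sum>k. b k * cis \<phi> ^ k)" for \<phi>
  proof -
    define v where "v = cis \<phi> * u"
    have s1: "(\<lambda>k. of_real (t k) * v ^ k) sums kfun n m (cis \<phi> * z)"
      unfolding F v_def by (intro summable_sums smF)
    have s2: "(\<lambda>k. of_real (t (Suc k)) * v ^ Suc k) sums (kfun n m (cis \<phi> * z) - of_real (t 0))"
      using s1 by (subst sums_Suc_iff) simp
    have "(\<lambda>k. of_real (t (Suc k)) * v ^ Suc k - of_real \<rho> * v * (of_real (t k) * v ^ k)) sums
        (kfun n m (cis \<phi> * z) - of_real (t 0) - of_real \<rho> * v * kfun n m (cis \<phi> * z))"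
      by (intro sums_diff sums_mult s1 s2)
    also have "(\<lambda>k. of_real (t (Suc k)) * v ^ Suc k - of_real \<rho> * v * (of_real (t k) * v ^ k)) =
        (\<lambda>k. b (Suc k) * cis \<phi> ^ Suc k)"
      by (rule ext) (simp add: b_def v_def power_mult_distrib algebra_simps)
    finally have "(\<lambda>k. b k * cis \<phi> ^ k) sums ((1 - of_real \<rho> * v) * kfun n m (cis \<phi> * z))"
      by (subst (asm) sums_Suc_iff) (simp add: b_def algebra_simps)
    thus ?thesis unfolding v_def by (simp add: sums_iff)
  qed
  have geo: "(1 - of_real \<rho> * (cis \<phi> * u)) * (\<Sum>k. g k * cis \<phi> ^ k) = 1" for \<phi>
  proof -
    have "norm (of_real \<rho> * (cis \<phi> * u)) < 1" using \<rho> u by (simp add: norm_mult)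
    from geometric_sums[OF this] have "(\<lambda>k. g k * cis \<phi> ^ k) sums (1 / (1 - of_real \<rho> * (cis \<phi> * u)))"
      by (simp add: g_def power_mult_distrib mult_ac)
    moreover have "1 - of_real \<rho> * (cis \<phi> * u) \<noteq> 0"
      using \<open>norm (of_real \<rho> * (cis \<phi> * u)) < 1\<close> by auto
    ultimately show ?thesis by (simp add: sums_iff)
  qed
  have ptw: "norm (kfun n m (cis \<phi> * z)) \<le> \<eta> / 2 * (norm (\<Sum>k. b k * cis \<phi> ^ k))\<^sup>2 + 1 / (2 * \<eta>) * (norm (\<Sum>k. g k * cis \<phi> ^ k))\<^sup>2" for \<phi>
  proof -
    define A where "A = norm (\<Sum>k. b k * cis \<phi> ^ k)"
    define B where "B = norm (\<Sum>k. g k * cis \<phi> ^ k)"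
    have "kfun n m (cis \<phi> * z) = (\<Sum>k. b k * cis \<phi> ^ k) * (\<Sum>k. g k * cis \<phi> ^ k)"
      unfolding prod[symmetric] using geo[of \<phi>] by (simp add: mult_ac)
    hence "norm (kfun n m (cis \<phi> * z)) = A * B" by (simp add: A_def B_def norm_mult)
    moreover have "2 * \<eta> * (A * B) \<le> (\<eta> * A)\<^sup>2 + B\<^sup>2"
      using sum_squares_bound[of "\<eta> * A" B] by (simp add: mult_ac)
    ultimately show ?thesis using \<eta> unfolding A_def[symmetric] B_def[symmetric]
      by (simp add: field_simps power2_eq_square)
  qed
  have gsum: "(\<Sum>k. ennreal ((norm (g k))\<^sup>2)) \<le> ennreal (1 / (1 - \<rho>))"
  proof -
    have "(\<Sum>k. ennreal ((norm (g k))\<^sup>2)) \<le> (\<Sum>k. ennreal (\<rho> ^ k))"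
    proof (intro suminf_le ennreal_leI)
      fix k
      have "\<rho> ^ k * \<rho> ^ k \<le> \<rho> ^ k * 1" using \<rho> by (intro mult_left_mono power_le_one) auto
      thus "(norm (g k))\<^sup>2 \<le> \<rho> ^ k" using \<rho> by (simp add: g_def norm_mult norm_power u power2_eq_square)
    qed auto
    also have "\<dots> = ennreal (1 / (1 - \<rho>))"
      using \<rho> by (intro suminf_ennreal_eq geometric_sums) auto
    finally show ?thesis .
  qed
  have [measurable]: "cis \<in> borel_measurable borel"
    by (intro borel_measurable_continuous_onI continuous_intros)
  have "(\<integral>\<^sup>+\<phi>. ennreal (indicator {0..2 * pi} \<phi> * norm (kfun n m (cis \<phi> * z))) \<partial>lborel) \<le>
    (\<integral>\<^sup>+\<phi>. ennreal (\<eta> / 2) * ennreal (indicator {0..2 * pi} \<phi> * (norm (\<Sum>k. b k * cis \<phi> ^ k))\<^sup>2) +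
       ennreal (1 / (2 * \<eta>)) * ennreal (indicator {0..2 * pi} \<phi> * (norm (\<Sum>k. g k * cis \<phi> ^ k))\<^sup>2) \<partial>lborel)"
    using ptw \<eta> by (intro nn_integral_mono)
      (auto simp: indicator_def simp flip: ennreal_mult' ennreal_plus intro!: ennreal_leI)
  also have "\<dots> = ennreal (\<eta> / 2) * (\<integral>\<^sup>+\<phi>. ennreal (indicator {0..2 * pi} \<phi> * (norm (\<Sum>k. b k * cis \<phi> ^ k))\<^sup>2) \<partial>lborel) +
       ennreal (1 / (2 * \<eta>)) * (\<integral>\<^sup>+\<phi>. ennreal (indicator {0..2 * pi} \<phi> * (norm (\<Sum>k. g k * cis \<phi> ^ k))\<^sup>2) \<partial>lborel)"
    by (subst nn_integral_add) (simp_all add: nn_integral_cmult)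
  also have "\<dots> \<le> ennreal (\<eta> / 2) * (ennreal (2 * pi) * (\<Sum>k. ennreal ((norm (b k))\<^sup>2))) +
       ennreal (1 / (2 * \<eta>)) * (ennreal (2 * pi) * ennreal (1 / (1 - \<rho>)))"
    by (intro add_mono mult_left_mono nn_integral_circle_power_series_le smb
        order_trans[OF nn_integral_circle_power_series_le[OF smg]] gsum) auto
  also have "(\<Sum>k. ennreal ((norm (b k))\<^sup>2)) = ennreal ((t 0)\<^sup>2) + (\<Sum>k. ennreal ((t (Suc k) - \<rho> * t k)\<^sup>2))"
    by (subst suminf_offset[of _ 1]) (simp_all add: nb add.commute)
  also have "ennreal (\<eta> / 2) * (ennreal (2 * pi) * (ennreal ((t 0)\<^sup>2) + (\<Sum>k. ennreal ((t (Suc k) - \<rho> * t k)\<^sup>2)))) =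
      ennreal (\<eta> * pi) * (ennreal ((t 0)\<^sup>2) + (\<Sum>k. ennreal ((t (Suc k) - \<rho> * t k)\<^sup>2)))"
    using \<eta> by (simp add: mult.assoc[symmetric] ennreal_mult'[symmetric])
  also have "ennreal (1 / (2 * \<eta>)) * (ennreal (2 * pi) * ennreal (1 / (1 - \<rho>))) = ennreal (pi / \<eta> / (1 - \<rho>))"
    using \<eta> \<rho> by (simp add: ennreal_mult'[symmetric] mult.assoc[symmetric])
  finally show ?thesis .
qed

lemma circle_mean_kfun_le_large:
  assumes n: "n \<ge> 2" "1 < m" "m < 2" and H: "real n - real n / m \<ge> 1 / 2"
  shows "\<exists>C>0. \<forall>z. norm z \<ge> 1 \<longrightarrow>
    (\<integral>\<^sup>+\<phi>. ennreal (indicator {0..2 * pi} \<phi> * norm (kfun n m (cis \<phi> * z))) \<partial>lborel) \<le>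
      ennreal (C * ((norm z powr m) powr (real n - real n / m - 1 / 2) * exp (norm z powr m)))"
proof -
  define A where "A = real n - real n / m - 1 / 2"
  have A: "A \<ge> 0" using H by (simp add: A_def)
  define c0 where "c0 = kcoeff n m 0"
  obtain C where C: "C > 0" "\<And>s. s \<ge> 1 \<Longrightarrow> (\<Sum>k. ennreal (
      (kcoeff n m (Suc k) * s powr (real (Suc k) / m) - kcoeff n m k * s powr (real k / m))\<^sup>2 +
      (kcoeff n m k * s powr (real k / m))\<^sup>2 / s)) \<le> ennreal (C * s powr (2 * (real n - real n / m) - 3 / 2) * exp (2 * s))"
    using kcoeff_difference_sum[OF n H] by blast
  define C' where "C' = pi * (c0\<^sup>2 + 2 * C) + 2 * pi"
  have C': "C' > 0" using C by (simp add: C'_def add_nonneg_pos)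
  have "(\<integral>\<^sup>+\<phi>. ennreal (indicator {0..2 * pi} \<phi> * norm (kfun n m (cis \<phi> * z))) \<partial>lborel) \<le>
      ennreal (C' * ((norm z powr m) powr A * exp (norm z powr m)))" if z: "norm z \<ge> 1" for z
  proof -
    define s where "s = norm z powr m"
    have s: "s \<ge> 1" "s powr (1 / m) = norm z"
      using n z by (auto simp: s_def powr_powr ge_one_powr_ge_zero)
    \<comment> \<open>The damping \<open>1 - \<rho>\<close> of order \<open>s^(-1/2)\<close> matches
      the relative size of the differences of the terms: it adds an error of the same order to their
      square sum, and \<open>1 / (1 - \<rho>)\<close> contributes only
      \<open>s^(1/2)\<close>.\<close>
    define \<rho> where "\<rho> = 1 - s powr (- 1 / 2) / 2"
    have "s powr (- 1 / 2) \<le> 1" using s powr_mono[of "- 1 / 2" 0 s] by simp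
    hence \<rho>: "0 \<le> \<rho>" "\<rho> < 1" using s by (auto simp: \<rho>_def)
    have \<rho>2: "(1 - \<rho>)\<^sup>2 = 1 / (4 * s)"
      using s by (simp add: \<rho>_def power_divide powr_power powr_minus_divide)
    define G where "G = s powr A * exp s"
    have G: "G > 0" using s by (simp add: G_def)
    \<comment> \<open>Balances the two parts of AM-GM: \<open>\<eta> * X = G\<close> and
      \<open>1 / (\<eta> * (1 - \<rho>)) = 2 * G\<close>.\<close>
    define \<eta> where "\<eta> = s powr (1 / 2) / G"
    have \<eta>: "\<eta> > 0" using G s by (simp add: \<eta>_def)
    define t where "t k = kcoeff n m k * norm z ^ k" for k
    have t: "t k = kcoeff n m k * s powr (real k / m)" for k
      using s by (simp add: t_def powr_nth_power)
    define X where "X = s powr (2 * A - 1 / 2) * exp (2 * s)"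
    \<comment> \<open>Allows the boundary term \<open>(t 0)^2\<close>, which has no difference
      partner, to be absorbed into \<open>X\<close>.\<close>
    have X: "X \<ge> 1"
    proof -
      have "1 \<le> s powr (- 1) * exp (2 * s)"
      proof -
        have "s \<le> exp (2 * s)" using s exp_ge_add_one_self[of "2 * s"] by linarith
        thus ?thesis using s by (simp add: powr_minus_divide)
      qed
      also have "\<dots> \<le> X" unfolding X_def using s A by (intro mult_right_mono powr_mono) auto
      finally show ?thesis .
    qed
    have "(\<Sum>k. ennreal ((t (Suc k) - \<rho> * t k)\<^sup>2)) \<le> (\<Sum>k. ennreal 2 * ennreal ((t (Suc k) - t k)\<^sup>2 + (t k)\<^sup>2 / s))"
    proof (rule suminf_le)
      fix k
      have "(t (Suc k) - \<rho> * t k)\<^sup>2 = ((t (Suc k) - t k) + (1 - \<rho>) * t k)\<^sup>2" by (simp add: algebra_simps)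
      also have "\<dots> \<le> 2 * (t (Suc k) - t k)\<^sup>2 + 2 * ((1 - \<rho>) * t k)\<^sup>2"
        using sum_squares_bound[of "t (Suc k) - t k" "(1 - \<rho>) * t k"] by (simp add: power2_sum)
      also have "((1 - \<rho>) * t k)\<^sup>2 = (t k)\<^sup>2 / (4 * s)" by (simp add: power_mult_distrib \<rho>2)
      also have "2 * ((t k)\<^sup>2 / (4 * s)) \<le> 2 * ((t k)\<^sup>2 / s)" using s by (intro mult_left_mono divide_left_mono) auto
      finally have "(t (Suc k) - \<rho> * t k)\<^sup>2 \<le> 2 * ((t (Suc k) - t k)\<^sup>2 + (t k)\<^sup>2 / s)" by simp
      hence "ennreal ((t (Suc k) - \<rho> * t k)\<^sup>2) \<le> ennreal (2 * ((t (Suc k) - t k)\<^sup>2 + (t k)\<^sup>2 / s))"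
        by (rule ennreal_leI)
      also have "\<dots> = ennreal 2 * ennreal ((t (Suc k) - t k)\<^sup>2 + (t k)\<^sup>2 / s)"
        by (rule ennreal_mult') simp
      finally show "ennreal ((t (Suc k) - \<rho> * t k)\<^sup>2) \<le> ennreal 2 * ennreal ((t (Suc k) - t k)\<^sup>2 + (t k)\<^sup>2 / s)" .
    qed auto
    also have "\<dots> = ennreal 2 * (\<Sum>k. ennreal ((t (Suc k) - t k)\<^sup>2 + (t k)\<^sup>2 / s))"
      by (rule ennreal_suminf_cmult)
    also have "\<dots> \<le> ennreal 2 * ennreal (C * s powr (2 * (real n - real n / m) - 3 / 2) * exp (2 * s))"
      unfolding t by (intro mult_left_mono C s) auto
    also have "2 * (real n - real n / m) - 3 / 2 = 2 * A - 1 / 2" by (simp add: A_def)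
    also have "ennreal 2 * ennreal (C * s powr (2 * A - 1 / 2) * exp (2 * s)) = ennreal (2 * C * X)"
      using C by (simp add: X_def ennreal_mult'[symmetric] mult_ac del: ennreal_numeral)
    finally have sum: "(\<Sum>k. ennreal ((t (Suc k) - \<rho> * t k)\<^sup>2)) \<le> ennreal (2 * C * X)" .
    have "(t 0)\<^sup>2 \<le> c0\<^sup>2 * X" using X mult_left_mono[of 1 X "c0\<^sup>2"] by (simp add: t_def c0_def)
    hence "ennreal ((t 0)\<^sup>2) + (\<Sum>k. ennreal ((t (Suc k) - \<rho> * t k)\<^sup>2)) \<le> ennreal (c0\<^sup>2 * X) + ennreal (2 * C * X)"
      by (intro add_mono sum ennreal_leI)
    also have "\<dots> = ennreal ((c0\<^sup>2 + 2 * C) * X)"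
      using C X by (subst ennreal_plus[symmetric]) (auto simp: algebra_simps)
    finally have "ennreal (\<eta> * pi) * (ennreal ((t 0)\<^sup>2) + (\<Sum>k. ennreal ((t (Suc k) - \<rho> * t k)\<^sup>2))) \<le>
        ennreal (\<eta> * pi) * ennreal ((c0\<^sup>2 + 2 * C) * X)" by (rule mult_left_mono) simp
    also have "\<dots> = ennreal (pi * (c0\<^sup>2 + 2 * C) * (\<eta> * X))"
      using \<eta> C X by (simp add: ennreal_mult'[symmetric] mult_ac)
    also have "\<eta> * X = G"
    proof -
      have "X * s powr (1 / 2) = G * G"
      proof -
        have "exp (2 * s) = exp s * exp s" by (simp flip: exp_add)
        moreover have "s powr (2 * A - 1 / 2) * s powr (1 / 2) = s powr A * s powr A"
          by (simp flip: powr_add)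
        ultimately show ?thesis unfolding X_def G_def by (simp add: mult_ac)
      qed
      thus ?thesis using G by (simp add: \<eta>_def field_simps)
    qed
    finally have 1: "ennreal (\<eta> * pi) * (ennreal ((t 0)\<^sup>2) + (\<Sum>k. ennreal ((t (Suc k) - \<rho> * t k)\<^sup>2))) \<le>
        ennreal (pi * (c0\<^sup>2 + 2 * C) * G)" .
    have 2: "pi / \<eta> / (1 - \<rho>) = 2 * pi * G"
      using s G by (simp add: \<eta>_def \<rho>_def powr_minus_divide field_simps)
    have "(\<integral>\<^sup>+\<phi>. ennreal (indicator {0..2 * pi} \<phi> * norm (kfun n m (cis \<phi> * z))) \<partial>lborel) \<le>
        ennreal (\<eta> * pi) * (ennreal ((t 0)\<^sup>2) + (\<Sum>k. ennreal ((t (Suc k) - \<rho> * t k)\<^sup>2))) + ennreal (pi / \<eta> / (1 - \<rho>))"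
      unfolding t_def by (rule circle_mean_kfun_split[OF n _ \<rho> \<eta>]) (use z in auto)
    also have "\<dots> \<le> ennreal (pi * (c0\<^sup>2 + 2 * C) * G) + ennreal (2 * pi * G)"
      unfolding 2 by (intro add_right_mono 1)
    also have "\<dots> = ennreal (C' * G)"
      using C G by (subst ennreal_plus[symmetric]) (auto simp: C'_def algebra_simps)
    finally show ?thesis by (simp add: G_def s_def)
  qed
  thus ?thesis using C' unfolding A_def by blast
qed

text \<open>Trades the bound in \<open>|z|^m\<close> for a series in \<open>|z|^2\<close>. Its
  terms, unlike an exponential of a power of \<open>cinner x y\<close>, can be integrated over
  \<open>y\<close> in closed form.\<close>

lemma circle_mean_kfun_le:
  assumes n: "n \<ge> 2" "1 < m" "m < 2" and H: "real n - real n / m \<ge> 1 / 2"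
  shows "\<exists>C>0. \<forall>z. (\<integral>\<^sup>+\<phi>. ennreal (indicator {0..2 * pi} \<phi> * norm (kfun n m (cis \<phi> * z))) \<partial>lborel) \<le>
      ennreal C * (\<Sum>k. ennreal (bcoeff n m k * norm z ^ (2 * k)))"
proof -
  obtain C1 where C1: "C1 > 0" "\<And>z. norm z \<ge> 1 \<Longrightarrow>
    (\<integral>\<^sup>+\<phi>. ennreal (indicator {0..2 * pi} \<phi> * norm (kfun n m (cis \<phi> * z))) \<partial>lborel) \<le>
      ennreal (C1 * ((norm z powr m) powr (real n - real n / m - 1 / 2) * exp (norm z powr m)))"
    using circle_mean_kfun_le_large[OF n H] by blast
  obtain C2 where C2: "C2 > 0" "\<And>s. s > 0 \<Longrightarrow> ennreal (s powr (real n - real n / m - 1 / 2) * exp s) \<le>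
    ennreal C2 * (\<Sum>k. ennreal (bcoeff n m k * s powr (2 / m * real k)))"
    using bcoeff_series_ge[OF n H] by blast
  define K where "K = (\<Sum>k. kcoeff n m k)"
  have kpos: "kcoeff n m k > 0" and bpos: "bcoeff n m k > 0" for k
    using n by (auto intro!: kcoeff_pos bcoeff_pos)
  have sK: "summable (kcoeff n m)" using summable_kcoeff[OF n, of 1] by simp
  have K: "K > 0" unfolding K_def using sK kpos by (intro suminf_pos) auto
  \<comment> \<open>On the unit disc the kernel is bounded by \<open>K\<close>, and the constant
    term of the comparison series alone is enough.\<close>
  define C3 where "C3 = 2 * pi * K / bcoeff n m 0"
  have C3: "C3 > 0" using K bpos by (simp add: C3_def)
  define Q where "Q z = (\<Sum>k. ennreal (bcoeff n m k * norm z ^ (2 * k)))" for z :: complex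
  have "(\<integral>\<^sup>+\<phi>. ennreal (indicator {0..2 * pi} \<phi> * norm (kfun n m (cis \<phi> * z))) \<partial>lborel) \<le>
      ennreal (C1 * C2 + C3) * Q z" for z
  proof (cases "norm z \<ge> 1")
    case True
    define s where "s = norm z powr m"
    have s: "s > 0" "s powr (1 / m) = norm z"
      using n True by (auto simp: s_def powr_powr)
    have pk: "s powr (2 / m * real k) = norm z ^ (2 * k)" for k
      using powr_nth_power[OF s(1), of "2 * k" m] by (simp add: s(2) mult_ac)
    have "(\<integral>\<^sup>+\<phi>. ennreal (indicator {0..2 * pi} \<phi> * norm (kfun n m (cis \<phi> * z))) \<partial>lborel) \<le>
        ennreal C1 * ennreal (s powr (real n - real n / m - 1 / 2) * exp s)"
      using C1(2)[OF True] C1(1) by (simp add: s_def ennreal_mult')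
    also have "\<dots> \<le> ennreal C1 * (ennreal C2 * Q z)"
      using C2(2)[OF s(1)] unfolding pk Q_def by (intro mult_left_mono) auto
    also have "\<dots> = ennreal (C1 * C2) * Q z" using C1 C2 by (simp add: ennreal_mult' mult_ac)
    also have "\<dots> \<le> ennreal (C1 * C2 + C3) * Q z" using C3 by (intro mult_right_mono ennreal_leI) auto
    finally show ?thesis .
  next
    case False
    have "norm (kfun n m (cis \<phi> * z)) \<le> K" for \<phi>
    proof -
      have "norm (kfun n m (cis \<phi> * z)) \<le> (\<Sum>k. kcoeff n m k * norm z ^ k)"
        using norm_kfun_le[OF n, of "cis \<phi> * z"] by (simp add: norm_mult)
      also have "\<dots> \<le> K"
        unfolding K_def using False kpos[THEN less_imp_le]
        by (intro suminf_le summable_kcoeff n sK mult_left_le power_le_one) auto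
      finally show ?thesis .
    qed
    hence "(\<integral>\<^sup>+\<phi>. ennreal (indicator {0..2 * pi} \<phi> * norm (kfun n m (cis \<phi> * z))) \<partial>lborel) \<le>
        (\<integral>\<^sup>+\<phi>. ennreal K * indicator {0..2 * pi} \<phi> \<partial>lborel)"
      using K by (intro nn_integral_mono) (auto simp: indicator_def intro!: ennreal_leI)
    also have "\<dots> = ennreal (K * (2 * pi))" using K by (simp add: nn_integral_cmult ennreal_mult')
    also have "\<dots> = ennreal C3 * ennreal (bcoeff n m 0 * norm z ^ (2 * 0))"
      using bpos[of 0] K by (simp add: C3_def ennreal_mult'[symmetric] mult_ac)
    also have "\<dots> \<le> ennreal C3 * Q z"
      unfolding Q_def using sum_le_suminf[of "\<lambda>k. ennreal (bcoeff n m k * norm z ^ (2 * k))" "{0}"]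
      by (intro mult_left_mono) auto
    also have "\<dots> \<le> ennreal (C1 * C2 + C3) * Q z" using C1 C2 C3 by (intro mult_right_mono ennreal_leI) auto
    finally show ?thesis .
  qed
  moreover have "C1 * C2 + C3 > 0" using C1 C2 C3 by (simp add: add_pos_pos)
  ultimately show ?thesis unfolding Q_def by blast
qed

text \<open>The sign compensates for the conjugation in the second argument of
  \<open>cinner\<close>.\<close>

definition phase :: "real \<Rightarrow> complex ^ 'n::finite \<Rightarrow> complex ^ 'n" where
  "phase t y = (\<chi> j. cis (- t) * y $ j)"

lemma linear_phase: "linear (phase t)"
  by (rule linearI) (auto simp: phase_def vec_eq_iff algebra_simps)

lemma norm_phase: "norm (phase t y) = norm y"
  by (simp add: norm_vec_def phase_def norm_mult)

lemma cinner_phase: "cinner x (phase t y) = cis t * cinner x y"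
  by (simp add: cinner_def phase_def sum_distrib_left mult_ac cis_cnj)

text \<open>Multiplying \<open>y\<close> by a phase preserves Lebesgue measure and the weight and
  rotates \<open>cinner x y\<close>. Averaging over the phase thus replaces the modulus of the
  kernel by its circle mean; the comparison series is then integrated termwise.\<close>

lemma kernel_integral_le:
  assumes n: "CARD('n::finite) \<ge> 2" "1 < m" "m < 2"
    and H: "real CARD('n) - real CARD('n) / m \<ge> 1 / 2" and \<beta>: "\<beta> > 0" and b: "b > 0"
  shows "\<exists>C>0. \<forall>x :: complex ^ 'n. (\<integral>\<^sup>+y. ennreal (norm (kfun CARD('n) m (of_real (\<beta> powr (1 / m)) * cinner x y)) *
      exp (- b * norm y powr (2 * m))) \<partial>lborel) \<le> ennreal (C * exp (\<beta>\<^sup>2 / (4 * b) * norm x powr (2 * m)))"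
proof -
  define N where "N = CARD('n)"
  define B where "B = \<beta> powr (1 / m)"
  have B: "B > 0" using \<beta> by (simp add: B_def)
  obtain C where C: "C > 0" "\<And>z. (\<integral>\<^sup>+\<phi>. ennreal (indicator {0..2 * pi} \<phi> * norm (kfun N m (cis \<phi> * z))) \<partial>lborel) \<le>
      ennreal C * (\<Sum>k. ennreal (bcoeff N m k * norm z ^ (2 * k)))"
    using circle_mean_kfun_le[OF n H] unfolding N_def by blast
  have bpos: "bcoeff N m k > 0" for k using n by (intro bcoeff_pos) (auto simp: N_def)
  have N: "real k + real N > 0" for k using n by (simp add: N_def add_nonneg_pos)
  define w where "w y = exp (- b * norm y powr (2 * m))" for y :: "complex ^ 'n"
  define S where "S x = (\<integral>\<^sup>+y. ennreal (norm (kfun N m (of_real B * cinner x y)) * w y) \<partial>lborel)" for x :: "complex ^ 'n"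
  have [measurable]: "cis \<in> borel_measurable borel"
    by (intro borel_measurable_continuous_onI continuous_intros)
  have [measurable]: "w \<in> borel_measurable borel" unfolding w_def[abs_def] by measurable
  have rot: "S x = (\<integral>\<^sup>+y. ennreal (norm (kfun N m (cis \<phi> * (of_real B * cinner x y))) * w y) \<partial>lborel)" for x \<phi>
  proof -
    have "S x = (\<integral>\<^sup>+y. ennreal (norm (kfun N m (of_real B * cinner x (phase \<phi> y))) * w (phase \<phi> y)) \<partial>lborel)"
      unfolding S_def by (rule nn_integral_lborel_isometry[OF linear_phase norm_phase, symmetric]) measurable
    thus ?thesis by (simp add: cinner_phase w_def norm_phase mult_ac)
  qed
  \<comment> \<open>\<open>bcoeff\<close> was defined for this cancellation: \<open>B^(2k)\<close>,
    the power of 4 and the power of \<open>b\<close> combine to \<open>\<beta>^2 / (4 b)\<close> to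
    the power \<open>k / m\<close>, and only one Gamma factor remains.\<close>
  have term_eq: "bcoeff N m k * B ^ (2 * k) * (pi ^ N * fact k * norm x ^ (2 * k) *
      (b powr (- (real k + real N) / m) * Gamma ((real k + real N) / m + 1) / Gamma (real k + real N + 1))) =
      (pi ^ N / m * b powr (- real N / m)) * expterm (1 / m * real k) (\<beta>\<^sup>2 / (4 * b) * norm x powr (2 * m))"
    if x: "x \<noteq> 0" for k and x :: "complex ^ 'n"
  proof -
    define u where "u = real k / m"
    define v where "v = (real k + real N) / m"
    have v: "v > 0" using N n by (simp add: v_def)
    have G1: "Gamma (v + 1) = v * Gamma v"
      using v nonpos_Ints_nonpos[of v] by (intro Gamma_plus1) auto
    have G2: "Gamma (real k + real N + 1) = (real k + real N) * Gamma (real k + real N)"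
      using N[of k] nonpos_Ints_nonpos[of "real k + real N"] by (intro Gamma_plus1) auto
    have ne: "Gamma v \<noteq> 0" "Gamma (real k + real N) \<noteq> 0" "real k + real N \<noteq> 0"
      using less_imp_neq[OF Gamma_real_pos[OF v]] less_imp_neq[OF Gamma_real_pos[OF N[of k]]]
        less_imp_neq[OF N[of k]] by simp_all
    have "(norm x powr (2 * m)) powr u = norm x ^ (2 * k)"
    proof -
      have "(norm x powr (2 * m)) powr u = norm x powr real (2 * k)"
        unfolding powr_powr using n by (simp add: u_def)
      thus ?thesis using x by (subst (asm) powr_realpow) auto
    qed
    moreover have "B ^ (2 * k) = (\<beta>\<^sup>2) powr u"
    proof -
      have "B ^ (2 * k) = B powr real (2 * k)" using B by (simp add: powr_realpow del: of_nat_mult)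
      also have "\<dots> = \<beta> powr (2 * u)" unfolding B_def powr_powr by (simp add: u_def)
      also have "\<dots> = (\<beta> powr 2) powr u" by (simp add: powr_powr)
      finally show ?thesis using \<beta> by simp
    qed
    moreover have "b powr (- (real k + real N) / m) = b powr (- real N / m) * (1 / b powr u)"
    proof -
      have "- (real k + real N) / m = - real N / m + - u" by (simp add: u_def diff_divide_distrib)
      thus ?thesis by (simp only: powr_add powr_minus_divide)
    qed
    moreover have "(\<beta>\<^sup>2 / (4 * b) * norm x powr (2 * m)) powr u = (\<beta>\<^sup>2) powr u / (4 powr u * b powr u) * (norm x powr (2 * m)) powr u"
      by (simp add: powr_mult powr_divide)
    ultimately show ?thesis
      using ne n unfolding bcoeff_def kcoeff_def expterm_def u_def[symmetric]
      by (simp add: add.commute[of "real N" "real k"] v_def[symmetric] G1 G2 u_def[symmetric])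
        (simp add: v_def mult_ac)
  qed
  define C' where "C' = C / (2 * pi) * (pi ^ N / m * b powr (- real N / m)) * 16"
  have C': "C' > 0" using C n b by (simp add: C'_def)
  have main: "S x \<le> ennreal (C' * exp (\<beta>\<^sup>2 / (4 * b) * norm x powr (2 * m)))" if x: "x \<noteq> 0" for x
  proof -
    define V where "V = \<beta>\<^sup>2 / (4 * b) * norm x powr (2 * m)"
    have V: "V > 0" using \<beta> b x by (simp add: V_def)
    have "ennreal (2 * pi) * S x = (\<integral>\<^sup>+\<phi>. S x * indicator {0..2 * pi} \<phi> \<partial>lborel)"
      by (simp add: nn_integral_cmult mult.commute)
    also have "\<dots> = (\<integral>\<^sup>+\<phi>. \<integral>\<^sup>+y. ennreal (w y) * ennreal (indicator {0..2 * pi} \<phi> * norm (kfun N m (cis \<phi> * (of_real B * cinner x y)))) \<partial>lborel \<partial>lborel)"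
    proof (rule nn_integral_cong)
      fix \<phi> :: real
      show "S x * indicator {0..2 * pi} \<phi> = (\<integral>\<^sup>+y. ennreal (w y) * ennreal (indicator {0..2 * pi} \<phi> * norm (kfun N m (cis \<phi> * (of_real B * cinner x y)))) \<partial>lborel)"
        using rot[of x \<phi>] by (auto simp: indicator_def w_def ennreal_mult' mult_ac)
    qed
    also have "\<dots> = (\<integral>\<^sup>+y. \<integral>\<^sup>+\<phi>. ennreal (w y) * ennreal (indicator {0..2 * pi} \<phi> * norm (kfun N m (cis \<phi> * (of_real B * cinner x y)))) \<partial>lborel \<partial>lborel)"
      by (rule lborel_pair.Fubini') measurable
    also have "\<dots> \<le> (\<integral>\<^sup>+y. ennreal (w y) * (ennreal C * (\<Sum>k. ennreal (bcoeff N m k * norm (of_real B * cinner x y) ^ (2 * k)))) \<partial>lborel)"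
      by (rule nn_integral_mono) (simp add: nn_integral_cmult mult_left_mono C)
    also have "\<dots> = (\<integral>\<^sup>+y. (\<Sum>k. ennreal (C * bcoeff N m k * B ^ (2 * k)) * ennreal (norm (cinner x y) ^ (2 * k) * w y)) \<partial>lborel)"
    proof (rule nn_integral_cong)
      fix y :: "complex ^ 'n"
      have "ennreal (w y) * (ennreal C * (\<Sum>k. ennreal (bcoeff N m k * norm (of_real B * cinner x y) ^ (2 * k)))) =
          (\<Sum>k. ennreal (w y) * (ennreal C * ennreal (bcoeff N m k * norm (of_real B * cinner x y) ^ (2 * k))))"
        by (simp only: ennreal_suminf_cmult)
      also have "\<dots> = (\<Sum>k. ennreal (C * bcoeff N m k * B ^ (2 * k)) * ennreal (norm (cinner x y) ^ (2 * k) * w y))"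
        using C bpos[THEN less_imp_le] B
        by (intro suminf_cong) (simp add: w_def norm_mult power_mult_distrib ennreal_mult'[symmetric] mult_ac)
      finally show "ennreal (w y) * (ennreal C * (\<Sum>k. ennreal (bcoeff N m k * norm (of_real B * cinner x y) ^ (2 * k)))) =
          (\<Sum>k. ennreal (C * bcoeff N m k * B ^ (2 * k)) * ennreal (norm (cinner x y) ^ (2 * k) * w y))" .
    qed
    also have "\<dots> = (\<Sum>k. ennreal (C * bcoeff N m k * B ^ (2 * k)) * (\<integral>\<^sup>+y. ennreal (norm (cinner x y) ^ (2 * k) * w y) \<partial>lborel))"
      by (subst nn_integral_suminf) (simp_all add: nn_integral_cmult)
    also have "\<dots> = (\<Sum>k. ennreal (C * (pi ^ N / m * b powr (- real N / m))) * ennreal (expterm (1 / m * real k) V))"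
    proof (rule suminf_cong)
      fix k
      have "(\<integral>\<^sup>+y. ennreal (norm (cinner x y) ^ (2 * k) * w y) \<partial>lborel) = ennreal (pi ^ N * fact k * norm x ^ (2 * k) *
        (b powr (- (real k + real N) / m) * Gamma ((real k + real N) / m + 1) / Gamma (real k + real N + 1)))"
        unfolding w_def N_def by (rule nn_integral_cinner_power) (use b n in auto)
      hence "ennreal (C * bcoeff N m k * B ^ (2 * k)) * (\<integral>\<^sup>+y. ennreal (norm (cinner x y) ^ (2 * k) * w y) \<partial>lborel) =
         ennreal (C * (bcoeff N m k * B ^ (2 * k) * (pi ^ N * fact k * norm x ^ (2 * k) *
        (b powr (- (real k + real N) / m) * Gamma ((real k + real N) / m + 1) / Gamma (real k + real N + 1)))))"
        using C bpos[of k] B by (simp add: ennreal_mult'[symmetric] mult_ac)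
      also have "\<dots> = ennreal (C * (pi ^ N / m * b powr (- real N / m)) * expterm (1 / m * real k) V)"
        unfolding term_eq[OF x] V_def by (simp only: mult.assoc)
      also have "\<dots> = ennreal (C * (pi ^ N / m * b powr (- real N / m))) * ennreal (expterm (1 / m * real k) V)"
        using C n by (intro ennreal_mult') auto
      finally show "ennreal (C * bcoeff N m k * B ^ (2 * k)) * (\<integral>\<^sup>+y. ennreal (norm (cinner x y) ^ (2 * k) * w y) \<partial>lborel) =
          ennreal (C * (pi ^ N / m * b powr (- real N / m))) * ennreal (expterm (1 / m * real k) V)" .
    qed
    also have "\<dots> = ennreal (C * (pi ^ N / m * b powr (- real N / m))) * (\<Sum>k. ennreal (expterm (1 / m * real k) V))"
      by (rule ennreal_suminf_cmult)
    also have "\<dots> \<le> ennreal (C * (pi ^ N / m * b powr (- real N / m))) * ennreal (16 * exp V)"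
      using V n by (intro mult_left_mono suminf_expterm_le) (auto simp: field_simps)
    also have "\<dots> = ennreal (2 * pi) * ennreal (C' * exp V)"
      using C n C' by (simp add: C'_def ennreal_mult'[symmetric] mult_ac)
    finally show ?thesis
      by (subst (asm) ennreal_mult_le_mult_iff) (auto simp: V_def)
  qed
  \<comment> \<open>The origin is apart because \<open>term_eq\<close> fails there for
    \<open>k = 0\<close>: the left side is positive, whereas \<open>expterm 0 0\<close> is
    0.\<close>
  have zero: "S 0 \<le> ennreal (kcoeff N m 0 * moment (\<lambda>_::'n. 0) m 1 b)"
  proof -
    have k0: "kcoeff N m 0 > 0" using n by (intro kcoeff_pos) (auto simp: N_def)
    have "kfun N m 0 = of_real (kcoeff N m 0)" by (simp add: kfun_def)
    hence "S 0 = (\<integral>\<^sup>+y. ennreal (kcoeff N m 0) * ennreal (norm (vmono (\<lambda>_. 0) y) powr 1 * exp (- b * norm y powr (2 * m))) \<partial>(lborel :: (complex ^ 'n) measure))"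
      using k0 unfolding S_def by (intro nn_integral_cong) (simp add: cinner_def w_def vmono_def ennreal_mult')
    also have "\<dots> = ennreal (kcoeff N m 0) * ennreal (moment (\<lambda>_::'n. 0) m 1 b)"
      using b n by (subst nn_integral_cmult, simp, subst nn_integral_vmono) auto
    finally show ?thesis using k0 by (simp add: ennreal_mult')
  qed
  define C0 where "C0 = kcoeff N m 0 * moment (\<lambda>_::'n. 0) m 1 b"
  have C0: "C0 > 0" unfolding C0_def using n b by (intro mult_pos_pos kcoeff_pos moment_pos) (auto simp: N_def)
  have "S x \<le> ennreal ((C' + C0) * exp (\<beta>\<^sup>2 / (4 * b) * norm x powr (2 * m)))" for x
  proof (cases "x = 0")
    case True
    show ?thesis unfolding True
      by (rule order_trans[OF zero ennreal_leI]) (use C' in \<open>simp add: C0_def\<close>)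
  next
    case False
    from main[OF this] show ?thesis
      by (rule order_trans[OF _ ennreal_leI]) (use C0 in simp)
  qed
  thus ?thesis unfolding S_def w_def N_def B_def using C' C0 by (intro exI[of _ "C' + C0"]) auto
qed

section \<open>Sufficiency\<close>

lemma cnj_kfun:
  assumes "n \<ge> 2" "1 < m" "m < 2"
  shows "kfun n m (cnj z) = cnj (kfun n m z)"
proof -
  have pos: "kcoeff n m k \<ge> 0" for k using kcoeff_pos[of n m k] assms by auto
  have "summable (\<lambda>k. norm (of_real (kcoeff n m k) * z ^ k))"
    using summable_kcoeff[OF assms, of "norm z"] pos by (simp add: norm_mult norm_power)
  hence "summable (\<lambda>k. of_real (kcoeff n m k) * z ^ k)" by (rule summable_norm_cancel)
  from bounded_linear.suminf[OF bounded_linear_cnj this] show ?thesis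
    by (simp add: kfun_def)
qed

text \<open>The graph of \<open>g powr p\<close> lies above its tangent at \<open>c\<close>. Being
  linear in \<open>g\<close>, this yields Jensen's inequality without a conjugate exponent,
  uniformly down to \<open>p = 1\<close>.\<close>

lemma powr_tangent_le:
  fixes c g p :: real
  assumes "c \<ge> 0" "g \<ge> 0" "p \<ge> 1"
  shows "p * c powr (p - 1) * g \<le> g powr p + (p - 1) * c powr p"
proof (cases "c = 0 \<or> g = 0")
  case True
  thus ?thesis using assms by (auto intro!: add_nonneg_nonneg mult_nonneg_nonneg)
next
  case False
  hence cg: "c > 0" "g > 0" using assms by auto
  define t where "t = g / c"
  have t: "t > 0" using cg by (simp add: t_def)
  have "1 powr (1 - 1 / p) * (t powr p) powr (1 / p) \<le> (1 - 1 / p) * 1 + 1 / p * (t powr p)"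
    using t assms by (intro Youngs_inequality_0) auto
  hence conv: "(1 - 1 / p) * 1 + 1 / p * (t powr p) \<ge> t"
    using t assms by (simp add: powr_powr)
  have "p * t \<le> t powr p + (p - 1)"
    using mult_left_mono[OF conv, of p] assms by (simp add: algebra_simps)
  hence "p * t * c powr p \<le> (t powr p + (p - 1)) * c powr p" by (intro mult_right_mono) auto
  moreover have "t powr p * c powr p = g powr p" using cg by (simp add: t_def powr_divide)
  moreover have "t * c powr p = c powr (p - 1) * g" using cg by (simp add: t_def powr_diff)
  ultimately show ?thesis by (simp add: algebra_simps)
qed

text \<open>Jensen's inequality for the measure with density \<open>k\<close>. The number
  \<open>u\<close> only lies below the integral of \<open>k * g\<close>, so the lemma applies before
  that integral is known to be finite.\<close>

lemma nn_integral_powr_Hoelder: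
  fixes k g :: "'a \<Rightarrow> real" and u S p :: real
  assumes [measurable]: "k \<in> borel_measurable M" "g \<in> borel_measurable M"
    and k: "\<And>y. k y \<ge> 0" and g: "\<And>y. g y \<ge> 0" and S: "S > 0" and p: "p \<ge> 1" and u: "u \<ge> 0"
    and kS: "(\<integral>\<^sup>+y. ennreal (k y) \<partial>M) \<le> ennreal S"
    and ukg: "ennreal u \<le> (\<integral>\<^sup>+y. ennreal (k y * g y) \<partial>M)"
  shows "ennreal (u powr p) \<le> ennreal (S powr (p - 1)) * (\<integral>\<^sup>+y. ennreal (k y * g y powr p) \<partial>M)"
proof -
  \<comment> \<open>The tangent point is the mean value, so that the term with \<open>p - 1\<close>
    cancels exactly.\<close>
  define c where "c = u / S"
  have c: "c \<ge> 0" "u = c * S" using u S by (auto simp: c_def)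
  define X where "X = (\<integral>\<^sup>+y. ennreal (k y * g y powr p) \<partial>M)"
  have "ennreal (p * c powr (p - 1) * u) \<le> ennreal (p * c powr (p - 1)) * (\<integral>\<^sup>+y. ennreal (k y * g y) \<partial>M)"
    using p ukg by (simp add: ennreal_mult' mult_left_mono)
  also have "\<dots> = (\<integral>\<^sup>+y. ennreal (p * c powr (p - 1)) * ennreal (k y * g y) \<partial>M)"
    by (simp add: nn_integral_cmult)
  also have "\<dots> \<le> (\<integral>\<^sup>+y. ennreal (k y * g y powr p) + ennreal ((p - 1) * c powr p) * ennreal (k y) \<partial>M)"
  proof (rule nn_integral_mono)
    fix y
    have "k y * (p * c powr (p - 1) * g y) \<le> k y * (g y powr p + (p - 1) * c powr p)"
      using powr_tangent_le[OF c(1) g p] k by (intro mult_left_mono)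
    moreover have "ennreal (p * c powr (p - 1)) * ennreal (k y * g y) = ennreal (k y * (p * c powr (p - 1) * g y))"
      using p by (subst ennreal_mult'[symmetric]) (auto simp: mult_ac)
    moreover have "ennreal (k y * g y powr p) + ennreal ((p - 1) * c powr p) * ennreal (k y) =
        ennreal (k y * (g y powr p + (p - 1) * c powr p))"
      using p k[of y] by (simp add: ennreal_mult'[symmetric] ennreal_plus[symmetric] distrib_left mult.commute
          del: ennreal_plus)
    ultimately show "ennreal (p * c powr (p - 1)) * ennreal (k y * g y) \<le>
        ennreal (k y * g y powr p) + ennreal ((p - 1) * c powr p) * ennreal (k y)"
      by (simp only: ennreal_leI)
  qed
  also have "\<dots> = X + ennreal ((p - 1) * c powr p) * (\<integral>\<^sup>+y. ennreal (k y) \<partial>M)"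
    unfolding X_def by (subst nn_integral_add) (simp_all add: nn_integral_cmult)
  also have "\<dots> \<le> X + ennreal ((p - 1) * c powr p) * ennreal S"
    using kS by (intro add_left_mono mult_left_mono) auto
  also have "\<dots> = X + ennreal ((p - 1) * c powr p * S)" using p by (simp add: ennreal_mult')
  finally have *: "ennreal (p * c powr (p - 1) * u) \<le> X + ennreal ((p - 1) * c powr p * S)" .
  have "c powr (p - 1) * c = c powr p"
    using c p by (cases "c = 0") (auto simp: powr_diff)
  hence eq: "p * c powr (p - 1) * u = p * (c powr p * S)" by (simp add: c(2) mult_ac)
  show ?thesis
  proof (cases "X = top")
    case True
    have "S powr (p - 1) > 0" using S by simp
    thus ?thesis unfolding X_def[symmetric] True by (simp add: ennreal_mult_top)
  next
    case False
    then obtain r where r: "X = ennreal r" "r \<ge> 0" by (cases X) auto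
    have "p * (c powr p * S) \<le> r + (p - 1) * (c powr p * S)"
      using * r p S unfolding eq by (simp add: ennreal_plus[symmetric] mult.assoc del: ennreal_plus)
    hence "c powr p * S \<le> r" by (simp add: algebra_simps)
    hence "S powr (p - 1) * (c powr p * S) \<le> S powr (p - 1) * r" by (intro mult_left_mono) auto
    moreover have "S powr (p - 1) * (c powr p * S) = u powr p"
      using S c by (simp add: powr_mult powr_diff)
    ultimately show ?thesis unfolding X_def[symmetric] r
      by (simp add: ennreal_mult'[symmetric] ennreal_leI)
  qed
qed

text \<open>Jensen in \<open>y\<close> uses the row bound, with factor
  \<open>S powr (p - 1)\<close>; Fubini and the column bound supply the last factor
  \<open>S\<close>.\<close>

lemma schur_test:
  fixes k :: "'a::euclidean_space \<Rightarrow> 'a \<Rightarrow> real" and g u :: "'a \<Rightarrow> real"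
  assumes [measurable]: "(\<lambda>(x, y). k x y) \<in> borel_measurable (borel \<Otimes>\<^sub>M borel)" "g \<in> borel_measurable borel"
    and k: "\<And>x y. k x y \<ge> 0" and g: "\<And>y. g y \<ge> 0" and S: "S > 0" and p: "p \<ge> 1" and u: "\<And>x. u x \<ge> 0"
    and k1: "\<And>x. (\<integral>\<^sup>+y. ennreal (k x y) \<partial>lborel) \<le> ennreal S"
    and k2: "\<And>y. (\<integral>\<^sup>+x. ennreal (k x y) \<partial>lborel) \<le> ennreal S"
    and ukg: "\<And>x. ennreal (u x) \<le> (\<integral>\<^sup>+y. ennreal (k x y * g y) \<partial>lborel)"
  shows "(\<integral>\<^sup>+x. ennreal (u x powr p) \<partial>lborel) \<le> ennreal (S powr p) * (\<integral>\<^sup>+y. ennreal (g y powr p) \<partial>lborel)"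
proof -
  have "(\<integral>\<^sup>+x. ennreal (u x powr p) \<partial>lborel) \<le>
      (\<integral>\<^sup>+x. ennreal (S powr (p - 1)) * (\<integral>\<^sup>+y. ennreal (k x y * g y powr p) \<partial>lborel) \<partial>lborel)"
    by (intro nn_integral_mono nn_integral_powr_Hoelder k g S p u k1 ukg) measurable
  also have "\<dots> = ennreal (S powr (p - 1)) * (\<integral>\<^sup>+x. \<integral>\<^sup>+y. ennreal (k x y * g y powr p) \<partial>lborel \<partial>lborel)"
    by (rule nn_integral_cmult) measurable
  also have "(\<integral>\<^sup>+x. \<integral>\<^sup>+y. ennreal (k x y * g y powr p) \<partial>lborel \<partial>lborel) =
      (\<integral>\<^sup>+y. \<integral>\<^sup>+x. ennreal (k x y * g y powr p) \<partial>lborel \<partial>lborel)"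
    by (rule lborel_pair.Fubini') measurable
  also have "\<dots> = (\<integral>\<^sup>+y. (\<integral>\<^sup>+x. ennreal (k x y) \<partial>lborel) * ennreal (g y powr p) \<partial>lborel)"
    using k by (intro nn_integral_cong) (simp add: ennreal_mult' nn_integral_multc)
  also have "\<dots> \<le> (\<integral>\<^sup>+y. ennreal S * ennreal (g y powr p) \<partial>lborel)"
    by (intro nn_integral_mono mult_right_mono k2) auto
  also have "\<dots> = ennreal S * (\<integral>\<^sup>+y. ennreal (g y powr p) \<partial>lborel)"
    by (rule nn_integral_cmult) measurable
  finally have "(\<integral>\<^sup>+x. ennreal (u x powr p) \<partial>lborel) \<le> ennreal (S powr (p - 1)) *
      (ennreal S * (\<integral>\<^sup>+y. ennreal (g y powr p) \<partial>lborel))"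
    by (auto simp: mult_left_mono)
  thus ?thesis using S by (simp add: mult.assoc[symmetric] ennreal_mult'[symmetric] powr_diff)
qed

section \<open>The projection on weighted spaces\<close>

lemma nn_integral_mu:
  assumes [measurable]: "f \<in> borel_measurable borel"
  shows "(\<integral>\<^sup>+x. f x \<partial>mu \<alpha> m) = (\<integral>\<^sup>+x. ennreal (exp (- \<alpha> * norm x powr (2 * m))) * f x \<partial>lborel)"
  unfolding mu_def by (subst nn_integral_density) simp_all

lemma sets_mu [simp, measurable_cong]: "sets (mu \<alpha> m) = sets borel"
  by (simp add: mu_def)

lemma kernel_measurable [measurable]:
  assumes [measurable]: "f \<in> borel_measurable M" "g \<in> borel_measurable M"
  shows "(\<lambda>x. bergK \<beta> m (f x) (g x)) \<in> borel_measurable M"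
  unfolding bergK_eq_kfun by measurable

lemma Pproj_eq_lborel:
  assumes [measurable]: "f \<in> borel_measurable borel"
  shows "Pproj \<beta> m f x = (\<integral>y. exp (- \<beta> * norm y powr (2 * m)) *\<^sub>R (f y * bergK \<beta> m x y) \<partial>lborel)"
  unfolding Pproj_def mu_def by (rule integral_density) auto

lemma Pproj_measurable:
  fixes f :: "complex ^ 'n::finite \<Rightarrow> complex"
  assumes [measurable]: "f \<in> borel_measurable borel"
  shows "Pproj \<beta> m f \<in> borel_measurable borel"
proof -
  have "(\<lambda>x :: complex ^ 'n. \<integral>y. exp (- \<beta> * norm y powr (2 * m)) *\<^sub>R (f y * bergK \<beta> m x y) \<partial>lborel) \<in> borel_measurable lborel"
    by (rule lborel.borel_measurable_lebesgue_integral) measurable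
  thus ?thesis by (subst (asm) Pproj_eq_lborel[symmetric]) simp_all
qed

lemma norm_Pproj_le:
  fixes f :: "complex ^ 'n::finite \<Rightarrow> complex"
  assumes [measurable]: "f \<in> borel_measurable borel"
  shows "ennreal (norm (Pproj \<beta> m f x)) \<le>
    (\<integral>\<^sup>+y. ennreal (exp (- \<beta> * norm y powr (2 * m)) * norm (f y) * norm (bergK \<beta> m x y)) \<partial>lborel)"
proof -
  have "ennreal (norm (Pproj \<beta> m f x)) \<le>
      (\<integral>\<^sup>+y. ennreal (norm (exp (- \<beta> * norm y powr (2 * m)) *\<^sub>R (f y * bergK \<beta> m x y))) \<partial>lborel)"
    unfolding Pproj_eq_lborel[OF assms]
  proof (cases "integrable lborel (\<lambda>y. exp (- \<beta> * norm y powr (2 * m)) *\<^sub>R (f y * bergK \<beta> m x y))")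
    case True
    thus "ennreal (norm (\<integral>y. exp (- \<beta> * norm y powr (2 * m)) *\<^sub>R (f y * bergK \<beta> m x y) \<partial>lborel)) \<le>
        (\<integral>\<^sup>+y. ennreal (norm (exp (- \<beta> * norm y powr (2 * m)) *\<^sub>R (f y * bergK \<beta> m x y))) \<partial>lborel)"
      by (rule integral_norm_bound_ennreal)
  \<comment> \<open>Without integrability the Bochner integral has the default value 0, and the
    bound is trivial.\<close>
  qed (simp add: not_integrable_integral_eq)
  thus ?thesis by (simp add: norm_mult mult.assoc)
qed

text \<open>Works with integrals of powers instead of norms, hence the exponent
  \<open>q / p\<close>; the operator bound obtained is \<open>D powr (1 / q)\<close>.\<close>

lemma P_boundedI:
  assumes p: "p \<ge> 1" and q: "q \<ge> 1"
    and le: "\<And>f :: complex ^ 'n::finite \<Rightarrow> complex. f \<in> borel_measurable borel \<Longrightarrow>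
      (\<integral>\<^sup>+x. ennreal (norm (f x) powr p) \<partial>mu \<alpha> m) < \<infinity> \<Longrightarrow>
      (\<integral>\<^sup>+x. ennreal (norm (Pproj \<beta> m f x) powr q) \<partial>mu \<gamma> m) \<le>
        ennreal (D * enn2real (\<integral>\<^sup>+x. ennreal (norm (f x) powr p) \<partial>mu \<alpha> m) powr (q / p))"
    and D: "D \<ge> 0"
  shows "P_bounded TYPE('n) \<beta> m \<alpha> p \<gamma> q"
  unfolding P_bounded_def
proof (intro exI allI impI)
  fix f :: "complex ^ 'n \<Rightarrow> complex"
  assume f: "inLp (mu \<beta> m) 2 f \<and> inLp (mu \<alpha> m) p f"
  hence fm: "f \<in> borel_measurable borel"
    and ff: "(\<integral>\<^sup>+x. ennreal (norm (f x) powr p) \<partial>mu \<alpha> m) < \<infinity>"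
    by (auto simp: inLp_def cong: measurable_cong_sets)
  define F where "F = enn2real (\<integral>\<^sup>+x. ennreal (norm (f x) powr p) \<partial>mu \<alpha> m)"
  define J where "J = (\<integral>\<^sup>+x. ennreal (norm (Pproj \<beta> m f x) powr q) \<partial>mu \<gamma> m)"
  have J: "J \<le> ennreal (D * F powr (q / p))" using le[OF fm ff] by (simp add: J_def F_def)
  have "enn2real J \<le> enn2real (ennreal (D * F powr (q / p)))" using J by (intro enn2real_mono) auto
  also have "\<dots> = D * F powr (q / p)" using D by simp
  finally have "enn2real J powr (1 / q) \<le> (D * F powr (q / p)) powr (1 / q)"
    using q by (intro powr_mono2) auto
  also have "\<dots> = D powr (1 / q) * F powr (1 / p)" using p q by (simp add: powr_mult powr_powr)
  finally show "inLp (mu \<gamma> m) q (Pproj \<beta> m f) \<and>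
      Lpnorm (mu \<gamma> m) q (Pproj \<beta> m f) \<le> D powr (1 / q) * Lpnorm (mu \<alpha> m) p f"
    using J Pproj_measurable[OF fm, of \<beta> m]
    by (auto simp: inLp_def Lpnorm_def J_def[symmetric] F_def[symmetric] cong: measurable_cong_sets intro: le_less_trans)
qed

lemma nn_integral_mu_powr:
  fixes f :: "complex ^ 'n::finite \<Rightarrow> complex"
  assumes [measurable]: "f \<in> borel_measurable borel" and p: "p > 0"
  shows "(\<integral>\<^sup>+x. ennreal (norm (f x) powr p) \<partial>mu \<alpha> m) =
    (\<integral>\<^sup>+x. ennreal ((norm (f x) * exp (- (\<alpha> / p) * norm x powr (2 * m))) powr p) \<partial>lborel)"
  using p by (subst nn_integral_mu)
    (auto simp: powr_mult powr_def[of "exp _"] ennreal_mult'[symmetric] mult_ac intro!: nn_integral_cong)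

text \<open>Splits the weight of the projection: \<open>c\<close> goes to \<open>f\<close>, turning
  its norm into an unweighted one when \<open>c = \<alpha> / p\<close>, and
  \<open>\<beta> - c\<close> stays with the kernel.\<close>

lemma norm_Pproj_weighted_le:
  fixes f :: "complex ^ 'n::finite \<Rightarrow> complex"
  assumes f: "f \<in> borel_measurable borel"
  shows "ennreal (norm (Pproj \<beta> m f x) * exp (- a * norm x powr (2 * m))) \<le>
    (\<integral>\<^sup>+y. ennreal (norm (bergK \<beta> m x y) * exp (- a * norm x powr (2 * m)) * exp (- (\<beta> - c) * norm y powr (2 * m)) *
      (norm (f y) * exp (- c * norm y powr (2 * m)))) \<partial>lborel)"
proof -
  note [measurable] = f
  have "ennreal (norm (Pproj \<beta> m f x) * exp (- a * norm x powr (2 * m))) =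
      ennreal (exp (- a * norm x powr (2 * m))) * ennreal (norm (Pproj \<beta> m f x))"
    by (simp add: ennreal_mult' mult.commute)
  also have "\<dots> \<le> ennreal (exp (- a * norm x powr (2 * m))) *
      (\<integral>\<^sup>+y. ennreal (exp (- \<beta> * norm y powr (2 * m)) * norm (f y) * norm (bergK \<beta> m x y)) \<partial>lborel)"
    by (intro mult_left_mono norm_Pproj_le f) auto
  also have "\<dots> = (\<integral>\<^sup>+y. ennreal (exp (- a * norm x powr (2 * m))) *
      ennreal (exp (- \<beta> * norm y powr (2 * m)) * norm (f y) * norm (bergK \<beta> m x y)) \<partial>lborel)"
    by (rule nn_integral_cmult[symmetric]) measurable
  also have "\<dots> = (\<integral>\<^sup>+y. ennreal (norm (bergK \<beta> m x y) * exp (- a * norm x powr (2 * m)) * exp (- (\<beta> - c) * norm y powr (2 * m)) *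
      (norm (f y) * exp (- c * norm y powr (2 * m)))) \<partial>lborel)"
  proof (rule nn_integral_cong)
    fix y :: "complex ^ 'n"
    have "exp (- \<beta> * norm y powr (2 * m)) = exp (- (\<beta> - c) * norm y powr (2 * m)) * exp (- c * norm y powr (2 * m))"
      by (simp add: exp_add[symmetric] algebra_simps)
    thus "ennreal (exp (- a * norm x powr (2 * m))) *
        ennreal (exp (- \<beta> * norm y powr (2 * m)) * norm (f y) * norm (bergK \<beta> m x y)) =
        ennreal (norm (bergK \<beta> m x y) * exp (- a * norm x powr (2 * m)) * exp (- (\<beta> - c) * norm y powr (2 * m)) *
        (norm (f y) * exp (- c * norm y powr (2 * m))))"
      by (subst ennreal_mult'[symmetric]) (auto simp: mult_ac)
  qed
  finally show ?thesis .
qed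

lemma nn_integral_exp_norm:
  assumes "c > 0" "m > 0"
  shows "(\<integral>\<^sup>+y. ennreal (exp (- c * norm y powr (2 * m))) \<partial>(lborel :: (complex ^ 'n::finite) measure)) =
    ennreal (moment (\<lambda>_::'n. 0) m 1 c)"
  using nn_integral_vmono[of 1 c m "\<lambda>_::'n. 0"] assms by (simp add: vmono_def)

lemma P_bounded_critical:
  fixes \<alpha> \<beta> \<gamma> p m :: real
  assumes n: "CARD('n::finite) \<ge> 2" "1 < m" "m < 2"
    and H: "real CARD('n) - real CARD('n) / m \<ge> 1 / 2"
    and \<beta>: "\<beta> > 0" and \<gamma>: "\<gamma> > 0" and p: "1 \<le> p" and crit: "p = 4 * \<gamma> / \<beta>\<^sup>2 * (\<beta> - \<alpha> / p)"
  shows "P_bounded TYPE('n) \<beta> m \<alpha> p \<gamma> p"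
proof -
  define a where "a = \<gamma> / p"
  define b where "b = \<beta> - \<alpha> / p"
  define \<kappa> where "\<kappa> = m * \<beta> powr (real CARD('n) / m) / pi ^ CARD('n)"
  have \<kappa>: "\<kappa> > 0" using n \<beta> by (simp add: \<kappa>_def)
  have a: "a > 0" using \<gamma> p by (simp add: a_def)
  have ab: "4 * a * b = \<beta>\<^sup>2"
  proof -
    have "p * \<beta>\<^sup>2 = 4 * \<gamma> * b" using crit \<beta> by (simp add: b_def field_simps)
    thus ?thesis using p by (simp add: a_def field_simps)
  qed
  have b: "b > 0"
  proof (rule ccontr)
    assume "\<not> b > 0"
    hence "4 * a * b \<le> 0" using a by (simp add: mult_nonneg_nonpos)
    thus False using ab \<beta> by simp
  qed
  \<comment> \<open>Criticality makes \<open>kernel_integral_le\<close> close up: row integrals grow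
    with exactly the rate \<open>a\<close> that the weight in \<open>x\<close> takes away, column
    integrals with exactly \<open>b\<close>. Hence the constant function serves as Schur test
    function.\<close>
  have quo: "\<beta>\<^sup>2 / (4 * b) = a" "\<beta>\<^sup>2 / (4 * a) = b" using ab a b by (auto simp: field_simps)
  define E where "E x y = kfun CARD('n) m (of_real (\<beta> powr (1 / m)) * cinner x y)" for x y :: "complex ^ 'n"
  obtain C1 where C1: "C1 > 0" "\<And>x. (\<integral>\<^sup>+y. ennreal (norm (E x y) * exp (- b * norm y powr (2 * m))) \<partial>lborel)
      \<le> ennreal (C1 * exp (a * norm x powr (2 * m)))"
    using kernel_integral_le[OF n H \<beta> b] unfolding quo E_def by blast
  obtain C2 where C2: "C2 > 0" "\<And>x. (\<integral>\<^sup>+y. ennreal (norm (E x y) * exp (- a * norm y powr (2 * m))) \<partial>lborel)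
      \<le> ennreal (C2 * exp (b * norm x powr (2 * m)))"
    using kernel_integral_le[OF n H \<beta> a] unfolding quo E_def by blast
  have sym: "norm (E x y) = norm (E y x)" for x y
    unfolding E_def using cnj_kfun[OF n, of "of_real (\<beta> powr (1 / m)) * cinner y x"] cinner_commute[of x y]
    by (metis complex_cnj_complex_of_real complex_cnj_mult complex_mod_cnj)
  define k where "k x y = norm (bergK \<beta> m x y) * exp (- a * norm x powr (2 * m)) * exp (- b * norm y powr (2 * m))" for x y :: "complex ^ 'n"
  have k_eq: "k x y = \<kappa> * norm (E x y) * exp (- a * norm x powr (2 * m)) * exp (- b * norm y powr (2 * m))" for x y
    using \<kappa> unfolding k_def bergK_eq_kfun E_def[symmetric] \<kappa>_def[symmetric] by (simp add: norm_mult)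
  have [measurable]: "(\<lambda>(x, y). k x y) \<in> borel_measurable (borel \<Otimes>\<^sub>M borel)"
    unfolding k_def by measurable
  have [measurable]: "(\<lambda>(x, y). E x y) \<in> borel_measurable (borel \<Otimes>\<^sub>M borel)"
    unfolding E_def by measurable
  define S where "S = \<kappa> * (C1 + C2)"
  have S: "S > 0" using \<kappa> C1 C2 by (simp add: S_def)
  have k1: "(\<integral>\<^sup>+y. ennreal (k x y) \<partial>lborel) \<le> ennreal S" for x
  proof -
    have "(\<integral>\<^sup>+y. ennreal (k x y) \<partial>lborel) = (\<integral>\<^sup>+y. ennreal (\<kappa> * exp (- a * norm x powr (2 * m))) *
        ennreal (norm (E x y) * exp (- b * norm y powr (2 * m))) \<partial>lborel)"
      unfolding k_eq using \<kappa> by (intro nn_integral_cong) (simp add: ennreal_mult'[symmetric] mult_ac)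
    also have "\<dots> = ennreal (\<kappa> * exp (- a * norm x powr (2 * m))) *
        (\<integral>\<^sup>+y. ennreal (norm (E x y) * exp (- b * norm y powr (2 * m))) \<partial>lborel)"
      by (rule nn_integral_cmult) measurable
    also have "\<dots> \<le> ennreal (\<kappa> * exp (- a * norm x powr (2 * m))) * ennreal (C1 * exp (a * norm x powr (2 * m)))"
      by (intro mult_left_mono C1) auto
    also have "\<dots> = ennreal (\<kappa> * C1 * (exp (- a * norm x powr (2 * m)) * exp (a * norm x powr (2 * m))))"
      using \<kappa> by (subst ennreal_mult'[symmetric]) (auto simp: mult_ac)
    also have "\<dots> \<le> ennreal S"
      using \<kappa> C2 by (intro ennreal_leI) (simp add: S_def exp_add[symmetric])
    finally show ?thesis .
  qed
  have k2: "(\<integral>\<^sup>+x. ennreal (k x y) \<partial>lborel) \<le> ennreal S" for y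
  proof -
    have "(\<integral>\<^sup>+x. ennreal (k x y) \<partial>lborel) = (\<integral>\<^sup>+x. ennreal (\<kappa> * exp (- b * norm y powr (2 * m))) *
        ennreal (norm (E y x) * exp (- a * norm x powr (2 * m))) \<partial>lborel)"
      unfolding k_eq using \<kappa> by (intro nn_integral_cong) (simp add: sym[of _ y] ennreal_mult'[symmetric] mult_ac)
    also have "\<dots> = ennreal (\<kappa> * exp (- b * norm y powr (2 * m))) *
        (\<integral>\<^sup>+x. ennreal (norm (E y x) * exp (- a * norm x powr (2 * m))) \<partial>lborel)"
      by (rule nn_integral_cmult) measurable
    also have "\<dots> \<le> ennreal (\<kappa> * exp (- b * norm y powr (2 * m))) * ennreal (C2 * exp (b * norm y powr (2 * m)))"
      by (intro mult_left_mono C2) auto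
    also have "\<dots> = ennreal (\<kappa> * C2 * (exp (- b * norm y powr (2 * m)) * exp (b * norm y powr (2 * m))))"
      using \<kappa> by (subst ennreal_mult'[symmetric]) (auto simp: mult_ac)
    also have "\<dots> \<le> ennreal S"
      using \<kappa> C1 by (intro ennreal_leI) (simp add: S_def exp_add[symmetric])
    finally show ?thesis .
  qed
  show ?thesis
  proof (rule P_boundedI[OF p p, where D = "S powr p"])
    fix f :: "complex ^ 'n \<Rightarrow> complex"
    assume f[measurable]: "f \<in> borel_measurable borel"
      and fin: "(\<integral>\<^sup>+x. ennreal (norm (f x) powr p) \<partial>mu \<alpha> m) < \<infinity>"
    have Pm[measurable]: "Pproj \<beta> m f \<in> borel_measurable borel" by (rule Pproj_measurable[OF f])
    have "(\<integral>\<^sup>+x. ennreal (norm (Pproj \<beta> m f x) powr p) \<partial>mu \<gamma> m) =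
        (\<integral>\<^sup>+x. ennreal ((norm (Pproj \<beta> m f x) * exp (- a * norm x powr (2 * m))) powr p) \<partial>lborel)"
      unfolding a_def using p by (intro nn_integral_mu_powr) auto
    also have "\<dots> \<le> ennreal (S powr p) *
        (\<integral>\<^sup>+y. ennreal ((norm (f y) * exp (- (\<alpha> / p) * norm y powr (2 * m))) powr p) \<partial>lborel)"
    proof (rule schur_test[OF _ _ _ _ S p _ k1 k2])
      fix x
      show "ennreal (norm (Pproj \<beta> m f x) * exp (- a * norm x powr (2 * m))) \<le>
          (\<integral>\<^sup>+y. ennreal (k x y * (norm (f y) * exp (- (\<alpha> / p) * norm y powr (2 * m)))) \<partial>lborel)"
        unfolding k_def b_def by (rule norm_Pproj_weighted_le[OF f])
    qed (auto simp: k_def)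
    also have "\<dots> = ennreal (S powr p) * (\<integral>\<^sup>+x. ennreal (norm (f x) powr p) \<partial>mu \<alpha> m)"
      using p by (subst nn_integral_mu_powr) auto
    also have "\<dots> = ennreal (S powr p * enn2real (\<integral>\<^sup>+x. ennreal (norm (f x) powr p) \<partial>mu \<alpha> m) powr (p / p))"
      using fin p by (simp add: ennreal_mult')
    finally show "(\<integral>\<^sup>+x. ennreal (norm (Pproj \<beta> m f x) powr p) \<partial>mu \<gamma> m) \<le>
        ennreal (S powr p * enn2real (\<integral>\<^sup>+x. ennreal (norm (f x) powr p) \<partial>mu \<alpha> m) powr (p / p))" .
  qed simp
qed

text \<open>Once the kernel lies below a function of \<open>x\<close> times a function of
  \<open>y\<close>, any pair of exponents works: the \<open>y\<close> integral is a number bounded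
  by Jensen, and the function of \<open>x\<close> has a finite integral to the power
  \<open>q\<close>.\<close>

lemma P_bounded_subcritical:
  fixes \<alpha> \<beta> \<gamma> p q m :: real
  assumes n: "CARD('n::finite) \<ge> 2" "1 < m" "m < 2"
    and \<beta>: "\<beta> > 0" and \<gamma>: "\<gamma> > 0" and p: "1 \<le> p" and q: "1 \<le> q"
    and sub: "q < 4 * \<gamma> / \<beta>\<^sup>2 * (\<beta> - \<alpha> / p)"
  shows "P_bounded TYPE('n) \<beta> m \<alpha> p \<gamma> q"
proof -
  define a where "a = \<gamma> / q"
  define b where "b = \<beta> - \<alpha> / p"
  define \<kappa> where "\<kappa> = m * \<beta> powr (real CARD('n) / m) / pi ^ CARD('n)"
  have \<kappa>: "\<kappa> > 0" using n \<beta> by (simp add: \<kappa>_def)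
  have a: "a > 0" using \<gamma> q by (simp add: a_def)
  have ab: "\<beta>\<^sup>2 < 4 * a * b"
  proof -
    have "q * \<beta>\<^sup>2 < 4 * \<gamma> * b" using sub \<beta> by (simp add: b_def field_simps)
    thus ?thesis using q by (simp add: a_def field_simps)
  qed
  have b: "b > 0"
  proof (rule ccontr)
    assume "\<not> b > 0"
    hence "4 * a * b \<le> 0" using a by (simp add: mult_nonneg_nonpos)
    thus False using ab zero_le_power2[of \<beta>] by linarith
  qed
  define t where "t = 2 * sqrt (a * b)"
  have t: "\<beta> < t"
    unfolding t_def using ab \<beta> a b by (intro power_less_imp_less_base[of \<beta> 2]) (auto simp: power_mult_distrib)
  \<comment> \<open>The gap between \<open>\<beta>\<close> and \<open>t\<close> is shared: one
    factor \<open>l\<close> pays for the loss \<open>1 + \<epsilon>\<close> in the kernel bound, and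
    \<open>1 - l\<close> remains as decay in both variables.\<close>
  define l where "l = sqrt (\<beta> / t)"
  have l: "0 < l" "l < 1" "l * l * t = \<beta>" using t \<beta> by (auto simp: l_def)
  define \<epsilon> where "\<epsilon> = 1 / l - 1"
  have \<epsilon>: "\<epsilon> > 0" "(1 + \<epsilon>) * \<beta> = l * t" using l by (auto simp: \<epsilon>_def field_simps)
  obtain C where C: "C > 0" "\<And>z. norm (kfun CARD('n) m z) \<le> C * exp ((1 + \<epsilon>) * norm z powr m)"
    using norm_kfun_exp_le[OF n \<epsilon>(1)] by blast
  define a' where "a' = (1 - l) * a"
  define b' where "b' = (1 - l) * b"
  have ab': "a' > 0" "b' > 0" using l a b by (auto simp: a'_def b'_def)
  have ker: "norm (bergK \<beta> m x y) * exp (- a * norm x powr (2 * m)) * exp (- b * norm y powr (2 * m)) \<le>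
      \<kappa> * C * exp (- a' * norm x powr (2 * m)) * exp (- b' * norm y powr (2 * m))" for x y :: "complex ^ 'n"
  proof -
    define X where "X = norm x powr m"
    define Y where "Y = norm y powr m"
    have XY: "norm x powr (2 * m) = X\<^sup>2" "norm y powr (2 * m) = Y\<^sup>2" "X \<ge> 0" "Y \<ge> 0"
      by (simp_all add: X_def Y_def power2_eq_square powr_add[symmetric])
    have "norm (of_real (\<beta> powr (1 / m)) * cinner x y) powr m \<le> (\<beta> powr (1 / m) * (norm x * norm y)) powr m"
      using n by (intro powr_mono2) (auto simp: norm_mult intro!: mult_left_mono norm_cinner_le)
    also have "\<dots> = \<beta> * (X * Y)" using n \<beta> by (simp add: powr_mult powr_powr X_def Y_def)
    finally have "(1 + \<epsilon>) * norm (of_real (\<beta> powr (1 / m)) * cinner x y) powr m \<le> (1 + \<epsilon>) * (\<beta> * (X * Y))"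
      using \<epsilon> by (intro mult_left_mono) auto
    \<comment> \<open>Writing \<open>t = 2 sqrt (a b)\<close> prepares AM-GM, which separates the
      variables with exactly the two weights.\<close>
    also have "\<dots> = l * (2 * (sqrt a * X) * (sqrt b * Y))"
      using \<epsilon>(2) by (simp add: mult.assoc[symmetric] t_def real_sqrt_mult)
    also have "\<dots> \<le> l * ((sqrt a * X)\<^sup>2 + (sqrt b * Y)\<^sup>2)"
      using l by (intro mult_left_mono sum_squares_bound) auto
    also have "\<dots> = l * (a * X\<^sup>2 + b * Y\<^sup>2)" using a b by (simp add: power_mult_distrib)
    finally have e: "(1 + \<epsilon>) * norm (of_real (\<beta> powr (1 / m)) * cinner x y) powr m \<le> l * (a * X\<^sup>2 + b * Y\<^sup>2)" .
    have "norm (bergK \<beta> m x y) = \<kappa> * norm (kfun CARD('n) m (of_real (\<beta> powr (1 / m)) * cinner x y))"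
      using \<kappa> unfolding bergK_eq_kfun \<kappa>_def[symmetric] by (simp add: norm_mult)
    also have "\<dots> \<le> \<kappa> * (C * exp (l * (a * X\<^sup>2 + b * Y\<^sup>2)))"
      using \<kappa> C e by (intro mult_left_mono order_trans[OF C(2)]) auto
    finally have "norm (bergK \<beta> m x y) * (exp (- a * X\<^sup>2) * exp (- b * Y\<^sup>2)) \<le>
        \<kappa> * (C * exp (l * (a * X\<^sup>2 + b * Y\<^sup>2))) * (exp (- a * X\<^sup>2) * exp (- b * Y\<^sup>2))"
      by (intro mult_right_mono) auto
    also have "\<dots> = \<kappa> * C * (exp (- a' * X\<^sup>2) * exp (- b' * Y\<^sup>2))"
      by (simp add: a'_def b'_def exp_add[symmetric] algebra_simps)
    finally show ?thesis by (simp add: XY mult.assoc)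
  qed
  define S where "S = moment (\<lambda>_::'n. 0) m 1 b'"
  have S: "S > 0" unfolding S_def using ab' n by (intro moment_pos) auto
  define R where "R = moment (\<lambda>_::'n. 0) m 1 (q * a')"
  have R: "R > 0" unfolding R_def using ab' n q by (intro moment_pos) auto
  define D where "D = (\<kappa> * C) powr q * R * (S powr (p - 1)) powr (q / p)"
  show ?thesis
  proof (rule P_boundedI[OF p q, where D = D])
    show "D \<ge> 0" using R by (simp add: D_def)
    fix f :: "complex ^ 'n \<Rightarrow> complex"
    assume f[measurable]: "f \<in> borel_measurable borel"
      and fin: "(\<integral>\<^sup>+x. ennreal (norm (f x) powr p) \<partial>mu \<alpha> m) < \<infinity>"
    have Pm[measurable]: "Pproj \<beta> m f \<in> borel_measurable borel" by (rule Pproj_measurable[OF f])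
    define F where "F = enn2real (\<integral>\<^sup>+x. ennreal (norm (f x) powr p) \<partial>mu \<alpha> m)"
    define g where "g y = norm (f y) * exp (- (\<alpha> / p) * norm y powr (2 * m))" for y
    have [measurable]: "g \<in> borel_measurable borel" unfolding g_def[abs_def] by measurable
    have g: "g y \<ge> 0" for y by (simp add: g_def)
    define k where "k y = exp (- b' * norm y powr (2 * m))" for y :: "complex ^ 'n"
    have [measurable]: "k \<in> borel_measurable borel" unfolding k_def[abs_def] by measurable
    have k: "k y \<ge> 0" "k y \<le> 1" for y using ab' by (auto simp: k_def)
    have kS: "(\<integral>\<^sup>+y. ennreal (k y) \<partial>lborel) \<le> ennreal S"
      unfolding k_def S_def using ab' n by (subst nn_integral_exp_norm) auto
    define V where "V = (S powr (p - 1) * F) powr (1 / p)"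
    have "(\<integral>\<^sup>+y. ennreal (g y powr p) \<partial>lborel) = (\<integral>\<^sup>+x. ennreal (norm (f x) powr p) \<partial>mu \<alpha> m)"
      unfolding g_def using p by (subst nn_integral_mu_powr) auto
    also have "\<dots> = ennreal F" unfolding F_def using fin by simp
    finally have gF: "(\<integral>\<^sup>+y. ennreal (g y powr p) \<partial>lborel) = ennreal F" .
    have F: "F \<ge> 0" by (simp add: F_def)
    have bound: "u \<le> V" if "u \<ge> 0" "ennreal u \<le> (\<integral>\<^sup>+y. ennreal (k y * g y) \<partial>lborel)" for u
    proof -
      have "ennreal (u powr p) \<le> ennreal (S powr (p - 1)) * (\<integral>\<^sup>+y. ennreal (k y * g y powr p) \<partial>lborel)"
        by (rule nn_integral_powr_Hoelder[OF _ _ k(1) g S p that(1) kS that(2)]) measurable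
      also have "\<dots> \<le> ennreal (S powr (p - 1)) * (\<integral>\<^sup>+y. ennreal (g y powr p) \<partial>lborel)"
        using k by (intro mult_left_mono nn_integral_mono ennreal_leI mult_left_le_one_le) auto
      also have "\<dots> = ennreal (S powr (p - 1) * F)" unfolding gF by (simp add: ennreal_mult')
      finally have "u powr p \<le> S powr (p - 1) * F" using F by (subst (asm) ennreal_le_iff) auto
      hence "(u powr p) powr (1 / p) \<le> V" unfolding V_def using p by (intro powr_mono2) auto
      thus ?thesis using that p by (simp add: powr_powr)
    qed
    have W: "(\<integral>\<^sup>+y. ennreal (k y * g y) \<partial>lborel) \<le> ennreal V"
    proof (cases "(\<integral>\<^sup>+y. ennreal (k y * g y) \<partial>lborel)" rule: ennreal_cases)
      case (real r)
      thus ?thesis using bound[of r] by (simp add: ennreal_leI)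
    next
      case top
      \<comment> \<open>An infinite integral would admit \<open>V + 1\<close> as a lower bound,
        against \<open>bound\<close>.\<close>
      hence "V + 1 \<le> V" by (intro bound) (auto simp: V_def)
      thus ?thesis by simp
    qed
    have V: "V \<ge> 0" by (simp add: V_def)
    have ptw: "norm (Pproj \<beta> m f x) * exp (- a * norm x powr (2 * m)) \<le> \<kappa> * C * V * exp (- a' * norm x powr (2 * m))" for x
    proof -
      have "ennreal (norm (Pproj \<beta> m f x) * exp (- a * norm x powr (2 * m))) \<le>
          (\<integral>\<^sup>+y. ennreal (norm (bergK \<beta> m x y) * exp (- a * norm x powr (2 * m)) * exp (- b * norm y powr (2 * m)) * g y) \<partial>lborel)"
        unfolding b_def g_def by (rule norm_Pproj_weighted_le[OF f])
      also have "\<dots> \<le> (\<integral>\<^sup>+y. ennreal (\<kappa> * C * exp (- a' * norm x powr (2 * m))) * ennreal (k y * g y) \<partial>lborel)"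
      proof (rule nn_integral_mono)
        fix y
        have "norm (bergK \<beta> m x y) * exp (- a * norm x powr (2 * m)) * exp (- b * norm y powr (2 * m)) * g y \<le>
            \<kappa> * C * exp (- a' * norm x powr (2 * m)) * exp (- b' * norm y powr (2 * m)) * g y"
          by (intro mult_right_mono ker g)
        thus "ennreal (norm (bergK \<beta> m x y) * exp (- a * norm x powr (2 * m)) * exp (- b * norm y powr (2 * m)) * g y) \<le>
            ennreal (\<kappa> * C * exp (- a' * norm x powr (2 * m))) * ennreal (k y * g y)"
          using \<kappa> C by (subst ennreal_mult'[symmetric]) (auto simp: k_def mult.assoc intro!: ennreal_leI)
      qed
      also have "\<dots> = ennreal (\<kappa> * C * exp (- a' * norm x powr (2 * m))) * (\<integral>\<^sup>+y. ennreal (k y * g y) \<partial>lborel)"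
        by (rule nn_integral_cmult) measurable
      also have "\<dots> \<le> ennreal (\<kappa> * C * exp (- a' * norm x powr (2 * m))) * ennreal V"
        by (intro mult_left_mono W) auto
      also have "\<dots> = ennreal (\<kappa> * C * V * exp (- a' * norm x powr (2 * m)))"
        using \<kappa> C by (subst ennreal_mult'[symmetric]) (auto simp: mult_ac)
      finally show ?thesis using \<kappa> C V by (subst (asm) ennreal_le_iff) auto
    qed
    have "(\<integral>\<^sup>+x. ennreal (norm (Pproj \<beta> m f x) powr q) \<partial>mu \<gamma> m) =
        (\<integral>\<^sup>+x. ennreal ((norm (Pproj \<beta> m f x) * exp (- a * norm x powr (2 * m))) powr q) \<partial>lborel)"
      unfolding a_def using q by (intro nn_integral_mu_powr) auto
    also have "\<dots> \<le> (\<integral>\<^sup>+x. ennreal ((\<kappa> * C * V) powr q) * ennreal (exp (- (q * a') * norm x powr (2 * m))) \<partial>(lborel :: (complex ^ 'n) measure))"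
    proof (rule nn_integral_mono)
      fix x :: "complex ^ 'n"
      have "(norm (Pproj \<beta> m f x) * exp (- a * norm x powr (2 * m))) powr q \<le>
          (\<kappa> * C * V * exp (- a' * norm x powr (2 * m))) powr q"
        using q by (intro powr_mono2 ptw) auto
      also have "\<dots> = (\<kappa> * C * V) powr q * exp (- (q * a') * norm x powr (2 * m))"
        unfolding powr_mult[of _ "exp _"] by (simp add: powr_def[of "exp _"] mult_ac)
      finally show "ennreal ((norm (Pproj \<beta> m f x) * exp (- a * norm x powr (2 * m))) powr q) \<le>
          ennreal ((\<kappa> * C * V) powr q) * ennreal (exp (- (q * a') * norm x powr (2 * m)))"
        by (subst ennreal_mult'[symmetric]) (auto intro: ennreal_leI)
    qed
    also have "\<dots> = ennreal ((\<kappa> * C * V) powr q) * ennreal R"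
      unfolding R_def using ab' n q by (subst nn_integral_cmult, simp, subst nn_integral_exp_norm) auto
    also have "\<dots> = ennreal (D * F powr (q / p))"
      using p by (subst ennreal_mult'[symmetric]) (auto simp: D_def V_def powr_mult powr_powr mult_ac)
    finally show "(\<integral>\<^sup>+x. ennreal (norm (Pproj \<beta> m f x) powr q) \<partial>mu \<gamma> m) \<le>
        ennreal (D * enn2real (\<integral>\<^sup>+x. ennreal (norm (f x) powr p) \<partial>mu \<alpha> m) powr (q / p))"
      unfolding F_def .
  qed
qed

section \<open>Stirling's formula and the growth of moments\<close>

text \<open>Stirling needs \<open>(j + 1/2) * ln (1 + 1 / j)\<close> up to order
  \<open>1 / j^2\<close>, where the contributions of first order cancel; hence Taylor up to the
  cube. The differences have derivatives \<open>x^2 / (1 + x)\<close> and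
  \<open>x^3 / (1 + x)\<close>.\<close>

lemma ln_one_plus_bounds:
  fixes u :: real
  assumes "u \<ge> 0"
  shows "u - u\<^sup>2 / 2 \<le> ln (1 + u)" "ln (1 + u) \<le> u - u\<^sup>2 / 2 + u ^ 3 / 3"
proof -
  have "(\<lambda>v. ln (1 + v) - v + v\<^sup>2 / 2) 0 \<le> (\<lambda>v. ln (1 + v) - v + v\<^sup>2 / 2) u"
  proof (rule DERIV_nonneg_imp_nondecreasing[OF assms])
    fix x :: real assume x: "0 \<le> x" "x \<le> u"
    have "((\<lambda>v. ln (1 + v) - v + v\<^sup>2 / 2) has_real_derivative (1 / (1 + x) - 1 + x)) (at x)"
      using x by (auto intro!: derivative_eq_intros)
    also have "1 / (1 + x) - 1 + x = x\<^sup>2 / (1 + x)" using x by (simp add: field_simps power2_eq_square)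
    finally show "\<exists>y. ((\<lambda>v. ln (1 + v) - v + v\<^sup>2 / 2) has_real_derivative y) (at x) \<and> 0 \<le> y"
      using x by (intro exI[of _ "x\<^sup>2 / (1 + x)"] conjI) auto
  qed
  thus "u - u\<^sup>2 / 2 \<le> ln (1 + u)" by simp
  have "(\<lambda>v. v - v\<^sup>2 / 2 + v ^ 3 / 3 - ln (1 + v)) 0 \<le> (\<lambda>v. v - v\<^sup>2 / 2 + v ^ 3 / 3 - ln (1 + v)) u"
  proof (rule DERIV_nonneg_imp_nondecreasing[OF assms])
    fix x :: real assume x: "0 \<le> x" "x \<le> u"
    have "((\<lambda>v. v - v\<^sup>2 / 2 + v ^ 3 / 3 - ln (1 + v)) has_real_derivative (1 - x + x\<^sup>2 - 1 / (1 + x))) (at x)"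
      using x by (auto intro!: derivative_eq_intros)
    also have "1 - x + x\<^sup>2 - 1 / (1 + x) = x ^ 3 / (1 + x)"
      using x by (simp add: field_simps power2_eq_square power3_eq_cube)
    finally show "\<exists>y. ((\<lambda>v. v - v\<^sup>2 / 2 + v ^ 3 / 3 - ln (1 + v)) has_real_derivative y) (at x) \<and> 0 \<le> y"
      using x by (intro exI[of _ "x ^ 3 / (1 + x)"] conjI) auto
  qed
  thus "ln (1 + u) \<le> u - u\<^sup>2 / 2 + u ^ 3 / 3" by simp
qed

text \<open>Increments of the error are at most \<open>1 / j^2\<close>, which telescopes under
  \<open>2 * (1 / j - 1 / (j + 1))\<close>. The error is 1 at \<open>j = 1\<close>, so it stays
  within 3.\<close>

lemma ln_fact_Stirling:
  assumes "j \<ge> 1"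
  shows "\<bar>ln (fact j) - ((real j + 1 / 2) * ln (real j) - real j)\<bar> \<le> 3"
proof -
  define a where "a j = ln (fact j) - ((real j + 1 / 2) * ln (real j) - real j)" for j
  have step: "\<bar>a (Suc j) - a j\<bar> \<le> 1 / (real j)\<^sup>2" if j: "j \<ge> 1" for j
  proof -
    define u where "u = 1 / real j"
    have u: "0 < u" "u \<le> 1" "real j = 1 / u" using j by (auto simp: u_def)
    have l: "ln (real (Suc j)) = ln (real j) + ln (1 + u)"
    proof -
      have "real (Suc j) = real j * (1 + u)" using j by (simp add: u_def distrib_left)
      thus ?thesis using j u(1) by (subst ln_mult_pos[symmetric]) auto
    qed
    have "ln (fact (Suc j)) = ln (real (Suc j)) + ln (fact j)"
      by (subst ln_mult_pos[symmetric]) (auto simp: fact_Suc simp del: of_nat_Suc)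
    hence eq: "a (Suc j) - a j = 1 - (1 / u + 1 / 2) * ln (1 + u)"
      unfolding a_def l u(3)[symmetric] by (simp add: algebra_simps)
    have lo: "(1 / u + 1 / 2) * (u - u\<^sup>2 / 2) \<le> (1 / u + 1 / 2) * ln (1 + u)"
      using u(1) by (intro mult_left_mono ln_one_plus_bounds) auto
    have up: "(1 / u + 1 / 2) * ln (1 + u) \<le> (1 / u + 1 / 2) * (u - u\<^sup>2 / 2 + u ^ 3 / 3)"
      using u(1) by (intro mult_left_mono ln_one_plus_bounds) auto
    have lo': "(1 / u + 1 / 2) * (u - u\<^sup>2 / 2) = 1 - u\<^sup>2 / 4"
      using u(1) by (simp add: field_simps power2_eq_square)
    have up': "(1 / u + 1 / 2) * (u - u\<^sup>2 / 2 + u ^ 3 / 3) = 1 + u\<^sup>2 / 12 + u ^ 3 / 6"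
      using u(1) by (simp add: field_simps power2_eq_square power3_eq_cube)
    have "u ^ 3 \<le> u\<^sup>2" using u(1,2) by (intro power_decreasing) auto
    moreover have "\<bar>1 - Z\<bar> \<le> U" if "1 - U / 4 \<le> Z" "Z \<le> 1 + U / 12 + V / 6" "V \<le> U" "0 \<le> U" for Z U V :: real
      using that by linarith
    ultimately have "\<bar>a (Suc j) - a j\<bar> \<le> u\<^sup>2"
      unfolding eq using lo[unfolded lo'] up[unfolded up'] by simp
    thus ?thesis by (simp add: u_def power_divide)
  qed
  have "\<bar>a j - 1\<bar> \<le> 2 * (1 - 1 / real j)"
    using assms
  proof (induction j rule: nat_induct_at_least)
    case base
    show ?case by (simp add: a_def)
  next
    case (Suc j)
    have "1 / (real j)\<^sup>2 \<le> 2 * (1 / real j - 1 / real (Suc j))"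
    proof -
      have r: "real j \<ge> 1" using Suc.hyps by simp
      have "1 / (real j)\<^sup>2 = 2 / (real j * (real j + real j))" by (simp add: power2_eq_square)
      also have "\<dots> \<le> 2 / (real j * (real j + 1))"
        using r by (intro divide_left_mono mult_left_mono) auto
      also have "\<dots> = 2 * (1 / real j - 1 / real (Suc j))" using r by (simp add: field_simps)
      finally show ?thesis .
    qed
    moreover have "\<bar>y - 1\<bar> \<le> 2 * (1 - r)"
      if "s \<le> 2 * (q - r)" "\<bar>y - x\<bar> \<le> s" "\<bar>x - 1\<bar> \<le> 2 * (1 - q)" for x y q r s :: real
      using that unfolding right_diff_distrib by linarith
    ultimately show ?case using step[OF Suc.hyps] Suc.IH by blast
  qed
  moreover have "1 / real j \<ge> 0" by simp
  moreover have "\<bar>y\<bar> \<le> 3" if "\<bar>y - 1\<bar> \<le> 2 * (1 - r)" "r \<ge> 0" for y r :: real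
    using that unfolding right_diff_distrib by linarith
  ultimately have "\<bar>a j\<bar> \<le> 3" by blast
  thus ?thesis unfolding a_def .
qed

text \<open>Log-convexity ties the value at \<open>x\<close> to the factorial of its integer part
  \<open>j\<close>. The error 3 of the factorial case and several corrections, each bounded by a
  small constant, fit generously into 10.\<close>

lemma ln_Gamma_Stirling:
  fixes x :: real
  assumes x: "x \<ge> 1"
  shows "\<bar>ln (Gamma (x + 1)) - (x * ln x - x + ln x / 2)\<bar> \<le> 10"
proof -
  define j where "j = nat \<lfloor>x\<rfloor>"
  define f where "f = x - real j"
  have j: "j \<ge> 1" "real j \<le> x" "x \<le> real j + 1" using x unfolding j_def by linarith+
  have f: "0 \<le> f" "f \<le> 1" "x = real j + f" using j by (auto simp: f_def)
  have rj: "real j \<ge> 1" using j by simp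
  have G: "Gamma (real j + 1) = fact j" by (simp add: Gamma_fact add.commute)
  have "Gamma (real j + 1 + f) \<le> Gamma (real j + 1) * (real j + 1) powr f"
    using f by (intro Gamma_add_le_unit) auto
  hence "ln (Gamma (x + 1)) \<le> ln (fact j * (real j + 1) powr f)"
    using f Gamma_real_pos[of "x + 1"] x unfolding G by (subst ln_le_cancel_iff) (auto simp: algebra_simps)
  also have "\<dots> = ln (fact j) + f * ln (real j + 1)" by (simp add: ln_mult)
  finally have up: "ln (Gamma (x + 1)) \<le> ln (fact j) + f * ln (real j + 1)" .
  have "Gamma (real j + 1) * (real j + 1) powr f \<le> Gamma (real j + 1 + f) * (1 + f)"
    using f by (intro Gamma_add_ge') auto
  also have "\<dots> \<le> Gamma (real j + 1 + f) * 2"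
    using f by (intro mult_left_mono less_imp_le[OF Gamma_real_pos]) auto
  finally have "ln (fact j * (real j + 1) powr f) \<le> ln (Gamma (x + 1) * 2)"
    using f Gamma_real_pos[of "x + 1"] x unfolding G by (subst ln_le_cancel_iff) (auto simp: algebra_simps)
  also have "\<dots> = ln (Gamma (x + 1)) + ln 2"
    using less_imp_neq[OF Gamma_real_pos[of "x + 1"]] x by (subst ln_mult) auto
  finally have lo: "ln (fact j) + f * ln (real j + 1) \<le> ln (Gamma (x + 1)) + ln 2" by (simp add: ln_mult)
  have l2: "ln 2 \<le> (1::real)" using ln_le_minus_one[of "2::real"] by simp
  have e1: "ln x = ln (real j) + ln (1 + f / real j)"
  proof -
    have "x = real j * (1 + f / real j)" using rj f(3) by (simp add: distrib_left)
    thus ?thesis using rj f by (subst ln_mult_pos[symmetric]) (auto simp: add_pos_nonneg)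
  qed
  have b1: "0 \<le> ln (1 + f / real j)" "ln (1 + f / real j) \<le> f / real j"
    using rj f by (auto intro!: ln_ge_zero ln_add_one_self_le_self)
  have e2: "ln (real j + 1) = ln x + ln ((real j + 1) / x)"
    using x by (subst ln_mult_pos[symmetric]) auto
  have "(real j + 1) / x \<le> 2" using x j rj by (simp add: field_simps)
  hence "ln ((real j + 1) / x) \<le> ln 2" using x rj by (subst ln_le_cancel_iff) (auto simp: add_pos_nonneg)
  hence b2: "ln ((real j + 1) / x) \<le> 1" using l2 by linarith
  have b2': "0 \<le> ln ((real j + 1) / x)"
    using x j by (intro ln_ge_zero) (simp add: field_simps)
  have c1: "(real j + 1 / 2) * ln (1 + f / real j) \<le> (real j + 1 / 2) * (f / real j)"
    using b1 by (intro mult_left_mono) auto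
  have c1': "(real j + 1 / 2) * (f / real j) \<le> 3 / 2"
  proof -
    have "(real j + 1 / 2) * (f / real j) = f + f / (2 * real j)" using rj by (simp add: field_simps)
    moreover have "f / (2 * real j) \<le> 1 / 2" using rj f by (simp add: field_simps)
    ultimately show ?thesis using f by linarith
  qed
  have c1'': "0 \<le> (real j + 1 / 2) * ln (1 + f / real j)" using b1 by simp
  have c2: "0 \<le> f * ln ((real j + 1) / x)" "f * ln ((real j + 1) / x) \<le> 1"
    using f b2 b2' by (auto intro: mult_le_one)
  have "x * ln x - x + ln x / 2 = (real j + 1 / 2) * ln x + f * ln x - real j - f"
    unfolding f(3) by (simp add: algebra_simps)
  also have "(real j + 1 / 2) * ln x = (real j + 1 / 2) * ln (real j) + (real j + 1 / 2) * ln (1 + f / real j)"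
    unfolding e1 by (rule distrib_left)
  finally have "x * ln x - x + ln x / 2 = ((real j + 1 / 2) * ln (real j) - real j) +
      (real j + 1 / 2) * ln (1 + f / real j) + f * ln x - f" by simp
  moreover have "f * ln (real j + 1) = f * ln x + f * ln ((real j + 1) / x)"
    unfolding e2 by (rule distrib_left)
  ultimately show ?thesis
    using up lo l2 ln_fact_Stirling[OF j(1)] c1 c1' c1'' c2 f by linarith
qed

lemma ln_Gamma_shift:
  fixes d :: real
  assumes d: "d \<ge> 0"
  shows "\<exists>C. \<forall>x\<ge>1. \<bar>ln (Gamma (x + d + 1)) - ln (Gamma (x + 1)) - d * ln x\<bar> \<le> C"
proof -
  have "\<bar>ln (Gamma (x + d + 1)) - ln (Gamma (x + 1)) - d * ln x\<bar> \<le> d * ln (1 + d) + ln (1 + d) + d"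
    if x: "x \<ge> 1" for x
  proof -
    have p: "Gamma (x + 1) > 0" "Gamma (x + d + 1) > 0" using x d by (auto intro!: Gamma_real_pos)
    note ne = less_imp_neq[OF p(1)] less_imp_neq[OF p(2)]
    have "Gamma (x + 1 + d) \<le> Gamma (x + 1) * (x + 1) powr d * (1 + d) powr d"
      using x d by (intro Gamma_add_le') auto
    hence "ln (Gamma (x + d + 1)) \<le> ln (Gamma (x + 1) * (x + 1) powr d * (1 + d) powr d)"
      using p x d by (subst ln_le_cancel_iff) (auto simp: algebra_simps)
    also have "\<dots> = ln (Gamma (x + 1)) + d * ln (x + 1) + d * ln (1 + d)"
      using ne x d by (simp add: ln_mult)
    finally have up: "ln (Gamma (x + d + 1)) \<le> ln (Gamma (x + 1)) + d * ln (x + 1) + d * ln (1 + d)" .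
    have "Gamma (x + 1) * (x + 1) powr d \<le> Gamma (x + 1 + d) * (1 + d)"
      using x d by (intro Gamma_add_ge') auto
    hence "Gamma (x + 1) * (x + 1) powr d \<le> Gamma (x + d + 1) * (1 + d)" by (simp add: add_ac)
    hence "ln (Gamma (x + 1) * (x + 1) powr d) \<le> ln (Gamma (x + d + 1) * (1 + d))"
      using p x d by (subst ln_le_cancel_iff) auto
    hence lo: "ln (Gamma (x + 1)) + d * ln (x + 1) \<le> ln (Gamma (x + d + 1)) + ln (1 + d)"
      using ne x d by (simp add: ln_mult)
    have "ln (x + 1) = ln x + ln (1 + 1 / x)"
    proof -
      have "x + 1 = x * (1 + 1 / x)" using x by (simp add: distrib_left)
      thus ?thesis using x by (subst ln_mult_pos[symmetric]) (auto simp: add_pos_nonneg)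
    qed
    moreover have "0 \<le> ln (1 + 1 / x)" "ln (1 + 1 / x) \<le> 1 / x"
      using x by (auto intro!: ln_ge_zero ln_add_one_self_le_self)
    moreover have "1 / x \<le> 1" using x by simp
    ultimately have "ln x \<le> ln (x + 1)" "ln (x + 1) \<le> ln x + 1" by linarith+
    hence "d * ln x \<le> d * ln (x + 1)" "d * ln (x + 1) \<le> d * (ln x + 1)" using d by (auto intro: mult_left_mono)
    moreover have "d * (ln x + 1) = d * ln x + d" by (simp add: algebra_simps)
    moreover have "0 \<le> ln (1 + d)" "0 \<le> d * ln (1 + d)" using d by auto
    ultimately show ?thesis using up lo d by linarith
  qed
  thus ?thesis by blast
qed

text \<open>Expresses Gamma at an affine argument through \<open>ln x\<close>, so that the three
  Gamma factors of a moment can be added in one variable.\<close>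

lemma ln_Gamma_affine:
  fixes r d :: real
  assumes r: "r > 0" and d: "d \<ge> 0"
  shows "\<exists>C. \<forall>x. x \<ge> 1 \<longrightarrow> r * x \<ge> 1 \<longrightarrow>
    \<bar>ln (Gamma (r * x + d + 1)) - (r * x * ln x + x * (r * ln r - r) + (d + 1 / 2) * ln x)\<bar> \<le> C"
proof -
  obtain C where C: "\<And>x. x \<ge> 1 \<Longrightarrow> \<bar>ln (Gamma (x + d + 1)) - ln (Gamma (x + 1)) - d * ln x\<bar> \<le> C"
    using ln_Gamma_shift[OF d] by blast
  have "\<bar>ln (Gamma (r * x + d + 1)) - (r * x * ln x + x * (r * ln r - r) + (d + 1 / 2) * ln x)\<bar> \<le>
      C + 10 + \<bar>(d + 1 / 2) * ln r\<bar>" if x: "x \<ge> 1" "r * x \<ge> 1" for x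
  proof -
    have l: "ln (r * x) = ln r + ln x" using r x by (simp add: ln_mult)
    have "r * x * ln (r * x) - r * x + ln (r * x) / 2 + d * ln (r * x) =
        (r * x * ln x + x * (r * ln r - r) + (d + 1 / 2) * ln x) + (d + 1 / 2) * ln r"
      unfolding l by (simp add: algebra_simps)
    thus ?thesis using C[OF x(2)] ln_Gamma_Stirling[OF x(2)] by linarith
  qed
  thus ?thesis by blast
qed

text \<open>With \<open>x = q k / 2\<close>, the \<open>x ln x\<close> terms of
  \<open>Gamma (x + 1)^d\<close> and \<open>Gamma (D + 1)\<close> cancel and
  \<open>Gamma (D / m + 1)\<close> leaves \<open>(d / m) x ln x\<close>; the multiples of
  \<open>ln x\<close> add up to \<open>d / 2 + n / m - n\<close>. Division by \<open>q\<close>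
  isolates the dependence on \<open>q\<close> and \<open>c\<close>: the middle line depends on
  \<open>k\<close>, \<open>d\<close> and \<open>m\<close> only.\<close>

lemma moment_asymp:
  fixes A :: "'n::finite set"
  assumes A: "A \<noteq> {}" and m: "1 < m" and q: "q > 0" and c: "c > 0"
  defines "d \<equiv> real (card A)" and "n \<equiv> real CARD('n)"
  shows "\<exists>C k0. \<forall>k\<ge>k0. \<bar>ln (moment (\<lambda>i. if i \<in> A then k else 0) m q c) / q -
    (d * real k / (2 * m) * (ln q - ln c) +
     real k / 2 * (d / m * ln (real k / 2) + d / m * ln (d / m) - d / m - d * ln d) +
     (d / 2 + n / m - n) / q * ln (real k))\<bar> \<le> C"
proof -
  have d: "d \<ge> 1" using A by (simp add: d_def Suc_le_eq card_gt_0_iff)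
  have n: "n \<ge> 1" by (simp add: n_def Suc_le_eq)
  have dm: "d / m > 0" using d m by simp
  obtain C1 where C1: "\<And>x. x \<ge> 1 \<Longrightarrow> d / m * x \<ge> 1 \<Longrightarrow> \<bar>ln (Gamma (d / m * x + n / m + 1)) -
      (d / m * x * ln x + x * (d / m * ln (d / m) - d / m) + (n / m + 1 / 2) * ln x)\<bar> \<le> C1"
    using ln_Gamma_affine[OF dm, of "n / m"] n m by auto
  obtain C2 where C2: "\<And>x. x \<ge> 1 \<Longrightarrow> d * x \<ge> 1 \<Longrightarrow> \<bar>ln (Gamma (d * x + n + 1)) -
      (d * x * ln x + x * (d * ln d - d) + (n + 1 / 2) * ln x)\<bar> \<le> C2"
    using ln_Gamma_affine[of d n] n d by auto
  define e where "e = d / 2 + n / m - n"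
  define C where "C = n * ln pi + 10 * d + C1 + C2 + \<bar>n / m * ln c\<bar> + \<bar>e * ln (q / 2)\<bar>"
  define k0 where "k0 = nat \<lceil>max (2 / q) (2 * m / (d * q))\<rceil> + 1"
  have "\<bar>ln (moment (\<lambda>i. if i \<in> A then k else 0) m q c) / q -
    (d * real k / (2 * m) * (ln q - ln c) +
     real k / 2 * (d / m * ln (real k / 2) + d / m * ln (d / m) - d / m - d * ln d) + e / q * ln (real k))\<bar> \<le> C / q"
    if k: "k \<ge> k0" for k
  proof -
    define x where "x = q * real k / 2"
    have k1: "real k \<ge> 1" "real k \<ge> 2 / q" "real k \<ge> 2 * m / (d * q)"
      using k unfolding k0_def by linarith+
    have x: "x \<ge> 1" using k1(2) q by (simp add: x_def field_simps)
    have x': "d / m * x \<ge> 1" using k1(3) q d m by (simp add: x_def field_simps)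
    have x'': "d * x \<ge> 1" using d x mult_mono[of 1 d 1 x] by simp
    \<comment> \<open>\<open>ln x\<close> is split in two ways. In the power term the factor
      \<open>q / 2\<close> only gives a bounded error; in \<open>x ln x\<close> it matters, and
      \<open>ln q\<close> has to remain explicit.\<close>
    have lx: "ln x = ln (q / 2) + ln (real k)"
      using q k1 unfolding x_def by (subst ln_mult_pos[symmetric]) auto
    have lx': "ln x = ln q + ln (real k / 2)"
      using q k1 unfolding x_def by (subst ln_mult_pos[symmetric]) auto
    define D where "D = d * x + n"
    have sum: "real (\<Sum>i\<in>UNIV. if i \<in> A then k else 0) = d * real k"
      by (simp add: d_def sum.If_cases)
    have D: "q * real (\<Sum>i\<in>UNIV. if i \<in> A then k else 0) / 2 + real CARD('n) = D"
      unfolding sum by (simp add: D_def x_def n_def)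
    have pr: "(\<Prod>i\<in>UNIV. Gamma (q * real (if i \<in> A then k else 0) / 2 + 1)) = Gamma (x + 1) ^ card A"
    proof -
      have "(\<Prod>i\<in>UNIV. Gamma (q * real (if i \<in> A then k else 0) / 2 + 1)) = (\<Prod>i\<in>UNIV. if i \<in> A then Gamma (x + 1) else 1)"
        by (intro prod.cong) (auto simp: x_def)
      thus ?thesis by (simp add: prod.If_cases)
    qed
    have D0: "D > 0" using x'' n by (simp add: D_def)
    have G: "Gamma (x + 1) > 0" "Gamma (D / m + 1) > 0" "Gamma (D + 1) > 0"
      using x D0 m by (auto intro!: Gamma_real_pos add_pos_pos divide_pos_pos)
    note ne = less_imp_neq[OF G(1)] less_imp_neq[OF G(2)] less_imp_neq[OF G(3)]
    have M: "ln (moment (\<lambda>i. if i \<in> A then k else 0) m q c) =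
        n * ln pi + d * ln (Gamma (x + 1)) + (- (D / m) * ln c + ln (Gamma (D / m + 1)) - ln (Gamma (D + 1)))"
      unfolding moment_def Let_def D pr using ne G c
      by (simp add: ln_mult ln_div ln_realpow d_def n_def)
    have Dm: "D / m = d / m * x + n / m" by (simp add: D_def add_divide_distrib)
    have s1: "\<bar>ln (Gamma (D / m + 1)) - (d / m * x * ln x + x * (d / m * ln (d / m) - d / m) + (n / m + 1 / 2) * ln x)\<bar> \<le> C1"
      using C1[OF x x'] unfolding Dm .
    have s2: "\<bar>ln (Gamma (D + 1)) - (d * x * ln x + x * (d * ln d - d) + (n + 1 / 2) * ln x)\<bar> \<le> C2"
      using C2[OF x x''] unfolding D_def .
    have s3: "\<bar>d * ln (Gamma (x + 1)) - d * (x * ln x - x + ln x / 2)\<bar> \<le> d * 10"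
      using mult_left_mono[OF ln_Gamma_Stirling[OF x], of d] d
      by (simp add: right_diff_distrib[symmetric] abs_mult)
    define main where "main = d / m * x * ln x + x * (d / m * ln (d / m) - d / m - d * ln d) - d / m * x * ln c + e * ln (real k)"
    have id: "n * ln pi + d * (x * ln x - x + ln x / 2) + (- (D / m) * ln c +
        (d / m * x * ln x + x * (d / m * ln (d / m) - d / m) + (n / m + 1 / 2) * ln x) -
        (d * x * ln x + x * (d * ln d - d) + (n + 1 / 2) * ln x)) = main + n * ln pi - n / m * ln c + e * ln (q / 2)"
    proof -
      have "e * ln x = e * ln (q / 2) + e * ln (real k)" unfolding lx by (rule distrib_left)
      moreover have "e * ln x = d / 2 * ln x + n / m * ln x - n * ln x" unfolding e_def by (simp add: algebra_simps)
      ultimately show ?thesis unfolding main_def Dm by (simp add: algebra_simps)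
    qed
    have "n * ln pi \<ge> 0" using n pi_gt3 by simp
    have abstract: "\<bar>X - M'\<bar> \<le> L + c3 + c1 + c2 + \<bar>u\<bar> + \<bar>v\<bar>"
      if "\<bar>g1 - a1\<bar> \<le> c1" "\<bar>g2 - a2\<bar> \<le> c2" "\<bar>g3 - a3\<bar> \<le> c3" "X = L + g3 + (U + g1 - g2)"
        "L + a3 + (U + a1 - a2) = M' + L - u + v" "L \<ge> 0" for X M' L U u v g1 g2 g3 a1 a2 a3 c1 c2 c3 :: real
      using that by linarith
    have "\<bar>ln (moment (\<lambda>i. if i \<in> A then k else 0) m q c) - main\<bar> \<le> C"
      using abstract[OF s1 s2 s3 M id \<open>n * ln pi \<ge> 0\<close>] by (simp add: C_def mult.commute)
    hence "\<bar>ln (moment (\<lambda>i. if i \<in> A then k else 0) m q c) - main\<bar> / q \<le> C / q"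
      using q by (intro divide_right_mono) auto
    moreover have "main / q = d * real k / (2 * m) * (ln q - ln c) +
     real k / 2 * (d / m * ln (real k / 2) + d / m * ln (d / m) - d / m - d * ln d) + e / q * ln (real k)"
    proof -
      define Z where "Z = d / m * (ln q - ln c) + (d / m * ln (real k / 2) + d / m * ln (d / m) - d / m - d * ln d)"
      have "main = x * Z + e * ln (real k)"
      proof -
        have "a * x * (lq + lk) + x * (b1 - b2 - b3) - a * x * lc + E = x * (a * (lq - lc) + (a * lk + b1 - b2 - b3)) + E"
          for a b1 b2 b3 lq lk lc E :: real by (simp add: algebra_simps)
        thus ?thesis unfolding main_def Z_def lx' .
      qed
      also have "x = q * (real k / 2)" by (simp add: x_def)
      finally have "main / q = real k / 2 * Z + e / q * ln (real k)"
        using q by (simp add: add_divide_distrib)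
      also have "real k / 2 * Z = real k / 2 * (d / m * (ln q - ln c)) +
          real k / 2 * (d / m * ln (real k / 2) + d / m * ln (d / m) - d / m - d * ln d)"
        unfolding Z_def by (rule distrib_left)
      also have "real k / 2 * (d / m * (ln q - ln c)) = d * real k / (2 * m) * (ln q - ln c)" by (simp add: mult_ac)
      finally show ?thesis .
    qed
    ultimately show ?thesis
      unfolding abs_div_pos[OF q] diff_divide_distrib by simp
  qed
  thus ?thesis unfolding e_def by blast
qed

text \<open>The linear term decides first; only when it vanishes does boundedness say something
  about the logarithm. This gives the sharp threshold and then the endpoint condition.\<close>

lemma linear_log_bounded:
  fixes u v C :: real
  assumes "\<And>k. k \<ge> kmin \<Longrightarrow> real k * u + v * ln (real k) \<le> C"
  shows "u \<le> 0" "u = 0 \<Longrightarrow> v \<le> 0"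
proof -
  have lim: "filterlim (\<lambda>k. real k) at_top sequentially" by (rule filterlim_real_sequentially)
  show "u \<le> 0"
  proof (rule ccontr)
    assume "\<not> u \<le> 0"
    hence u: "u > 0" by simp
    have "(\<lambda>k. u + v * (ln (real k) / real k)) \<longlonglongrightarrow> u + v * 0"
      by (intro tendsto_intros lim_ln_over_n)
    hence "filterlim (\<lambda>k. (u + v * (ln (real k) / real k)) * real k) at_top sequentially"
      using u by (intro filterlim_tendsto_pos_mult_at_top[OF _ _ lim]) auto
    moreover have "eventually (\<lambda>k. (u + v * (ln (real k) / real k)) * real k = real k * u + v * ln (real k)) sequentially"
      using eventually_gt_at_top[of 0] by eventually_elim (simp add: field_simps)
    ultimately have "filterlim (\<lambda>k. real k * u + v * ln (real k)) at_top sequentially"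
      by (simp add: filterlim_cong)
    hence "eventually (\<lambda>k. real k * u + v * ln (real k) > C) sequentially"
      by (simp add: filterlim_at_top_dense)
    hence "eventually (\<lambda>k. real k * u + v * ln (real k) > C \<and> k \<ge> kmin) sequentially"
      using eventually_ge_at_top[of kmin] by eventually_elim auto
    then obtain k where "real k * u + v * ln (real k) > C" "k \<ge> kmin"
      by (auto simp: eventually_sequentially)
    thus False using assms[of k] by simp
  qed
  show "v \<le> 0" if "u = 0"
  proof (rule ccontr)
    assume "\<not> v \<le> 0"
    hence v: "v > 0" by simp
    have "filterlim (\<lambda>k. v * ln (real k)) at_top sequentially"
      using v by (intro filterlim_tendsto_pos_mult_at_top[OF tendsto_const]
          filterlim_compose[OF ln_at_top lim]) auto
    hence "eventually (\<lambda>k. v * ln (real k) > C) sequentially"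
      by (simp add: filterlim_at_top_dense)
    hence "eventually (\<lambda>k. v * ln (real k) > C \<and> k \<ge> kmin) sequentially"
      using eventually_ge_at_top[of kmin] by eventually_elim auto
    then obtain k where "v * ln (real k) > C" "k \<ge> kmin"
      by (auto simp: eventually_sequentially)
    thus False using assms[of k] that by simp
  qed
qed

section \<open>Necessity\<close>

text \<open>Truncation at radius \<open>T\<close> bounds the kernel series by a convergent numerical
  series on the support, which justifies integrating it termwise; orthogonality leaves the single
  term of degree \<open>K\<close>.\<close>

lemma Pproj_vmono:
  fixes \<nu> :: "'n::finite \<Rightarrow> nat" and w :: "real \<Rightarrow> real" and \<beta> b m T :: real
  assumes n: "CARD('n) \<ge> 2" "1 < m" "m < 2" and \<beta>: "\<beta> > 0" and b: "b > 0"
    and w [measurable]: "w \<in> borel_measurable borel"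
    and w_nonneg: "\<And>t. 0 \<le> w t" and w_le: "\<And>t. w t * exp (- \<beta> * t powr (2 * m)) \<le> exp (- b * t powr (2 * m))"
    and w_supp: "\<And>t. t > T \<Longrightarrow> w t = 0" and T: "T \<ge> 0"
  defines "K \<equiv> (\<Sum>i\<in>UNIV. \<nu> i)"
  shows "Pproj \<beta> m (\<lambda>y. vmono \<nu> y * of_real (w (norm y))) x =
    of_real (m * \<beta> powr (real CARD('n) / m) / pi ^ CARD('n) * kcoeff CARD('n) m K * (\<beta> powr (1 / m)) ^ K *
      (fact K / mfact \<nu>) * (\<integral>y. (norm (vmono \<nu> y))\<^sup>2 * (w (norm y) * exp (- \<beta> * norm y powr (2 * m))) \<partial>lborel)) * vmono \<nu> x"
proof -
  define N where "N = CARD('n)"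
  define \<kappa> where "\<kappa> = m * \<beta> powr (real N / m) / pi ^ N"
  define B where "B = \<beta> powr (1 / m)"
  have B: "B > 0" using \<beta> by (simp add: B_def)
  have m: "m > 0" using n by simp
  define v where "v t = w t * exp (- \<beta> * t powr (2 * m))" for t
  have v: "v \<in> borel_measurable borel" "\<And>t. 0 \<le> v t" "\<And>t. v t \<le> exp (- b * t powr (2 * m))"
    using w_nonneg w_le unfolding v_def by auto
  note [measurable] = v(1)
  have v_supp: "v t = 0" if "t > T" for t using w_supp[OF that] by (simp add: v_def)
  have kpos: "kcoeff N m k > 0" for k using n by (intro kcoeff_pos) (auto simp: N_def)
  define I where "I = (\<integral>y. (norm (vmono \<nu> y))\<^sup>2 * v (norm y) \<partial>lborel)"
  define g where "g k y = of_real (kcoeff N m k * B ^ k) * (vmono \<nu> y * cinner x y ^ k * of_real (v (norm y)))" for k and y :: "complex ^ 'n"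
  have g_int: "integrable lborel (g k)" for k
    unfolding g_def[abs_def] by (intro integrable_mult_right integrable_vmono_cinner[OF v b m])
  define R where "R = B * (norm x * T)"
  have R: "R \<ge> 0" using B T by (simp add: R_def)
  have sR: "summable (\<lambda>k. kcoeff N m k * R ^ k)"
    using n R unfolding N_def by (intro summable_kcoeff) auto
  have g_le: "norm (g k y) \<le> kcoeff N m k * R ^ k * (norm (vmono \<nu> y) * v (norm y))" for k y
  proof (cases "norm y > T")
    case True
    thus ?thesis by (simp add: g_def v_supp)
  next
    case False
    have "norm (cinner x y) \<le> norm x * T"
      using norm_cinner_le[of x y] False by (meson mult_left_mono norm_ge_zero not_less order_trans)
    hence "norm (cinner x y) ^ k \<le> (norm x * T) ^ k" by (intro power_mono) auto
    hence "kcoeff N m k * B ^ k * (norm (vmono \<nu> y) * v (norm y)) * norm (cinner x y) ^ k \<le>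
        kcoeff N m k * B ^ k * (norm (vmono \<nu> y) * v (norm y)) * (norm x * T) ^ k"
      using kpos[of k] B v(2)[of "norm y"] by (intro mult_left_mono) auto
    thus ?thesis
      using kpos[of k] B v(2)[of "norm y"] by (simp add: g_def R_def norm_mult norm_power power_mult_distrib mult_ac)
  qed
  have m1: "integrable lborel (\<lambda>y. norm (vmono \<nu> y) * v (norm y))"
  proof -
    have "(\<integral>\<^sup>+y. ennreal (norm (norm (vmono \<nu> y) * v (norm y))) \<partial>lborel) \<le>
        (\<integral>\<^sup>+y. ennreal (norm (vmono \<nu> y) powr 1 * exp (- b * norm y powr (2 * m))) \<partial>lborel)"
      using v by (intro nn_integral_mono ennreal_leI) (auto intro!: mult_left_mono)
    also have "\<dots> < \<infinity>" using b m by (subst nn_integral_vmono) auto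
    finally show ?thesis by (intro integrableI_bounded) auto
  qed
  define M where "M = (\<integral>y. norm (vmono \<nu> y) * v (norm y) \<partial>lborel)"
  have summ: "summable (\<lambda>k. norm (g k y))" for y
    by (rule summable_comparison_test'[where N = 0, OF summable_mult2[OF sR]]) (use g_le[of _ y] in auto)
  have sumi: "summable (\<lambda>k. \<integral>y. norm (g k y) \<partial>lborel)"
  proof (rule summable_comparison_test'[where N = 0])
    show "summable (\<lambda>k. kcoeff N m k * R ^ k * M)" by (rule summable_mult2[OF sR])
    fix k
    have "(\<integral>y. norm (g k y) \<partial>lborel) \<le> (\<integral>y. kcoeff N m k * R ^ k * (norm (vmono \<nu> y) * v (norm y)) \<partial>lborel)"
      by (intro integral_mono integrable_norm g_int integrable_mult_right m1 g_le)
    also have "\<dots> = kcoeff N m k * R ^ k * M" by (simp add: M_def)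
    finally show "norm (\<integral>y. norm (g k y) \<partial>lborel) \<le> kcoeff N m k * R ^ k * M" by simp
  qed
  have fm: "(\<lambda>y. vmono \<nu> y * of_real (w (norm y))) \<in> borel_measurable borel" by measurable
  have "Pproj \<beta> m (\<lambda>y. vmono \<nu> y * of_real (w (norm y))) x =
      (\<integral>y. of_real \<kappa> * (\<Sum>k. g k y) \<partial>lborel)"
    unfolding Pproj_eq_lborel[OF fm]
  proof (rule Bochner_Integration.integral_cong)
    fix y :: "complex ^ 'n"
    have "summable (\<lambda>k. norm (of_real (kcoeff N m k) * (of_real B * cinner x y) ^ k))"
      using summable_kcoeff[of N m "B * norm (cinner x y)"] n B kpos[THEN less_imp_le]
      by (simp add: norm_mult norm_power N_def)
    hence s: "summable (\<lambda>k. of_real (kcoeff N m k) * (of_real B * cinner x y) ^ k)" by (rule summable_norm_cancel)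
    have "exp (- \<beta> * norm y powr (2 * m)) *\<^sub>R (vmono \<nu> y * of_real (w (norm y)) * bergK \<beta> m x y) =
        of_real \<kappa> * ((vmono \<nu> y * of_real (v (norm y))) * kfun N m (of_real B * cinner x y))"
      unfolding bergK_eq_kfun N_def[symmetric] B_def[symmetric] \<kappa>_def[symmetric] v_def
      by (simp add: scaleR_conv_of_real mult_ac)
    also have "(vmono \<nu> y * of_real (v (norm y))) * kfun N m (of_real B * cinner x y) = (\<Sum>k. g k y)"
      unfolding kfun_def g_def suminf_mult[OF s, symmetric]
      by (intro suminf_cong) (simp add: power_mult_distrib mult_ac)
    finally show "exp (- \<beta> * norm y powr (2 * m)) *\<^sub>R (vmono \<nu> y * of_real (w (norm y)) * bergK \<beta> m x y) =
        of_real \<kappa> * (\<Sum>k. g k y)" .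
  qed simp
  also have "\<dots> = of_real \<kappa> * (\<integral>y. (\<Sum>k. g k y) \<partial>lborel)" by simp
  also have "(\<integral>y. (\<Sum>k. g k y) \<partial>lborel) = (\<Sum>k. \<integral>y. g k y \<partial>lborel)"
    by (rule integral_suminf[OF g_int _ sumi]) (simp add: summ)
  also have "\<dots> = (\<Sum>k. if k = K then of_real (kcoeff N m K * B ^ K * (fact K / mfact \<nu> * I)) * vmono \<nu> x else 0)"
    unfolding g_def K_def I_def
    by (intro suminf_cong) (simp add: integral_vmono_cinner[OF v b m])
  also have "\<dots> = of_real (kcoeff N m K * B ^ K * (fact K / mfact \<nu> * I)) * vmono \<nu> x"
    using sums_single[of K "\<lambda>_. of_real (kcoeff N m K * B ^ K * (fact K / mfact \<nu> * I)) * vmono \<nu> x"]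
    by (simp add: sums_iff)
  finally show ?thesis
    unfolding \<kappa>_def N_def B_def I_def v_def by (simp add: mult_ac)
qed

text \<open>All Gamma functions and factorials of the kernel coefficient and of the second moment
  cancel. At \<open>b = \<beta>\<close> the value is 1, which is the reproducing property for
  monomials.\<close>

lemma projection_coefficient:
  fixes \<nu> :: "'n::finite \<Rightarrow> nat"
  assumes m: "m > 0" and \<beta>: "\<beta> > 0" and b: "b > 0"
  defines "K \<equiv> (\<Sum>i\<in>UNIV. \<nu> i)"
  shows "m * \<beta> powr (real CARD('n) / m) / pi ^ CARD('n) * kcoeff CARD('n) m K * (\<beta> powr (1 / m)) ^ K *
      (fact K / mfact \<nu>) * moment \<nu> m 2 b = (\<beta> / b) powr ((real CARD('n) + real K) / m)"
proof -
  define N where "N = real CARD('n)"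
  have N: "N \<ge> 1" by (simp add: N_def Suc_le_eq)
  define u where "u = (N + real K) / m"
  have u: "u > 0" using N m by (simp add: u_def add_pos_nonneg)
  have NK: "N + real K > 0" using N by simp
  have G1: "Gamma (u + 1) = u * Gamma u"
    using u nonpos_Ints_nonpos[of u] by (intro Gamma_plus1) auto
  have G2: "Gamma (N + real K + 1) = (N + real K) * Gamma (N + real K)"
    using NK nonpos_Ints_nonpos[of "N + real K"] by (intro Gamma_plus1) auto
  note ne = less_imp_neq[OF Gamma_real_pos[OF u]] less_imp_neq[OF Gamma_real_pos[OF NK]] less_imp_neq[OF NK]
    less_imp_neq[OF mfact_pos[of \<nu>]]
  have p: "\<beta> powr (N / m) * (\<beta> powr (1 / m)) ^ K = \<beta> powr u"
    using powr_nth_power[OF \<beta>, of K m] by (simp add: u_def add_divide_distrib powr_add)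
  have b': "b powr (- (real K + N) / m) = 1 / b powr u"
  proof -
    have "- (real K + N) / m = - u" by (simp only: u_def minus_divide_left add.commute)
    thus ?thesis by (simp only: powr_minus_divide)
  qed
  have "m * \<beta> powr (N / m) / pi ^ CARD('n) * kcoeff CARD('n) m K * (\<beta> powr (1 / m)) ^ K *
      (fact K / mfact \<nu>) * moment \<nu> m 2 b =
      m * (\<beta> powr (N / m) * (\<beta> powr (1 / m)) ^ K) / pi ^ CARD('n) * (Gamma (N + real K) / (fact K * Gamma u)) *
      (fact K / mfact \<nu>) * (pi ^ CARD('n) * mfact \<nu> * (1 / b powr u * (u * Gamma u) / ((N + real K) * Gamma (N + real K))))"
    unfolding moment_2 K_def[symmetric] kcoeff_def N_def[symmetric] b' u_def[symmetric]
      G1[symmetric] G2[symmetric] by (simp add: u_def add.commute mult_ac)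
  also have "\<dots> = m * u / (N + real K) * (\<beta> powr u / b powr u)"
    unfolding p using ne by (simp add: mult_ac)
  also have "m * u / (N + real K) = 1" using m NK by (simp add: u_def)
  finally show ?thesis using \<beta> b unfolding N_def u_def by (simp add: powr_divide)
qed

text \<open>The truncation makes the test function admissible for every real \<open>c\<close>,
  including those for which the full function is not square integrable for
  \<open>mu \<beta> m\<close>.\<close>

lemma inLp_truncated_vmono:
  fixes \<nu> :: "'n::finite \<Rightarrow> nat"
  assumes q: "q > 0" and m: "m > 0" and T: "T \<ge> 0"
  shows "inLp (mu \<alpha> m) q (\<lambda>y. vmono \<nu> y * of_real (if norm y \<le> T then exp (- c * norm y powr (2 * m)) else 0))"
proof -
  define w where "w t = (if t \<le> T then exp (- c * t powr (2 * m)) else 0)" for t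
  have [measurable]: "w \<in> borel_measurable borel" unfolding w_def[abs_def] by measurable
  \<comment> \<open>One unit more than the exponent to be compensated: \<open>exp (L * r)\<close> is
    bounded by \<open>E\<close> on the support, and the spare \<open>exp (- r)\<close> turns the
    rest into a moment.\<close>
  define L where "L = \<bar>c * q + \<alpha>\<bar> + 1"
  define E where "E = exp (L * T powr (2 * m))"
  have fm: "(\<lambda>y. vmono \<nu> y * of_real (w (norm y))) \<in> borel_measurable borel" by measurable
  have "(\<integral>\<^sup>+y. ennreal (norm (vmono \<nu> y * of_real (w (norm y))) powr q) \<partial>mu \<alpha> m) =
      (\<integral>\<^sup>+y. ennreal ((norm (vmono \<nu> y * of_real (w (norm y))) * exp (- (\<alpha> / q) * norm y powr (2 * m))) powr q) \<partial>lborel)"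
    by (rule nn_integral_mu_powr[OF fm q])
  also have "\<dots> \<le> (\<integral>\<^sup>+y. ennreal E * ennreal (norm (vmono \<nu> y) powr q * exp (- 1 * norm y powr (2 * m))) \<partial>lborel)"
  proof (rule nn_integral_mono)
    fix y :: "complex ^ 'n"
    define r where "r = norm y powr (2 * m)"
    have "(norm (vmono \<nu> y * of_real (w (norm y))) * exp (- (\<alpha> / q) * r)) powr q \<le>
        E * (norm (vmono \<nu> y) powr q * exp (- 1 * r))"
    proof (cases "norm y \<le> T")
      case False
      thus ?thesis by (simp add: w_def E_def)
    next
      case True
      have r: "0 \<le> r" "r \<le> T powr (2 * m)" using True m by (auto simp: r_def intro!: powr_mono2)
      have "(norm (vmono \<nu> y * of_real (w (norm y))) * exp (- (\<alpha> / q) * r)) powr q =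
          norm (vmono \<nu> y) powr q * exp (- (c * q + \<alpha>) * r)"
      proof -
        have "w (norm y) = exp (- c * r)" using True by (simp add: w_def r_def)
        hence eq: "norm (vmono \<nu> y * of_real (w (norm y))) * exp (- (\<alpha> / q) * r) =
            norm (vmono \<nu> y) * exp (- c * r + - (\<alpha> / q) * r)"
          unfolding exp_add by (simp add: norm_mult)
        have "(norm (vmono \<nu> y * of_real (w (norm y))) * exp (- (\<alpha> / q) * r)) powr q =
            norm (vmono \<nu> y) powr q * exp (q * (- c * r + - (\<alpha> / q) * r))"
          unfolding eq powr_mult by (simp add: powr_def[of "exp _"])
        also have "q * (- c * r + - (\<alpha> / q) * r) = - (c * q + \<alpha>) * r"
          using q by (simp add: algebra_simps)
        finally show ?thesis .
      qed
      also have "\<dots> \<le> norm (vmono \<nu> y) powr q * (E * exp (- 1 * r))"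
      proof (rule mult_left_mono)
        have "- (c * q + \<alpha>) * r \<le> \<bar>c * q + \<alpha>\<bar> * r" using r by (intro mult_right_mono) auto
        hence "- (c * q + \<alpha>) * r + r \<le> L * r" unfolding L_def distrib_right by simp
        also have "\<dots> \<le> L * T powr (2 * m)" using r by (intro mult_left_mono) (auto simp: L_def)
        finally have "- (c * q + \<alpha>) * r \<le> L * T powr (2 * m) - 1 * r" by simp
        thus "exp (- (c * q + \<alpha>) * r) \<le> E * exp (- 1 * r)" unfolding E_def exp_add[symmetric] by simp
      qed simp
      also have "\<dots> = E * (norm (vmono \<nu> y) powr q * exp (- 1 * r))" by (simp only: mult_ac)
      finally show ?thesis .
    qed
    thus "ennreal ((norm (vmono \<nu> y * of_real (w (norm y))) * exp (- (\<alpha> / q) * norm y powr (2 * m))) powr q) \<le>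
        ennreal E * ennreal (norm (vmono \<nu> y) powr q * exp (- 1 * norm y powr (2 * m)))"
      unfolding r_def by (subst ennreal_mult'[symmetric]) (auto simp: E_def intro!: ennreal_leI)
  qed
  also have "\<dots> = ennreal E * ennreal (moment \<nu> m q 1)"
    using m q by (subst nn_integral_cmult, simp, subst nn_integral_vmono) auto
  also have "\<dots> < \<infinity>" by (simp add: ennreal_mult_less_top)
  finally show ?thesis
    using fm by (auto simp: inLp_def w_def cong: measurable_cong_sets)
qed

text \<open>The bound is applied to truncated test functions. Their norm on the right stays below
  the untruncated moment, and on the left the projection coefficient converges as the radius grows,
  dominated because \<open>\<beta> + c > 0\<close>.\<close>

lemma P_bounded_moment_le:
  fixes \<alpha> \<beta> \<gamma> p q m :: real
  assumes n: "CARD('n::finite) \<ge> 2" "1 < m" "m < 2" and \<beta>: "\<beta> > 0" and \<gamma>: "\<gamma> > 0"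
    and p: "1 \<le> p" and q: "1 \<le> q" and bd: "P_bounded TYPE('n) \<beta> m \<alpha> p \<gamma> q"
  shows "\<exists>C>0. \<forall>(\<nu> :: 'n \<Rightarrow> nat) c. c * p + \<alpha> > 0 \<longrightarrow> \<beta> + c > 0 \<longrightarrow>
    (\<beta> / (\<beta> + c)) powr ((real CARD('n) + real (\<Sum>i\<in>UNIV. \<nu> i)) / m) * moment \<nu> m q \<gamma> powr (1 / q) \<le>
      C * moment \<nu> m p (c * p + \<alpha>) powr (1 / p)"
proof -
  have m: "m > 0" using n by simp
  obtain C0 where C0: "\<And>f :: complex ^ 'n \<Rightarrow> complex. inLp (mu \<beta> m) 2 f \<Longrightarrow> inLp (mu \<alpha> m) p f \<Longrightarrow>
      Lpnorm (mu \<gamma> m) q (Pproj \<beta> m f) \<le> C0 * Lpnorm (mu \<alpha> m) p f"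
    using bd unfolding P_bounded_def by blast
  \<comment> \<open>\<open>P_bounded\<close> admits a constant of any sign; a positive one is needed
    because its logarithm is taken later.\<close>
  define C where "C = max C0 1"
  have C: "C > 0" by (simp add: C_def)
  have "(\<beta> / (\<beta> + c)) powr ((real CARD('n) + real (\<Sum>i\<in>UNIV. \<nu> i)) / m) * moment \<nu> m q \<gamma> powr (1 / q) \<le>
      C * moment \<nu> m p (c * p + \<alpha>) powr (1 / p)"
    if c: "c * p + \<alpha> > 0" "\<beta> + c > 0" for \<nu> :: "'n \<Rightarrow> nat" and c
  proof -
    define K where "K = (\<Sum>i\<in>UNIV. \<nu> i)"
    define P where "P = m * \<beta> powr (real CARD('n) / m) / pi ^ CARD('n) * kcoeff CARD('n) m K * (\<beta> powr (1 / m)) ^ K * (fact K / mfact \<nu>)"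
    have P: "P > 0" unfolding P_def using m \<beta> n kcoeff_pos[of "CARD('n)" m K] mfact_pos[of \<nu>] by simp
    define w where "w T t = (if t \<le> T then exp (- c * t powr (2 * m)) else 0)" for T t :: real
    have [measurable]: "w T \<in> borel_measurable borel" for T unfolding w_def[abs_def] by measurable
    define f where "f T y = vmono \<nu> y * of_real (w T (norm y))" for T and y :: "complex ^ 'n"
    define I where "I T = (\<integral>y. (norm (vmono \<nu> y))\<^sup>2 * (w T (norm y) * exp (- \<beta> * norm y powr (2 * m))) \<partial>lborel)" for T
    have w_le: "w T t * exp (- \<beta> * t powr (2 * m)) \<le> exp (- (\<beta> + c) * t powr (2 * m))" for T t
      by (simp add: w_def exp_add[symmetric] algebra_simps)
    have Pf: "Pproj \<beta> m (f T) x = of_real (P * I T) * vmono \<nu> x" if "T \<ge> 0" for T x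
      unfolding f_def P_def I_def K_def
      by (rule Pproj_vmono[OF n \<beta> c(2) _ _ w_le _ that]) (auto simp: w_def)
    have I: "I T \<ge> 0" for T unfolding I_def by (intro Bochner_Integration.integral_nonneg) (simp add: w_def)
    have main: "P * I T * moment \<nu> m q \<gamma> powr (1 / q) \<le> C * moment \<nu> m p (c * p + \<alpha>) powr (1 / p)" if T: "T \<ge> 0" for T
    proof -
      have fm[measurable]: "f T \<in> borel_measurable borel" unfolding f_def[abs_def] by measurable
      have "(\<integral>\<^sup>+y. ennreal (norm (f T y) powr p) \<partial>mu \<alpha> m) =
          (\<integral>\<^sup>+y. ennreal ((norm (f T y) * exp (- (\<alpha> / p) * norm y powr (2 * m))) powr p) \<partial>lborel)"
        using p by (intro nn_integral_mu_powr fm) auto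
      also have "\<dots> \<le> (\<integral>\<^sup>+y. ennreal (norm (vmono \<nu> y) powr p * exp (- (c * p + \<alpha>) * norm y powr (2 * m))) \<partial>lborel)"
        using p by (intro nn_integral_mono ennreal_leI)
          (auto simp: f_def w_def norm_mult powr_mult powr_def[of "exp _"] exp_add[symmetric] algebra_simps)
      also have "\<dots> = ennreal (moment \<nu> m p (c * p + \<alpha>))"
        using p c m by (intro nn_integral_vmono) auto
      finally have "enn2real (\<integral>\<^sup>+y. ennreal (norm (f T y) powr p) \<partial>mu \<alpha> m) \<le> enn2real (ennreal (moment \<nu> m p (c * p + \<alpha>)))"
        by (intro enn2real_mono) auto
      also have "\<dots> = moment \<nu> m p (c * p + \<alpha>)" using moment_pos[of p "c * p + \<alpha>" m \<nu>] p c m by simp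
      finally have L1: "Lpnorm (mu \<alpha> m) p (f T) \<le> moment \<nu> m p (c * p + \<alpha>) powr (1 / p)"
        unfolding Lpnorm_def using p by (intro powr_mono2) auto
      have "(\<integral>\<^sup>+y. ennreal (norm (Pproj \<beta> m (f T) y) powr q) \<partial>mu \<gamma> m) =
          (\<integral>\<^sup>+y. ennreal ((norm (Pproj \<beta> m (f T) y) * exp (- (\<gamma> / q) * norm y powr (2 * m))) powr q) \<partial>lborel)"
        using q by (intro nn_integral_mu_powr Pproj_measurable fm) auto
      also have "\<dots> = (\<integral>\<^sup>+y. ennreal ((P * I T) powr q) * ennreal (norm (vmono \<nu> y) powr q * exp (- \<gamma> * norm y powr (2 * m))) \<partial>lborel)"
      proof (rule nn_integral_cong)
        fix y :: "complex ^ 'n"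
        have "(norm (Pproj \<beta> m (f T) y) * exp (- (\<gamma> / q) * norm y powr (2 * m))) powr q =
            (P * I T) powr q * (norm (vmono \<nu> y) powr q * exp (- \<gamma> * norm y powr (2 * m)))"
          unfolding Pf[OF T] using P I[of T] q
          by (simp add: norm_mult powr_mult powr_def[of "exp _"] abs_mult)
        thus "ennreal ((norm (Pproj \<beta> m (f T) y) * exp (- (\<gamma> / q) * norm y powr (2 * m))) powr q) =
            ennreal ((P * I T) powr q) * ennreal (norm (vmono \<nu> y) powr q * exp (- \<gamma> * norm y powr (2 * m)))"
          by (simp add: ennreal_mult')
      qed
      also have "\<dots> = ennreal ((P * I T) powr q) * ennreal (moment \<nu> m q \<gamma>)"
        using q \<gamma> m by (subst nn_integral_cmult, simp, subst nn_integral_vmono) auto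
      also have "\<dots> = ennreal ((P * I T) powr q * moment \<nu> m q \<gamma>)" by (simp add: ennreal_mult')
      finally have "Lpnorm (mu \<gamma> m) q (Pproj \<beta> m (f T)) = ((P * I T) powr q * moment \<nu> m q \<gamma>) powr (1 / q)"
        unfolding Lpnorm_def using moment_pos[of q \<gamma> m \<nu>] q \<gamma> m by simp
      also have "\<dots> = P * I T * moment \<nu> m q \<gamma> powr (1 / q)"
        using P I[of T] q by (simp add: powr_mult[of "_ powr q"] powr_powr)
      finally have "P * I T * moment \<nu> m q \<gamma> powr (1 / q) \<le> C0 * Lpnorm (mu \<alpha> m) p (f T)"
        using C0[of "f T"] inLp_truncated_vmono[of 2 m T \<beta> \<nu> c] inLp_truncated_vmono[of p m T \<alpha> \<nu> c] p m T
        unfolding f_def[abs_def] w_def by simp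
      also have "\<dots> \<le> C * moment \<nu> m p (c * p + \<alpha>) powr (1 / p)"
        using L1 by (intro mult_mono) (auto simp: C_def Lpnorm_def)
      finally show ?thesis .
    qed
    have "(\<lambda>j. I (real j)) \<longlonglongrightarrow> (\<integral>y. (norm (vmono \<nu> y))\<^sup>2 * exp (- (\<beta> + c) * norm y powr (2 * m)) \<partial>lborel)"
      unfolding I_def
    proof (rule integral_dominated_convergence)
      show "integrable lborel (\<lambda>y. (norm (vmono \<nu> y))\<^sup>2 * exp (- (\<beta> + c) * norm y powr (2 * m)))"
        using integrable_vmono_square[of "\<lambda>t. exp (- (\<beta> + c) * t powr (2 * m))" "\<beta> + c" m \<nu>] c m by auto
      show "AE y in lborel. (\<lambda>j. (norm (vmono \<nu> y))\<^sup>2 * (w (real j) (norm y) * exp (- \<beta> * norm y powr (2 * m)))) \<longlonglongrightarrow>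
          (norm (vmono \<nu> y))\<^sup>2 * exp (- (\<beta> + c) * norm y powr (2 * m))"
      proof (rule AE_I2)
        fix y :: "complex ^ 'n"
        have "eventually (\<lambda>j. (norm (vmono \<nu> y))\<^sup>2 * (w (real j) (norm y) * exp (- \<beta> * norm y powr (2 * m))) =
            (norm (vmono \<nu> y))\<^sup>2 * exp (- (\<beta> + c) * norm y powr (2 * m))) sequentially"
          using eventually_ge_at_top[of "nat \<lceil>norm y\<rceil>"]
        proof eventually_elim
          fix j assume "nat \<lceil>norm y\<rceil> \<le> j"
          hence "norm y \<le> real j" by linarith
          thus "(norm (vmono \<nu> y))\<^sup>2 * (w (real j) (norm y) * exp (- \<beta> * norm y powr (2 * m))) =
              (norm (vmono \<nu> y))\<^sup>2 * exp (- (\<beta> + c) * norm y powr (2 * m))"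
            by (simp add: w_def exp_add[symmetric] algebra_simps)
        qed
        thus "(\<lambda>j. (norm (vmono \<nu> y))\<^sup>2 * (w (real j) (norm y) * exp (- \<beta> * norm y powr (2 * m)))) \<longlonglongrightarrow>
          (norm (vmono \<nu> y))\<^sup>2 * exp (- (\<beta> + c) * norm y powr (2 * m))"
          by (rule tendsto_eventually)
      qed
      show "AE y in lborel. norm ((norm (vmono \<nu> y))\<^sup>2 * (w (real j) (norm y) * exp (- \<beta> * norm y powr (2 * m)))) \<le>
          (norm (vmono \<nu> y))\<^sup>2 * exp (- (\<beta> + c) * norm y powr (2 * m))" for j
      proof (rule AE_I2)
        fix y :: "complex ^ 'n"
        have "w (real j) (norm y) \<ge> 0" by (simp add: w_def)
        thus "norm ((norm (vmono \<nu> y))\<^sup>2 * (w (real j) (norm y) * exp (- \<beta> * norm y powr (2 * m)))) \<le>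
          (norm (vmono \<nu> y))\<^sup>2 * exp (- (\<beta> + c) * norm y powr (2 * m))"
          using mult_left_mono[OF w_le[of "real j" "norm y"], of "(norm (vmono \<nu> y))\<^sup>2"] by (simp add: abs_mult)
      qed
    qed measurable
    hence "(\<lambda>j. P * I (real j) * moment \<nu> m q \<gamma> powr (1 / q)) \<longlonglongrightarrow>
        P * moment \<nu> m 2 (\<beta> + c) * moment \<nu> m q \<gamma> powr (1 / q)"
      unfolding integral_vmono_square_exp[OF c(2) m] by (intro tendsto_intros)
    hence "P * moment \<nu> m 2 (\<beta> + c) * moment \<nu> m q \<gamma> powr (1 / q) \<le> C * moment \<nu> m p (c * p + \<alpha>) powr (1 / p)"
      by (rule LIMSEQ_le_const2) (use main in auto)
    thus ?thesis unfolding P_def K_def projection_coefficient[OF m \<beta> c(2)] .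
  qed
  thus ?thesis using C by blast
qed

text \<open>Along the multi-indices equal to \<open>k\<close> on \<open>A\<close>, the quotient of
  the two sides of \<open>P_bounded_moment_le\<close> has logarithm
  \<open>(d k / (2 m)) ln \<Theta> + e (1 / q - 1 / p) ln k\<close> up to a bounded error.\<close>

lemma P_bounded_growth:
  fixes \<alpha> \<beta> \<gamma> p q m :: real and A :: "'n::finite set"
  assumes n: "CARD('n) \<ge> 2" "1 < m" "m < 2" and \<beta>: "\<beta> > 0" and \<gamma>: "\<gamma> > 0"
    and p: "1 \<le> p" and q: "1 \<le> q" and bd: "P_bounded TYPE('n) \<beta> m \<alpha> p \<gamma> q"
    and A: "A \<noteq> {}" and c: "c * p + \<alpha> > 0" "\<beta> + c > 0"
  defines "\<Theta> \<equiv> \<beta>\<^sup>2 * q * (c * p + \<alpha>) / (p * \<gamma> * (\<beta> + c)\<^sup>2)"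
    and "e \<equiv> real (card A) / 2 + real CARD('n) / m - real CARD('n)"
  shows "\<Theta> \<le> 1" "\<Theta> = 1 \<Longrightarrow> e * (1 / q - 1 / p) \<le> 0"
proof -
  define d where "d = real (card A)"
  have d: "d \<ge> 1" using A by (simp add: d_def Suc_le_eq card_gt_0_iff)
  have m: "m > 0" using n by simp
  have p0: "p > 0" and q0: "q > 0" using p q by simp_all
  define \<nu> where "\<nu> k = (\<lambda>i. if i \<in> A then k else 0)" for k :: nat
  define t where "t = c * p + \<alpha>"
  have t: "t > 0" using c by (simp add: t_def)
  \<comment> \<open>The growth common to both moments; it involves neither the exponents nor the
    weights and drops out of the comparison.\<close>
  define X where "X k = real k / 2 * (d / m * ln (real k / 2) + d / m * ln (d / m) - d / m - d * ln d)" for k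
  obtain C where C: "C > 0" "\<And>\<nu> :: 'n \<Rightarrow> nat. (\<beta> / (\<beta> + c)) powr ((real CARD('n) + real (\<Sum>i\<in>UNIV. \<nu> i)) / m) * moment \<nu> m q \<gamma> powr (1 / q) \<le>
      C * moment \<nu> m p t powr (1 / p)"
    using P_bounded_moment_le[OF n \<beta> \<gamma> p q bd] c unfolding t_def by blast
  obtain C1 k1 where C1: "\<And>k. k \<ge> k1 \<Longrightarrow> \<bar>ln (moment (\<nu> k) m q \<gamma>) / q -
      (d * real k / (2 * m) * (ln q - ln \<gamma>) + X k + e / q * ln (real k))\<bar> \<le> C1"
    using moment_asymp[OF A n(2) q0 \<gamma>] unfolding \<nu>_def d_def X_def e_def by blast
  obtain C2 k2 where C2: "\<And>k. k \<ge> k2 \<Longrightarrow> \<bar>ln (moment (\<nu> k) m p t) / p -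
      (d * real k / (2 * m) * (ln p - ln t) + X k + e / p * ln (real k))\<bar> \<le> C2"
    using moment_asymp[OF A n(2) p0 t] unfolding \<nu>_def d_def X_def e_def by blast
  define b where "b = ln (\<beta> / (\<beta> + c))"
  have \<Theta>: "\<Theta> > 0" unfolding \<Theta>_def using \<beta> \<gamma> p q c by (intro divide_pos_pos mult_pos_pos) auto
  have ln\<Theta>: "ln \<Theta> = 2 * b + (ln q - ln \<gamma>) - (ln p - ln t)"
  proof -
    have "\<Theta> = (\<beta> / (\<beta> + c))\<^sup>2 * (q / \<gamma>) / (p / t)" by (simp add: \<Theta>_def t_def power_divide)
    thus ?thesis using \<beta> \<gamma> p q c t by (simp add: b_def ln_mult ln_div ln_realpow)
  qed
  have "real k * (d / (2 * m) * ln \<Theta>) + (e * (1 / q - 1 / p)) * ln (real k) \<le> ln C + C1 + C2 + \<bar>real CARD('n) / m * b\<bar>"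
    if k: "k \<ge> max k1 k2" for k
  proof -
    have Mq: "moment (\<nu> k) m q \<gamma> > 0" using q \<gamma> m by (intro moment_pos) auto
    have Mp: "moment (\<nu> k) m p t > 0" using p t m by (intro moment_pos) auto
    have s: "real (\<Sum>i\<in>UNIV. \<nu> k i) = d * real k" by (simp add: \<nu>_def d_def sum.If_cases)
    have "ln ((\<beta> / (\<beta> + c)) powr ((real CARD('n) + d * real k) / m) * moment (\<nu> k) m q \<gamma> powr (1 / q)) \<le>
        ln (C * moment (\<nu> k) m p t powr (1 / p))"
      using C(2)[of "\<nu> k"] C(1) Mq Mp \<beta> c unfolding s by (subst ln_le_cancel_iff) auto
    hence "(real CARD('n) + d * real k) / m * b + ln (moment (\<nu> k) m q \<gamma>) / q \<le> ln C + ln (moment (\<nu> k) m p t) / p"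
      using Mq Mp C \<beta> c by (simp add: ln_mult b_def)
    hence main: "real CARD('n) / m * b + d * real k / m * b + ln (moment (\<nu> k) m q \<gamma>) / q \<le> ln C + ln (moment (\<nu> k) m p t) / p"
      by (simp add: add_divide_distrib distrib_right)
    have eq1: "real k * (d / (2 * m) * ln \<Theta>) = d * real k / m * b + d * real k / (2 * m) * (ln q - ln \<gamma>) - d * real k / (2 * m) * (ln p - ln t)"
    proof -
      have "K * (d / (2 * m) * (2 * b + x - y)) = d * K / m * b + d * K / (2 * m) * x - d * K / (2 * m) * y" for K x y
        unfolding distrib_left right_diff_distrib by (simp add: mult_ac)
      thus ?thesis unfolding ln\<Theta> .
    qed
    have eq2: "(e * (1 / q - 1 / p)) * ln (real k) = e / q * ln (real k) - e / p * ln (real k)"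
      by (simp add: right_diff_distrib left_diff_distrib)
    have abstract: "U \<le> lC + c1 + c2 + \<bar>v\<bar>"
      if "v + w + x \<le> lC + y" "\<bar>x - (a1 + z + a2)\<bar> \<le> c1" "\<bar>y - (b1 + z + b2)\<bar> \<le> c2" "U = (w + a1 - b1) + (a2 - b2)"
      for U v w x y z a1 a2 b1 b2 lC c1 c2 :: real
      using that by linarith
    have "k \<ge> k1" "k \<ge> k2" using k by auto
    from abstract[OF main C1[OF this(1)] C2[OF this(2)]] show ?thesis
      unfolding eq1 eq2 by simp
  qed
  note lim = linear_log_bounded[where kmin = "max k1 k2", OF this]
  have "d / (2 * m) * ln \<Theta> \<le> 0" using lim(1) by blast
  hence "ln \<Theta> \<le> 0" using d m by (simp add: mult_le_0_iff divide_le_0_iff)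
  thus "\<Theta> \<le> 1" using \<Theta> by (simp add: ln_le_zero_iff)
  show "e * (1 / q - 1 / p) \<le> 0" if "\<Theta> = 1"
    using lim(2) that by simp
qed

text \<open>The exponent \<open>c\<close> of the test functions is free, so
  \<open>\<Theta> \<le> 1\<close> becomes a quadratic inequality in \<open>s\<close>: the line
  \<open>u * s\<close> stays below the parabola \<open>(b + s)^2\<close>. Tangency means
  \<open>u = 4 * b\<close>, which is the equation \<open>q = qmax\<close>.\<close>

lemma P_bounded_necessary:
  fixes \<alpha> \<beta> \<gamma> p q m :: real
  assumes n: "CARD('n::finite) \<ge> 2" "1 < m" "m < 2"
    and H: "1 / 2 + real CARD('n) / m - real CARD('n) < 0" and \<beta>: "\<beta> > 0" and \<gamma>: "\<gamma> > 0"
    and p: "1 \<le> p" and q: "1 \<le> q" and bd: "P_bounded TYPE('n) \<beta> m \<alpha> p \<gamma> q"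
  defines "qmax \<equiv> 4 * \<gamma> / \<beta>\<^sup>2 * (\<beta> - \<alpha> / p)"
  shows "q < qmax \<or> (q = qmax \<and> qmax = p)"
proof -
  define b where "b = \<beta> - \<alpha> / p"
  define u where "u = \<beta>\<^sup>2 * q / \<gamma>"
  have u: "u > 0" using \<beta> q \<gamma> by (simp add: u_def)
  \<comment> \<open>the test exponent is parametrised by \<open>s = (c * p + \<alpha>) / p = (\<beta> + c) - b\<close>\<close>
  have growth: "u * s \<le> (b + s)\<^sup>2" "u * s = (b + s)\<^sup>2 \<Longrightarrow> A \<noteq> {} \<Longrightarrow>
      (real (card A) / 2 + real CARD('n) / m - real CARD('n)) * (1 / q - 1 / p) \<le> 0"
    if s: "s > 0" "b + s > 0" for s and A :: "'n set"
  proof -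
    define c where "c = s - \<alpha> / p"
    have c: "c * p + \<alpha> = p * s" "\<beta> + c = b + s" using p by (auto simp: c_def b_def field_simps)
    have c': "c * p + \<alpha> > 0" "\<beta> + c > 0" unfolding c using s p by auto
    have T: "\<beta>\<^sup>2 * q * (c * p + \<alpha>) / (p * \<gamma> * (\<beta> + c)\<^sup>2) = u * s / (b + s)\<^sup>2"
      unfolding c u_def using p by simp
    note g = P_bounded_growth[OF n \<beta> \<gamma> p q bd _ c', unfolded T]
    have "u * s / (b + s)\<^sup>2 \<le> 1" using g(1)[of UNIV] by simp
    thus "u * s \<le> (b + s)\<^sup>2" using s by (simp add: divide_le_eq)
    show "(real (card A) / 2 + real CARD('n) / m - real CARD('n)) * (1 / q - 1 / p) \<le> 0"
      if "u * s = (b + s)\<^sup>2" "A \<noteq> {}"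
      using g(2)[OF that(2)] that(1) s by simp
  qed
  have b: "b > 0"
  proof (rule ccontr)
    assume "\<not> b > 0"
    \<comment> \<open>The maximiser of \<open>u * s - (b + s)^2\<close>, positive when
      \<open>b \<le> 0\<close>; there the inequality would fail.\<close>
    define s where "s = u / 2 - b"
    have s: "s > 0" "b + s = u / 2" using u \<open>\<not> b > 0\<close> by (auto simp: s_def)
    have "u * s \<le> (u / 2)\<^sup>2" using growth(1)[of s] s u by simp
    moreover have "u * s = u * (- b) + u * u / 2" by (simp add: s_def algebra_simps)
    moreover have "u * (- b) \<ge> 0" using u \<open>\<not> b > 0\<close> by (intro mult_nonneg_nonneg) auto
    moreover have "u * u > 0" using u by simp
    ultimately show False by (simp add: power2_eq_square)
  qed
  \<comment> \<open>\<open>s = b\<close> is the point of tangency of the line of slope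
    \<open>4 * b\<close>, hence the optimal test exponent.\<close>
  have "u * b \<le> (b + b)\<^sup>2" using growth(1)[of b] b by simp
  also have "(b + b)\<^sup>2 = 4 * b * b" by (simp add: power2_eq_square)
  finally have ub: "u \<le> 4 * b" using b by simp
  have qm: "qmax = 4 * b * \<gamma> / \<beta>\<^sup>2" by (simp add: qmax_def b_def)
  have qu: "q = u * \<gamma> / \<beta>\<^sup>2" using \<beta> \<gamma> by (simp add: u_def)
  show ?thesis
  proof (cases "u = 4 * b")
    case False
    hence "u * \<gamma> / \<beta>\<^sup>2 < 4 * b * \<gamma> / \<beta>\<^sup>2"
      using ub \<beta> \<gamma> by (intro divide_strict_right_mono mult_strict_right_mono) auto
    thus ?thesis using qm qu by simp
  next
    case True
    hence crit: "u * b = (b + b)\<^sup>2" by (simp add: power2_eq_square)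
    \<comment> \<open>An arbitrary coordinate, to be the only active one.\<close>
    obtain i :: 'n where "True" by blast
    have "(1 / 2 + real CARD('n) / m - real CARD('n)) * (1 / q - 1 / p) \<le> 0"
      using growth(2)[OF b _ crit, of "{i}"] b by simp
    hence 1: "1 / q - 1 / p \<ge> 0" using H by (simp add: mult_le_0_iff)
    have "(real CARD('n) / 2 + real CARD('n) / m - real CARD('n)) * (1 / q - 1 / p) \<le> 0"
      using growth(2)[OF b _ crit, of UNIV] b by simp
    moreover have "real CARD('n) / 2 + real CARD('n) / m - real CARD('n) > 0"
    proof -
      have "real CARD('n) / 2 < real CARD('n) / m" using n by (intro divide_strict_left_mono) auto
      thus ?thesis by simp
    qed
    ultimately have 2: "1 / q - 1 / p \<le> 0" by (simp add: mult_le_0_iff)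
    have "p = q" using 1 2 p q by (simp add: field_simps)
    moreover have "q = qmax" using qm qu True by simp
    ultimately show ?thesis by simp
  qed
qed

theorem theorem2:
  fixes \<alpha> \<beta> \<gamma> p q m :: real
  assumes "\<beta> > 0" and "\<gamma> > 0"
    and "1 \<le> p" and "1 \<le> q"
    and "2 * real CARD('n::finite) / (2 * real CARD('n) - 1) < m" and "m < 2"
  shows "P_bounded TYPE('n) \<beta> m \<alpha> p \<gamma> q \<longleftrightarrow>
    (let qmax = 4 * \<gamma> / \<beta>\<^sup>2 * (\<beta> - \<alpha> / p) in q < qmax \<or> (q = qmax \<and> qmax = p))"
proof -
  define N where "N = real CARD('n)"
  have N1: "N \<ge> 1" by (simp add: N_def Suc_le_eq)
  hence Nm: "2 * N < m * (2 * N - 1)"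
    using assms(5) unfolding N_def[symmetric] by (simp add: divide_less_eq)
  have m1: "1 < m"
  proof (rule ccontr)
    assume "\<not> 1 < m"
    hence "m * (2 * N - 1) \<le> 1 * (2 * N - 1)" using N1 by (intro mult_right_mono) auto
    thus False using Nm by simp
  qed
  \<comment> \<open>In dimension one the lower bound on \<open>m\<close> would read
    \<open>m > 2\<close>; the two bounds on \<open>m\<close> are compatible only for larger
    \<open>n\<close>.\<close>
  have "CARD('n) \<noteq> 1"
    using Nm assms(6) by (auto simp: N_def)
  hence n: "CARD('n) \<ge> 2" using zero_less_card_finite[where 'a = 'n] by linarith
  have H: "1 / 2 + N / m - N < 0" using Nm m1 by (simp add: field_simps)
  show ?thesis
  proof
    assume "P_bounded TYPE('n) \<beta> m \<alpha> p \<gamma> q"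
    from P_bounded_necessary[OF n m1 assms(6) _ assms(1-4) this] H
    show "let qmax = 4 * \<gamma> / \<beta>\<^sup>2 * (\<beta> - \<alpha> / p) in q < qmax \<or> (q = qmax \<and> qmax = p)"
      unfolding Let_def N_def by blast
  next
    assume "let qmax = 4 * \<gamma> / \<beta>\<^sup>2 * (\<beta> - \<alpha> / p) in q < qmax \<or> (q = qmax \<and> qmax = p)"
    hence "q < 4 * \<gamma> / \<beta>\<^sup>2 * (\<beta> - \<alpha> / p) \<or> (q = p \<and> p = 4 * \<gamma> / \<beta>\<^sup>2 * (\<beta> - \<alpha> / p))"
      unfolding Let_def by auto
    thus "P_bounded TYPE('n) \<beta> m \<alpha> p \<gamma> q"
    proof
      assume "q < 4 * \<gamma> / \<beta>\<^sup>2 * (\<beta> - \<alpha> / p)"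
      thus ?thesis by (intro P_bounded_subcritical n m1 assms)
    next
      assume "q = p \<and> p = 4 * \<gamma> / \<beta>\<^sup>2 * (\<beta> - \<alpha> / p)"
      moreover have "real CARD('n) - real CARD('n) / m \<ge> 1 / 2" using H unfolding N_def by simp
      ultimately show ?thesis using P_bounded_critical[OF n m1 assms(6) _ assms(1-3)] by simp
    qed
  qed
qed

end
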